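(* Let $A\subseteq B$ be Ritt algebras that are integral domains ($A$ a differential subring of $B$), and suppose that $B$ is differentially finitely generated over $A$. Then $B$ contains a nonzero element $s$ for which the embedding $A\subseteq B_s$ has the going-down property for differential ideals.
   Context: Rings are commutative with identity. A differential ring is a ring with a finite set $\Delta$ of pairwise commuting derivations. A Ritt algebra is a differential ring which is an algebra over $\mathbb Q$. $B$ is differentially finitely generated over $A$ if it is generated as an $A$-algebra by finitely many elements together with all their derivatives of all orders. $B_s$ is the localization of $B$ at the powers of $s$ with the induced derivations. A differential ideal is an ideal stable under all derivations in $\Delta$. A differential homomorphism $f\colon A\to B$ has the going-down property for differential ideals if, given any chain $\mathfrak p_1\supseteq\dots\supseteq\mathfrak p_n$ of prime differential ideals of $f(A)$ and any nonempty chain $\mathfrak q_1\supseteq\dots\supseteq\mathfrak q_m$ ($m<n$) of prime differential ideals of $B$ with $\mathfrak q_i\cap f(A)=\mathfrak p_i$ for $1\le i\le m$, the latter can be extended to a chain $\mathfrak q_1\supseteq\dots\supseteq\mathfrak q_n$ of prime differential ideals of $B$ with $\mathfrak q_i\cap f(A)=\mathfrak p_i$ for $1\le i\le n$. *)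

theory Defs
  imports "HOL-Algebra.Algebra"
begin

text \<open>
  A ring with derivations \<open>der R \<delta>\<close> indexed by the elements \<open>\<delta>\<close> of an index set \<open>\<Delta>\<close>.  Indexing the
  derivations by names that do not depend on the ring allows the same \<open>\<Delta>\<close> to act on different rings,
  so that homomorphisms commuting with \<open>\<Delta>\<close> make sense.
\<close>

record ('a, 'd) diff_ring = "'a ring" +
  der :: "'d \<Rightarrow> 'a \<Rightarrow> 'a"

definition derivation :: "('a, 'm) ring_scheme \<Rightarrow> ('a \<Rightarrow> 'a) \<Rightarrow> bool" where
  "derivation R D \<longleftrightarrow>
     D \<in> carrier R \<rightarrow> carrier R \<and>
     (\<forall>x\<in>carrier R. \<forall>y\<in>carrier R. D (x \<oplus>\<^bsub>R\<^esub> y) = D x \<oplus>\<^bsub>R\<^esub> D y) \<and>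
     (\<forall>x\<in>carrier R. \<forall>y\<in>carrier R.
        D (x \<otimes>\<^bsub>R\<^esub> y) = (D x \<otimes>\<^bsub>R\<^esub> y) \<oplus>\<^bsub>R\<^esub> (x \<otimes>\<^bsub>R\<^esub> D y))"

definition differential_ring :: "'d set \<Rightarrow> ('a, 'd, 'm) diff_ring_scheme \<Rightarrow> bool" where
  "differential_ring \<Delta> R \<longleftrightarrow>
     cring R \<and> finite \<Delta> \<and>
     (\<forall>\<delta>\<in>\<Delta>. derivation R (der R \<delta>)) \<and>
     (\<forall>\<delta>\<in>\<Delta>. \<forall>\<epsilon>\<in>\<Delta>. \<forall>x\<in>carrier R. der R \<delta> (der R \<epsilon> x) = der R \<epsilon> (der R \<delta> x))"

abbreviation rat_ring :: "rat ring" where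
  "rat_ring \<equiv> \<lparr>carrier = UNIV, monoid.mult = (*), one = 1, ring.zero = 0, ring.add = (+)\<rparr>"

definition ritt_algebra :: "'d set \<Rightarrow> ('a, 'd, 'm) diff_ring_scheme \<Rightarrow> bool" where
  "ritt_algebra \<Delta> R \<longleftrightarrow>
     differential_ring \<Delta> R \<and>
     (\<exists>sc :: rat \<Rightarrow> 'a \<Rightarrow> 'a.
        algebra rat_ring
          \<lparr>carrier = carrier R, monoid.mult = monoid.mult R, one = one R,
           ring.zero = ring.zero R, ring.add = ring.add R, smult = sc\<rparr>)"

definition differential_subring :: "'d set \<Rightarrow> 'a set \<Rightarrow> ('a, 'd, 'm) diff_ring_scheme \<Rightarrow> bool" where
  "differential_subring \<Delta> A R \<longleftrightarrow>
     subring A R \<and> (\<forall>\<delta>\<in>\<Delta>. \<forall>x\<in>A. der R \<delta> x \<in> A)"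

definition prime_differential_ideal :: "'d set \<Rightarrow> ('a, 'd, 'm) diff_ring_scheme \<Rightarrow> 'a set \<Rightarrow> bool" where
  "prime_differential_ideal \<Delta> R P \<longleftrightarrow>
     primeideal P R \<and> (\<forall>\<delta>\<in>\<Delta>. \<forall>x\<in>P. der R \<delta> x \<in> P)"

definition differential_hom ::
    "'d set \<Rightarrow> ('a, 'd, 'm) diff_ring_scheme \<Rightarrow> ('b, 'd, 'n) diff_ring_scheme \<Rightarrow> ('a \<Rightarrow> 'b) \<Rightarrow> bool" where
  "differential_hom \<Delta> R S f \<longleftrightarrow>
     differential_ring \<Delta> R \<and> differential_ring \<Delta> S \<and> f \<in> ring_hom R S \<and>
     (\<forall>\<delta>\<in>\<Delta>. \<forall>x\<in>carrier R. f (der R \<delta> x) = der S \<delta> (f x))"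

text \<open>The derivatives of all orders (including order \<open>0\<close>) of the elements of \<open>G\<close>.\<close>

definition all_derivatives :: "'d set \<Rightarrow> ('a, 'd, 'm) diff_ring_scheme \<Rightarrow> 'a set \<Rightarrow> 'a set" where
  "all_derivatives \<Delta> R G = {foldr (der R) \<delta>s x | \<delta>s x. set \<delta>s \<subseteq> \<Delta> \<and> x \<in> G}"

definition differentially_finitely_generated ::
    "'d set \<Rightarrow> 'a set \<Rightarrow> ('a, 'd, 'm) diff_ring_scheme \<Rightarrow> bool" where
  "differentially_finitely_generated \<Delta> A B \<longleftrightarrow>
     (\<exists>G. finite G \<and> G \<subseteq> carrier B \<and>
          generate_ring B (A \<union> all_derivatives \<Delta> B G) = carrier B)"

text \<open>
  The localization of \<open>R\<close> at the powers of \<open>s\<close>: the pair \<open>(a, u)\<close> represents the fraction \<open>a / u\<close>,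
  and \<open>fraction R s a u\<close> is its equivalence class.  The derivations are given by the quotient rule.
\<close>

definition powers :: "('a, 'm) ring_scheme \<Rightarrow> 'a \<Rightarrow> 'a set" where
  "powers R s = {s [^]\<^bsub>R\<^esub> n | n :: nat. True}"

definition frac_rel :: "('a, 'm) ring_scheme \<Rightarrow> 'a \<Rightarrow> (('a \<times> 'a) \<times> ('a \<times> 'a)) set" where
  "frac_rel R s =
     {((a, u), (b, v)). a \<in> carrier R \<and> b \<in> carrier R \<and> u \<in> powers R s \<and> v \<in> powers R s \<and>
        (\<exists>t\<in>powers R s. t \<otimes>\<^bsub>R\<^esub> (a \<otimes>\<^bsub>R\<^esub> v) = t \<otimes>\<^bsub>R\<^esub> (b \<otimes>\<^bsub>R\<^esub> u))}"

definition fraction :: "('a, 'm) ring_scheme \<Rightarrow> 'a \<Rightarrow> 'a \<Rightarrow> 'a \<Rightarrow> ('a \<times> 'a) set" where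
  "fraction R s a u = frac_rel R s `` {(a, u)}"

definition localization :: "('a, 'd, 'm) diff_ring_scheme \<Rightarrow> 'a \<Rightarrow> (('a \<times> 'a) set, 'd) diff_ring" where
  "localization R s =
     \<lparr>carrier = (carrier R \<times> powers R s) // frac_rel R s,
      monoid.mult = (\<lambda>M N. \<Union>(a, u)\<in>M. \<Union>(b, v)\<in>N. fraction R s (a \<otimes>\<^bsub>R\<^esub> b) (u \<otimes>\<^bsub>R\<^esub> v)),
      one = fraction R s \<one>\<^bsub>R\<^esub> \<one>\<^bsub>R\<^esub>,
      ring.zero = fraction R s \<zero>\<^bsub>R\<^esub> \<one>\<^bsub>R\<^esub>,
      ring.add = (\<lambda>M N. \<Union>(a, u)\<in>M. \<Union>(b, v)\<in>N.
               fraction R s ((a \<otimes>\<^bsub>R\<^esub> v) \<oplus>\<^bsub>R\<^esub> (b \<otimes>\<^bsub>R\<^esub> u)) (u \<otimes>\<^bsub>R\<^esub> v)),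
      der = (\<lambda>\<delta> M. \<Union>(a, u)\<in>M.
               fraction R s ((der R \<delta> a \<otimes>\<^bsub>R\<^esub> u) \<ominus>\<^bsub>R\<^esub> (a \<otimes>\<^bsub>R\<^esub> der R \<delta> u)) (u \<otimes>\<^bsub>R\<^esub> u))\<rparr>"

definition to_localization :: "('a, 'm) ring_scheme \<Rightarrow> 'a \<Rightarrow> 'a \<Rightarrow> ('a \<times> 'a) set" where
  "to_localization R s a = fraction R s a \<one>\<^bsub>R\<^esub>"

text \<open>
  The prime ideals \<open>p i\<close> live in the image \<open>f(A)\<close>, viewed as a differential subring of \<open>B\<close>.
  Only the values \<open>p i\<close> for \<open>1 \<le> i \<le> n\<close> and \<open>q i\<close>, \<open>q' i\<close> for \<open>i\<close> in the stated ranges matter.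
\<close>

definition going_down ::
    "'d set \<Rightarrow> ('a, 'd, 'm) diff_ring_scheme \<Rightarrow> ('b, 'd, 'n) diff_ring_scheme \<Rightarrow> ('a \<Rightarrow> 'b) \<Rightarrow> bool" where
  "going_down \<Delta> A B f \<longleftrightarrow>
     differential_hom \<Delta> A B f \<and>
     (\<forall>(n::nat) (m::nat) (p :: nat \<Rightarrow> 'b set) (q :: nat \<Rightarrow> 'b set).
        1 \<le> m \<and> m < n \<and>
        (\<forall>i\<in>{1..n}. prime_differential_ideal \<Delta> (B\<lparr>carrier := f ` carrier A\<rparr>) (p i)) \<and>
        (\<forall>i\<in>{1..<n}. p (Suc i) \<subseteq> p i) \<and>
        (\<forall>i\<in>{1..m}. prime_differential_ideal \<Delta> B (q i)) \<and>
        (\<forall>i\<in>{1..<m}. q (Suc i) \<subseteq> q i) \<and>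
        (\<forall>i\<in>{1..m}. q i \<inter> f ` carrier A = p i)
        \<longrightarrow>
        (\<exists>q' :: nat \<Rightarrow> 'b set.
           (\<forall>i\<in>{1..m}. q' i = q i) \<and>
           (\<forall>i\<in>{1..n}. prime_differential_ideal \<Delta> B (q' i)) \<and>
           (\<forall>i\<in>{1..<n}. q' (Suc i) \<subseteq> q' i) \<and>
           (\<forall>i\<in>{1..n}. q' i \<inter> f ` carrier A = p i)))"

end

theory Submission
  imports Defs "HOL-Library.Multiset_Order" "HOL-Library.Product_Lexorder"
begin

text \<open>
  Order all derivatives of the generators of \<open>B\<close> by a ranking and adjoin them to \<open>A\<close> one at a time.
  A derivative that is algebraic over the lower ones has, after inverting an initial, a basis of powers
  over them; all its proper derivatives become rational over lower ones after inverting the separant.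
  By Dickson's lemma finitely many initials and separants suffice, and \<open>s\<close> is their product.  Hence,
  for a prime \<open>p\<close> of \<open>A\<close>, the \<open>A / p\<close>-torsion of \<open>B / p B\<close> is killed by elements outside any prime \<open>q\<close>
  that avoids \<open>s\<close>.  If \<open>p \<subseteq> q\<close>, the differential ideal \<open>p B\<close> is therefore disjoint from the
  multiplicative set \<open>(A - p) (B - q)\<close>, and a differential ideal containing \<open>p B\<close> and maximal subject to
  this is prime, lies in \<open>q\<close> and contracts to \<open>p\<close>.
\<close>

section \<open>Differential ideals maximal with respect to a multiplicative set\<close>

text \<open>\<open>B\<close> is finitely generated only as a differential algebra, so generic
  freeness of finitely generated algebras yields no single denominator: infinitely many derivatives
  are adjoined, and each algebraic one seems to bring its own. Finiteness comes from the shape of a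
  differentiated relation: if \<open>P(y) = 0\<close> is minimal with separant
  \<open>S = P'(y)\<close>, a derivative \<open>y'\<close> satisfies \<open>S y' + T = 0\<close>
  with \<open>T\<close> lower, and all further derivatives satisfy linear relations with the same
  coefficient \<open>S\<close>. The factors of \<open>s\<close> lie in various stages of the tower,
  while \<open>s\<close> need not lie in the early ones. Hence torsion is measured by killers in
  \<open>U \<inter> C\<close>, with \<open>U\<close> the complement of \<open>q\<close>; as
  \<open>q\<close> is an ideal, \<open>s \<in> U\<close> forces every factor of \<open>s\<close>
  into \<open>U\<close>. Rational scalars enter twice: invertible integers make radicals of
  differential ideals differential, and characteristic zero keeps separants nonzero.\<close>

locale diff_cring = cring R for R :: "('a, 'd, 'm) diff_ring_scheme" (structure) +
  fixes \<Delta> :: "'d set"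
  assumes diff: "differential_ring \<Delta> R"
begin

lemma der_closed [simp, intro]: "\<lbrakk>\<delta> \<in> \<Delta>; x \<in> carrier R\<rbrakk> \<Longrightarrow> der R \<delta> x \<in> carrier R"
  using diff unfolding differential_ring_def derivation_def by blast

lemma der_add: "\<lbrakk>\<delta> \<in> \<Delta>; x \<in> carrier R; y \<in> carrier R\<rbrakk> \<Longrightarrow> der R \<delta> (x \<oplus> y) = der R \<delta> x \<oplus> der R \<delta> y"
  using diff unfolding differential_ring_def derivation_def by blast

lemma der_mult:
  "\<lbrakk>\<delta> \<in> \<Delta>; x \<in> carrier R; y \<in> carrier R\<rbrakk> \<Longrightarrow> der R \<delta> (x \<otimes> y) = (der R \<delta> x \<otimes> y) \<oplus> (x \<otimes> der R \<delta> y)"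
  using diff unfolding differential_ring_def derivation_def by blast

lemma der_commute:
  "\<lbrakk>\<delta> \<in> \<Delta>; \<epsilon> \<in> \<Delta>; x \<in> carrier R\<rbrakk> \<Longrightarrow> der R \<delta> (der R \<epsilon> x) = der R \<epsilon> (der R \<delta> x)"
  using diff unfolding differential_ring_def by blast

lemma der_zero [simp]: "\<delta> \<in> \<Delta> \<Longrightarrow> der R \<delta> \<zero> = \<zero>"
  using der_add[of \<delta> \<zero> \<zero>] add.l_cancel_one'[of "der R \<delta> \<zero>" "der R \<delta> \<zero>"] by auto

lemma der_one [simp]: "\<delta> \<in> \<Delta> \<Longrightarrow> der R \<delta> \<one> = \<zero>"
  using der_mult[of \<delta> \<one> \<one>] add.l_cancel_one'[of "der R \<delta> \<one>" "der R \<delta> \<one>"] by auto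

lemma der_minus:
  assumes "\<delta> \<in> \<Delta>" "x \<in> carrier R" shows "der R \<delta> (\<ominus> x) = \<ominus> der R \<delta> x"
proof -
  have "der R \<delta> (\<ominus> x) \<oplus> der R \<delta> x = \<zero>"
    using der_add[of \<delta> "\<ominus> x" x] assms by (simp add: l_neg)
  thus ?thesis using assms minus_equality by simp
qed

text \<open>The power rule is multiplied by \<open>x\<close> so that no exponent
  \<open>n - 1\<close> occurs and \<open>n = 0\<close> is no exception. The integer \<open>n\<close>
  of \<open>R\<close> is written \<open>add_pow R n \<one>\<close>.\<close>

lemma mult_der_pow:
  assumes "\<delta> \<in> \<Delta>" "x \<in> carrier R"
  shows "x \<otimes> der R \<delta> (x [^] (n::nat)) = add_pow R n \<one> \<otimes> (x [^] n \<otimes> der R \<delta> x)"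
proof (induction n)
  case (Suc n)
  have "x \<otimes> der R \<delta> (x [^] Suc n)
      = (x \<otimes> der R \<delta> (x [^] n)) \<otimes> x \<oplus> x \<otimes> x [^] n \<otimes> der R \<delta> x"
    using assms by (simp add: der_mult r_distr m_assoc)
  also have "\<dots> = (add_pow R n \<one> \<otimes> (x [^] n \<otimes> der R \<delta> x)) \<otimes> x \<oplus> x \<otimes> x [^] n \<otimes> der R \<delta> x"
    by (simp only: Suc)
  also have "\<dots> = add_pow R (Suc n) \<one> \<otimes> (x [^] Suc n \<otimes> der R \<delta> x)"
    using assms by (simp add: l_distr r_distr m_ac)
  finally show ?case .
qed (use assms in simp)

lemma der_pow_Suc:
  assumes "\<delta> \<in> \<Delta>" "x \<in> carrier R"
  shows "der R \<delta> (x [^] Suc n) = add_pow R (Suc n) \<one> \<otimes> (x [^] n \<otimes> der R \<delta> x)"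
proof -
  have "der R \<delta> (x [^] Suc n) = x \<otimes> der R \<delta> (x [^] n) \<oplus> x [^] n \<otimes> der R \<delta> x"
    using assms by (simp add: der_mult m_comm a_comm)
  thus ?thesis using assms by (simp add: mult_der_pow l_distr)
qed

definition diff_ideal :: "'a set \<Rightarrow> bool" where
  "diff_ideal I \<longleftrightarrow> ideal I R \<and> (\<forall>\<delta>\<in>\<Delta>. \<forall>x\<in>I. der R \<delta> x \<in> I)"

lemma diff_idealD:
  assumes "diff_ideal I"
  shows "I \<subseteq> carrier R" "\<zero> \<in> I" "\<lbrakk>x \<in> I; y \<in> I\<rbrakk> \<Longrightarrow> x \<oplus> y \<in> I" "x \<in> I \<Longrightarrow> \<ominus> x \<in> I"
    "\<lbrakk>x \<in> I; y \<in> I\<rbrakk> \<Longrightarrow> x \<ominus> y \<in> I"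
    "\<lbrakk>x \<in> I; r \<in> carrier R\<rbrakk> \<Longrightarrow> r \<otimes> x \<in> I" "\<lbrakk>x \<in> I; r \<in> carrier R\<rbrakk> \<Longrightarrow> x \<otimes> r \<in> I"
    "\<lbrakk>\<delta> \<in> \<Delta>; x \<in> I\<rbrakk> \<Longrightarrow> der R \<delta> x \<in> I"
proof -
  interpret ideal I R using assms by (simp add: diff_ideal_def)
  show "I \<subseteq> carrier R" by (rule a_subset)
  show "\<zero> \<in> I" by simp
  show "\<lbrakk>x \<in> I; y \<in> I\<rbrakk> \<Longrightarrow> x \<oplus> y \<in> I" by simp
  show "x \<in> I \<Longrightarrow> \<ominus> x \<in> I" by simp
  show "\<lbrakk>x \<in> I; y \<in> I\<rbrakk> \<Longrightarrow> x \<ominus> y \<in> I" by (simp add: a_minus_def)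
  show "\<lbrakk>x \<in> I; r \<in> carrier R\<rbrakk> \<Longrightarrow> r \<otimes> x \<in> I" "\<lbrakk>x \<in> I; r \<in> carrier R\<rbrakk> \<Longrightarrow> x \<otimes> r \<in> I"
    using I_l_closed I_r_closed by auto
  show "\<lbrakk>\<delta> \<in> \<Delta>; x \<in> I\<rbrakk> \<Longrightarrow> der R \<delta> x \<in> I" using assms by (simp add: diff_ideal_def)
qed

lemma diff_idealI:
  assumes "I \<subseteq> carrier R" "\<zero> \<in> I" "\<And>x y. \<lbrakk>x \<in> I; y \<in> I\<rbrakk> \<Longrightarrow> x \<oplus> y \<in> I"
    "\<And>x r. \<lbrakk>x \<in> I; r \<in> carrier R\<rbrakk> \<Longrightarrow> r \<otimes> x \<in> I" "\<And>\<delta> x. \<lbrakk>\<delta> \<in> \<Delta>; x \<in> I\<rbrakk> \<Longrightarrow> der R \<delta> x \<in> I"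
  shows "diff_ideal I"
proof -
  have neg: "\<ominus> x \<in> I" if "x \<in> I" for x
    using assms(4)[OF that, of "\<ominus> \<one>"] that assms(1) by (auto simp: l_minus)
  have "subgroup I (add_monoid R)"
    using assms(1-3) neg by (intro add.subgroupI) (auto simp: a_inv_def)
  hence "ideal I R"
    using assms(1,4) m_comm by (intro idealI[OF ring_axioms]) (auto simp: subset_iff)
  thus ?thesis using assms(5) by (simp add: diff_ideal_def)
qed

section \<open>Prime differential ideals when positive integers are invertible\<close>

context
  assumes divisible: "\<And>n::nat. n > 0 \<Longrightarrow> \<exists>r\<in>carrier R. r \<otimes> add_pow R n \<one> = \<one>"
begin

text \<open>With \<open>y\<close> the derivative of \<open>x\<close>, differentiating
  \<open>x^(n+1) y^k\<close> and multiplying by \<open>y\<close> gives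
  \<open>(n+1) x^n y^(k+2)\<close> plus a multiple of the original element. As \<open>n+1\<close> is
  invertible, one factor \<open>x\<close> is traded for two factors \<open>y\<close>.\<close>

lemma diff_ideal_pow_step:
  assumes Q: "diff_ideal Q" and \<delta>: "\<delta> \<in> \<Delta>" and x: "x \<in> carrier R"
    and mem: "x [^] Suc n \<otimes> der R \<delta> x [^] (k::nat) \<in> Q"
  shows "x [^] n \<otimes> der R \<delta> x [^] (k + 2) \<in> Q"
proof -
  define y where "y = der R \<delta> x"
  have y: "y \<in> carrier R" using \<delta> x by (simp add: y_def)
  obtain r where r: "r \<in> carrier R" "r \<otimes> add_pow R (Suc n) \<one> = \<one>" using divisible by blast
  have "der R \<delta> (x [^] Suc n \<otimes> y [^] k) =
      add_pow R (Suc n) \<one> \<otimes> (x [^] n \<otimes> y) \<otimes> y [^] k \<oplus> x [^] Suc n \<otimes> der R \<delta> (y [^] k)"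
    using der_mult[OF \<delta>, of "x [^] Suc n" "y [^] k"] x y der_pow_Suc[OF \<delta> x, of n]
    unfolding y_def by simp
  hence "y \<otimes> der R \<delta> (x [^] Suc n \<otimes> y [^] k) =
      y \<otimes> (add_pow R (Suc n) \<one> \<otimes> (x [^] n \<otimes> y) \<otimes> y [^] k) \<oplus> x [^] Suc n \<otimes> (y \<otimes> der R \<delta> (y [^] k))"
    using x y \<delta> by (simp add: r_distr m_ac)
  also have "\<dots> = add_pow R (Suc n) \<one> \<otimes> (x [^] n \<otimes> y [^] (k + 2))
      \<oplus> (add_pow R k \<one> \<otimes> der R \<delta> y) \<otimes> (x [^] Suc n \<otimes> y [^] k)"
    unfolding mult_der_pow[OF \<delta> y] using x y \<delta>
    by (simp add: m_ac del: add_pow_rdistr_int add.nat_pow_Suc)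
  finally have eq: "y \<otimes> der R \<delta> (x [^] Suc n \<otimes> y [^] k) = add_pow R (Suc n) \<one> \<otimes> (x [^] n \<otimes> y [^] (k + 2))
      \<oplus> (add_pow R k \<one> \<otimes> der R \<delta> y) \<otimes> (x [^] Suc n \<otimes> y [^] k)" .
  let ?z = "x [^] n \<otimes> y [^] (k + 2)"
  note D = diff_idealD[OF Q]
  have mem': "x [^] Suc n \<otimes> y [^] k \<in> Q" using mem by (simp add: y_def)
  have 1: "y \<otimes> der R \<delta> (x [^] Suc n \<otimes> y [^] k) \<in> Q" using D(8)[OF \<delta> mem'] D(6) y by blast
  have 2: "(add_pow R k \<one> \<otimes> der R \<delta> y) \<otimes> (x [^] Suc n \<otimes> y [^] k) \<in> Q"
    using D(6)[OF mem'] y \<delta> by simp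
  have "add_pow R (Suc n) \<one> \<otimes> ?z = y \<otimes> der R \<delta> (x [^] Suc n \<otimes> y [^] k) \<ominus>
       (add_pow R k \<one> \<otimes> der R \<delta> y) \<otimes> (x [^] Suc n \<otimes> y [^] k)"
    unfolding eq using x y \<delta>
    by (simp add: a_minus_def a_assoc r_neg del: add.nat_pow_Suc nat_pow_Suc)
  hence "add_pow R (Suc n) \<one> \<otimes> ?z \<in> Q" using D(5)[OF 1 2] by simp
  hence "r \<otimes> (add_pow R (Suc n) \<one> \<otimes> ?z) \<in> Q" using D(6) r by blast
  moreover have "r \<otimes> (add_pow R (Suc n) \<one> \<otimes> ?z) = ?z"
    using r x y by (simp add: m_assoc[symmetric] del: add.nat_pow_Suc)
  ultimately show ?thesis by (simp add: y_def)
qed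

text \<open>Trading all \<open>n\<close> factors of \<open>x^n\<close> by
  \<open>diff_ideal_pow_step\<close> leaves the power \<open>2 n\<close> of the derivative of
  \<open>x\<close>, so the derivative lies in the radical too.\<close>

lemma diff_ideal_radical:
  assumes Q: "diff_ideal Q"
  shows "diff_ideal {x \<in> carrier R. \<exists>n::nat. x [^] n \<in> Q}"
proof (rule diff_idealI)
  note D = diff_idealD[OF Q]
  show "\<zero> \<in> {x \<in> carrier R. \<exists>n::nat. x [^] n \<in> Q}"
    using D(2) by (auto intro!: exI[of _ "1::nat"])
  fix x assume x: "x \<in> {x \<in> carrier R. \<exists>n::nat. x [^] n \<in> Q}"
  then obtain n :: nat where xc: "x \<in> carrier R" and n: "x [^] n \<in> Q" by blast
  {
    fix r assume "r \<in> carrier R"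
    thus "r \<otimes> x \<in> {x \<in> carrier R. \<exists>n::nat. x [^] n \<in> Q}"
      using D(6)[OF n, of "r [^] n"] xc by (auto simp: nat_pow_distrib intro!: exI[of _ n])
  }
  {
    fix \<delta> assume \<delta>: "\<delta> \<in> \<Delta>"
    have "x [^] (n - j) \<otimes> der R \<delta> x [^] (2 * j) \<in> Q" if "j \<le> n" for j
      using that
    proof (induction j)
      case 0
      then show ?case using n xc by simp
    next
      case (Suc j)
      hence "Suc (n - Suc j) = n - j" by simp
      hence "x [^] (n - Suc j) \<otimes> der R \<delta> x [^] (2 * j + 2) \<in> Q"
        using Suc diff_ideal_pow_step[OF Q \<delta> xc, of "n - Suc j" "2 * j"] by simp
      then show ?case by (simp add: add.commute)
    qed
    from this[of n] show "der R \<delta> x \<in> {x \<in> carrier R. \<exists>n::nat. x [^] n \<in> Q}"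
      using xc \<delta> by auto
  }
  fix y assume "y \<in> {x \<in> carrier R. \<exists>n::nat. x [^] n \<in> Q}"
  then obtain m :: nat where yc: "y \<in> carrier R" and m: "y [^] m \<in> Q" by blast
  \<comment> \<open>In place of the binomial theorem, one factor \<open>x \<oplus> y\<close> is
    split off at a time; once none is left, \<open>i + j = n + m\<close> forces
    \<open>i \<ge> n\<close> or \<open>j \<ge> m\<close>.\<close>
  have "x [^] i \<otimes> y [^] j \<otimes> (x \<oplus> y) [^] k \<in> Q" if "i + j + k = n + m" for i j k :: nat
    using that
  proof (induction k arbitrary: i j)
    case 0
    hence "i \<ge> n \<or> j \<ge> m" by linarith
    then show ?case
    proof
      assume "i \<ge> n"
      then obtain l where "i = n + l" using le_Suc_ex by blast
      hence "x [^] i = x [^] n \<otimes> x [^] l" using xc by (simp add: nat_pow_mult)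
      thus ?thesis using D(7)[OF n, of "x [^] l \<otimes> y [^] j"] xc yc by (simp add: m_assoc)
    next
      assume "j \<ge> m"
      then obtain l where "j = m + l" using le_Suc_ex by blast
      hence "y [^] j = y [^] m \<otimes> y [^] l" using yc by (simp add: nat_pow_mult)
      thus ?thesis using D(6)[OF m, of "x [^] i \<otimes> y [^] l"] xc yc by (simp add: m_ac)
    qed
  next
    case (Suc k)
    have "x [^] i \<otimes> y [^] j \<otimes> (x \<oplus> y) [^] Suc k =
       x [^] Suc i \<otimes> y [^] j \<otimes> (x \<oplus> y) [^] k \<oplus> x [^] i \<otimes> y [^] Suc j \<otimes> (x \<oplus> y) [^] k"
    proof -
      have "u \<otimes> (x \<oplus> y) = u \<otimes> x \<oplus> u \<otimes> y" if "u \<in> carrier R" for u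
        using that xc yc by (simp add: r_distr)
      from this[of "x [^] i \<otimes> y [^] j \<otimes> (x \<oplus> y) [^] k"] show ?thesis
        using xc yc by (simp add: m_ac)
    qed
    moreover have "x [^] Suc i \<otimes> y [^] j \<otimes> (x \<oplus> y) [^] k \<in> Q" "x [^] i \<otimes> y [^] Suc j \<otimes> (x \<oplus> y) [^] k \<in> Q"
      using Suc.prems Suc.IH[of "Suc i" j] Suc.IH[of i "Suc j"] by simp_all
    ultimately show ?case using D(3) by metis
  qed
  from this[of 0 0 "n + m"] show "x \<oplus> y \<in> {x \<in> carrier R. \<exists>n::nat. x [^] n \<in> Q}"
    using xc yc by auto
qed auto

text \<open>For \<open>w = a \<otimes> der R \<delta> x\<close>, the product of \<open>w\<close>
  with the derivative of \<open>a \<otimes> x\<close> is \<open>w\<close> squared plus a multiple of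
  \<open>a \<otimes> x\<close>. Hence \<open>w\<close> squared lies in \<open>Q\<close>, and the
  radical hypothesis removes the square.\<close>

lemma diff_ideal_quotient:
  assumes Q: "diff_ideal Q" and a: "a \<in> carrier R"
    and radical: "\<And>x n. \<lbrakk>x \<in> carrier R; x [^] (n::nat) \<in> Q\<rbrakk> \<Longrightarrow> x \<in> Q"
  shows "diff_ideal {x \<in> carrier R. a \<otimes> x \<in> Q}"
proof (rule diff_idealI)
  note D = diff_idealD[OF Q]
  fix x assume x: "x \<in> {x \<in> carrier R. a \<otimes> x \<in> Q}"
  {
    fix r assume "r \<in> carrier R"
    thus "r \<otimes> x \<in> {x \<in> carrier R. a \<otimes> x \<in> Q}" using D(6)[of "a \<otimes> x" r] x a by (auto simp: m_ac)
  }
  {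
    fix \<delta> assume \<delta>: "\<delta> \<in> \<Delta>"
    define w where "w = a \<otimes> der R \<delta> x"
    have c: "x \<in> carrier R" "w \<in> carrier R" "der R \<delta> a \<in> carrier R" "der R \<delta> x \<in> carrier R"
      using \<delta> x a by (auto simp: w_def)
    have "w [^] (2::nat) = w \<otimes> der R \<delta> (a \<otimes> x) \<ominus> (der R \<delta> a \<otimes> der R \<delta> x) \<otimes> (a \<otimes> x)"
    proof -
      have "w \<otimes> der R \<delta> (a \<otimes> x) = w \<otimes> w \<oplus> w \<otimes> (der R \<delta> a \<otimes> x)"
        using c a \<delta> by (simp add: der_mult w_def r_distr a_comm)
      moreover have "w \<otimes> (der R \<delta> a \<otimes> x) = (der R \<delta> a \<otimes> der R \<delta> x) \<otimes> (a \<otimes> x)"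
        using c a \<delta> by (simp add: w_def m_ac)
      ultimately show ?thesis using c a
        by (simp add: a_minus_def a_assoc r_neg numeral_2_eq_2)
    qed
    also have "\<dots> \<in> Q" using D(5,6,8) c a x \<delta> by auto
    finally have "w \<in> Q" using radical c by blast
    thus "der R \<delta> x \<in> {x \<in> carrier R. a \<otimes> x \<in> Q}" using c by (simp add: w_def)
  }
  fix y assume "y \<in> {x \<in> carrier R. a \<otimes> x \<in> Q}"
  thus "x \<oplus> y \<in> {x \<in> carrier R. a \<otimes> x \<in> Q}" using D(3) x a by (auto simp: r_distr)
qed (use a diff_idealD[OF Q] in auto)

lemma diff_ideal_Union_chain:
  assumes "\<C> \<noteq> {}" "\<And>I. I \<in> \<C> \<Longrightarrow> diff_ideal I" "\<And>I J. \<lbrakk>I \<in> \<C>; J \<in> \<C>\<rbrakk> \<Longrightarrow> I \<subseteq> J \<or> J \<subseteq> I"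
  shows "diff_ideal (\<Union>\<C>)"
proof (rule diff_idealI)
  show "\<Union>\<C> \<subseteq> carrier R" "\<zero> \<in> \<Union>\<C>" using assms(1,2) diff_idealD(1,2) by blast+
  fix x assume "x \<in> \<Union>\<C>"
  then obtain I where I: "I \<in> \<C>" "x \<in> I" by blast
  {
    fix r assume "r \<in> carrier R"
    thus "r \<otimes> x \<in> \<Union>\<C>" using I diff_idealD(6)[OF assms(2)] by blast
  }
  {
    fix \<delta> assume "\<delta> \<in> \<Delta>"
    thus "der R \<delta> x \<in> \<Union>\<C>" using I diff_idealD(8)[OF assms(2)] by blast
  }
  fix y assume "y \<in> \<Union>\<C>"
  then obtain J where J: "J \<in> \<C>" "y \<in> J" by blast
  from assms(3)[OF I(1) J(1)] show "x \<oplus> y \<in> \<Union>\<C>"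
    using I J diff_idealD(3)[OF assms(2)] by (meson UnionI subsetD)
qed

text \<open>The usual argument enlarges a maximal \<open>Q\<close> to \<open>Q + (a)\<close>, which
  need not be differential. The radical of \<open>Q\<close> and the quotients \<open>(Q : a)\<close>
  are differential and contain \<open>Q\<close>, so maximality is tested against these
  instead.\<close>

theorem prime_differential_ideal_avoiding:
  assumes I: "diff_ideal I" and U: "\<one> \<in> U" "\<And>u v. \<lbrakk>u \<in> U; v \<in> U\<rbrakk> \<Longrightarrow> u \<otimes> v \<in> U"
    and UI: "I \<inter> U = {}" and Uc: "U \<subseteq> carrier R"
  shows "\<exists>Q. prime_differential_ideal \<Delta> R Q \<and> I \<subseteq> Q \<and> Q \<inter> U = {}"
proof -
  define \<A> where "\<A> = {J. diff_ideal J \<and> I \<subseteq> J \<and> J \<inter> U = {}}"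
  have "\<exists>Q\<in>\<A>. \<forall>J\<in>\<A>. Q \<subseteq> J \<longrightarrow> J = Q"
  proof (rule subset_Zorn_nonempty)
    show "\<A> \<noteq> {}" using I UI by (auto simp: \<A>_def)
    fix \<C> assume ne: "\<C> \<noteq> {}" and ch: "subset.chain \<A> \<C>"
    have sub: "\<C> \<subseteq> \<A>" using ch by (simp add: subset.chain_def)
    have "diff_ideal (\<Union>\<C>)"
      using ne sub subset_chain_def[of \<A> \<C>] ch by (intro diff_ideal_Union_chain) (auto simp: \<A>_def)
    moreover have "I \<subseteq> \<Union>\<C>" "\<Union>\<C> \<inter> U = {}" using ne sub by (auto simp: \<A>_def)
    ultimately show "\<Union>\<C> \<in> \<A>" by (simp add: \<A>_def)
  qed
  then obtain Q where Q: "diff_ideal Q" "I \<subseteq> Q" "Q \<inter> U = {}"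
    and max: "\<And>J. \<lbrakk>diff_ideal J; Q \<subseteq> J; J \<inter> U = {}\<rbrakk> \<Longrightarrow> J = Q"
    by (auto simp: \<A>_def)
  note D = diff_idealD[OF Q(1)]
  have upow: "u [^] (n::nat) \<in> U" if "u \<in> U" for u n
    using that U by (induction n) auto
  have radical: "x \<in> Q" if "x \<in> carrier R" "x [^] (n::nat) \<in> Q" for x n
  proof -
    have "{x \<in> carrier R. \<exists>n::nat. x [^] n \<in> Q} = Q"
    proof (rule max[OF diff_ideal_radical[OF Q(1)]])
      show "Q \<subseteq> {x \<in> carrier R. \<exists>n::nat. x [^] n \<in> Q}"
        using D(1) by (auto intro!: exI[of _ "1::nat"] simp: subset_iff)
      show "{x \<in> carrier R. \<exists>n::nat. x [^] n \<in> Q} \<inter> U = {}" using upow Q(3) by blast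
    qed
    thus ?thesis using that by blast
  qed
  \<comment> \<open>If \<open>b \<notin> Q\<close>, the quotient \<open>(Q : a)\<close> contains
    \<open>b\<close> and is strictly larger than \<open>Q\<close>, so by maximality it meets
    \<open>U\<close>.\<close>
  have meet: "\<exists>u\<in>U. a \<otimes> u \<in> Q" if "a \<in> carrier R" "b \<in> carrier R" "a \<otimes> b \<in> Q" "b \<notin> Q" for a b
  proof (rule ccontr)
    assume no: "\<not> (\<exists>u\<in>U. a \<otimes> u \<in> Q)"
    have "{x \<in> carrier R. a \<otimes> x \<in> Q} = Q"
    proof (rule max)
      show "diff_ideal {x \<in> carrier R. a \<otimes> x \<in> Q}"
        by (rule diff_ideal_quotient[OF Q(1) that(1) radical])
      show "Q \<subseteq> {x \<in> carrier R. a \<otimes> x \<in> Q}" using D(1,6) that(1) by blast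
      show "{x \<in> carrier R. a \<otimes> x \<in> Q} \<inter> U = {}" using no by blast
    qed
    thus False using that by blast
  qed
  have "primeideal Q R"
  proof (rule primeidealI)
    show "ideal Q R" using Q(1) by (simp add: diff_ideal_def)
    show "cring R" by (rule is_cring)
    show "carrier R \<noteq> Q" using U(1) Q(3) by auto
    fix a b assume ab: "a \<in> carrier R" "b \<in> carrier R" "a \<otimes> b \<in> Q"
    show "a \<in> Q \<or> b \<in> Q"
    proof (rule ccontr)
      assume n: "\<not> (a \<in> Q \<or> b \<in> Q)"
      then obtain u where u: "u \<in> U" "a \<otimes> u \<in> Q" using meet ab by blast
      have uc: "u \<in> carrier R" using u Uc by blast
      \<comment> \<open>Now \<open>meet\<close> is used again, with \<open>u\<close> as multiplier
        and \<open>a\<close> as the element outside \<open>Q\<close>; this puts a product of two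
        elements of \<open>U\<close> into \<open>Q\<close>.\<close>
      have "u \<otimes> a \<in> Q" using u uc ab by (simp add: m_comm)
      then obtain v where "v \<in> U" "u \<otimes> v \<in> Q" using meet[OF uc ab(1)] n by blast
      thus False using U(2)[OF u(1)] Q(3) by blast
    qed
  qed
  thus ?thesis using Q D(8) by (auto simp: prime_differential_ideal_def)
qed

end

end

lemma ritt_algebra_divisible:
  assumes "ritt_algebra \<Delta> R" and "(n::nat) > 0"
  shows "\<exists>r\<in>carrier R. r \<otimes>\<^bsub>R\<^esub> add_pow R n \<one>\<^bsub>R\<^esub> = \<one>\<^bsub>R\<^esub>"
proof -
  have "cring R" using assms by (simp add: ritt_algebra_def differential_ring_def)
  then interpret cring R .
  obtain sc where "algebra rat_ring
          \<lparr>carrier = carrier R, monoid.mult = monoid.mult R, one = one R,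
           ring.zero = ring.zero R, ring.add = ring.add R, smult = sc\<rparr>" (is "algebra _ ?M")
    using assms by (auto simp: ritt_algebra_def)
  then interpret M: algebra rat_ring ?M .
  have cl: "sc a \<one>\<^bsub>R\<^esub> \<in> carrier R" for a using M.smult_closed[of a "\<one>\<^bsub>R\<^esub>"] by simp
  have add: "sc (a + b) \<one>\<^bsub>R\<^esub> = sc a \<one>\<^bsub>R\<^esub> \<oplus>\<^bsub>R\<^esub> sc b \<one>\<^bsub>R\<^esub>" for a b
    using M.smult_l_distr[of a b "\<one>\<^bsub>R\<^esub>"] by simp
  have zero: "sc 0 \<one>\<^bsub>R\<^esub> = \<zero>\<^bsub>R\<^esub>"
    using add[of 0 0] add.l_cancel_one'[of "sc 0 \<one>\<^bsub>R\<^esub>" "sc 0 \<one>\<^bsub>R\<^esub>"] cl by auto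
  have one: "sc 1 \<one>\<^bsub>R\<^esub> = \<one>\<^bsub>R\<^esub>" using M.smult_one[of "\<one>\<^bsub>R\<^esub>"] by simp
  have "sc a \<one>\<^bsub>R\<^esub> \<otimes>\<^bsub>R\<^esub> add_pow R k \<one>\<^bsub>R\<^esub> = sc (a * of_nat k) \<one>\<^bsub>R\<^esub>" for a and k :: nat
    by (induction k) (simp_all add: zero r_distr cl add distrib_left add.commute a_comm)
  from this[of "1 / of_nat n" n] show ?thesis using assms(2) cl one by auto
qed

section \<open>Torsion along a tower of subrings\<close>

text \<open>Common skeleton of \<open>ideal_span\<close> and \<open>poly_span\<close>: sums grow by
  one summand, so facts about spans follow by rule induction without index sets.\<close>

inductive_set additive_closure :: "('a, 'm) ring_scheme \<Rightarrow> 'a set \<Rightarrow> 'a set" for R and W where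
  zero: "\<zero>\<^bsub>R\<^esub> \<in> additive_closure R W"
| add: "\<lbrakk>x \<in> W; z \<in> additive_closure R W\<rbrakk> \<Longrightarrow> x \<oplus>\<^bsub>R\<^esub> z \<in> additive_closure R W"

definition ideal_span :: "('a, 'm) ring_scheme \<Rightarrow> 'a set \<Rightarrow> 'a set \<Rightarrow> 'a set" where
  "ideal_span R p C = additive_closure R {x \<otimes>\<^bsub>R\<^esub> c | x c. x \<in> p \<and> c \<in> C}"

text \<open>\<open>S\<close> is only a set because two cases matter: a subring \<open>C\<close>,
  giving a lattice \<open>M\<close> of polynomial expressions in \<open>y\<close>, and the ideal
  \<open>p C\<close>, giving the sublattice \<open>p M\<close>.\<close>

definition poly_span :: "('a, 'm) ring_scheme \<Rightarrow> 'a set \<Rightarrow> 'a \<Rightarrow> nat set \<Rightarrow> 'a set" where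
  "poly_span R S y D = additive_closure R {c \<otimes>\<^bsub>R\<^esub> y [^]\<^bsub>R\<^esub> i | c i. c \<in> S \<and> i \<in> D}"

text \<open>Coefficients are total functions, so their whole range is confined to \<open>C\<close>;
  for a subring this costs nothing, because values from \<open>n\<close> on can be set to
  zero.\<close>

definition indep_powers :: "('a, 'm) ring_scheme \<Rightarrow> 'a set \<Rightarrow> 'a \<Rightarrow> nat \<Rightarrow> bool" where
  "indep_powers R C y n \<longleftrightarrow>
     (\<forall>c. range c \<subseteq> C \<longrightarrow> (\<Oplus>\<^bsub>R\<^esub>i\<in>{..<n}. c i \<otimes>\<^bsub>R\<^esub> y [^]\<^bsub>R\<^esub> i) = \<zero>\<^bsub>R\<^esub> \<longrightarrow> (\<forall>i<n. c i = \<zero>\<^bsub>R\<^esub>))"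

text \<open>
  For a prime \<open>p\<close> of \<open>A\<close>, \<open>a \<in> A - p\<close> and a multiplicative set \<open>U\<close>: the \<open>a\<close>-torsion of \<open>C / p C\<close>
  dies in the localization at \<open>U \<inter> C\<close>.
\<close>

definition torsion_killed :: "('a, 'm) ring_scheme \<Rightarrow> 'a set \<Rightarrow> 'a \<Rightarrow> 'a set \<Rightarrow> 'a set \<Rightarrow> bool" where
  "torsion_killed R p a U C \<longleftrightarrow>
     (\<forall>b\<in>C. a \<otimes>\<^bsub>R\<^esub> b \<in> ideal_span R p C \<longrightarrow> (\<exists>t\<in>U \<inter> C. t \<otimes>\<^bsub>R\<^esub> b \<in> ideal_span R p C))"

text \<open>After inverting \<open>h\<close>, the ring \<open>C[y]\<close> is free over
  \<open>C\<close> on the powers with exponent in \<open>D\<close>. This \<open>D\<close> is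
  \<open>UNIV\<close> for a transcendental \<open>y\<close> and \<open>{..<d}\<close> for an
  algebraic one; being downward closed, it is exhausted by initial segments, to which
  \<open>indep_powers\<close> refers.\<close>

definition tame_extension :: "('a, 'm) ring_scheme \<Rightarrow> 'a set \<Rightarrow> 'a set \<Rightarrow> 'a \<Rightarrow> bool" where
  "tame_extension R U C y \<longleftrightarrow>
     (\<exists>h\<in>U \<inter> C. \<exists>D. 0 \<in> D \<and> (\<forall>i\<in>D. h \<otimes>\<^bsub>R\<^esub> y [^]\<^bsub>R\<^esub> Suc i \<in> poly_span R C y D) \<and>
        (\<forall>n. {..<n} \<subseteq> D \<longrightarrow> indep_powers R C y n) \<and> (\<forall>i\<in>D. \<forall>j<i. j \<in> D))"

context cring
begin

lemma additive_closure_closed: "W \<subseteq> carrier R \<Longrightarrow> additive_closure R W \<subseteq> carrier R"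
proof
  fix z assume "z \<in> additive_closure R W" "W \<subseteq> carrier R"
  thus "z \<in> carrier R" by induction auto
qed

lemma additive_closure_incl: "\<lbrakk>W \<subseteq> carrier R; x \<in> W\<rbrakk> \<Longrightarrow> x \<in> additive_closure R W"
  using additive_closure.add[OF _ additive_closure.zero, of x W R] by (auto simp: subset_iff)

lemma additive_closure_add:
  assumes W: "W \<subseteq> carrier R" and w: "w \<in> additive_closure R W" and z: "z \<in> additive_closure R W"
  shows "w \<oplus> z \<in> additive_closure R W"
  using w
proof induction
  case zero
  then show ?case using z additive_closure_closed[OF W] by auto
next
  case (add x w)
  have "x \<oplus> w \<oplus> z = x \<oplus> (w \<oplus> z)"
    using add additive_closure_closed[OF W] z W by (intro a_assoc) auto
  then show ?case using additive_closure.add[OF add(1,3)] by simp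
qed

lemma additive_closure_mult:
  assumes "W \<subseteq> carrier R" "Y \<subseteq> carrier R" "r \<in> carrier R"
    and "\<And>x. x \<in> W \<Longrightarrow> r \<otimes> x \<in> additive_closure R Y" and "z \<in> additive_closure R W"
  shows "r \<otimes> z \<in> additive_closure R Y"
  using assms(5)
proof induction
  case zero
  then show ?case using assms(3) additive_closure.zero[of R Y] by simp
next
  case (add x z)
  have "r \<otimes> (x \<oplus> z) = r \<otimes> x \<oplus> r \<otimes> z"
    using add assms(1,3) additive_closure_closed[OF assms(1)] by (intro r_distr) auto
  then show ?case using additive_closure_add[OF assms(2,4)] add by simp
qed

lemma additive_closure_mono:
  assumes "W \<subseteq> Y" shows "additive_closure R W \<subseteq> additive_closure R Y"
proof
  fix z assume "z \<in> additive_closure R W"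
  thus "z \<in> additive_closure R Y" using assms
    by induction (auto intro: additive_closure.intros)
qed

lemma ideal_span_props:
  assumes "p \<subseteq> carrier R" "subring C R"
  shows ideal_span_closed: "ideal_span R p C \<subseteq> carrier R"
    and ideal_span_zero: "\<zero> \<in> ideal_span R p C"
    and ideal_span_add: "\<lbrakk>w \<in> ideal_span R p C; z \<in> ideal_span R p C\<rbrakk> \<Longrightarrow> w \<oplus> z \<in> ideal_span R p C"
    and ideal_span_mult: "\<lbrakk>c \<in> C; z \<in> ideal_span R p C\<rbrakk> \<Longrightarrow> c \<otimes> z \<in> ideal_span R p C"
    and ideal_span_gen: "\<lbrakk>x \<in> p; c \<in> C\<rbrakk> \<Longrightarrow> x \<otimes> c \<in> ideal_span R p C"
proof -
  note C = subringE[OF assms(2)]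
  have W: "{x \<otimes> c | x c. x \<in> p \<and> c \<in> C} \<subseteq> carrier R" using assms C(1) by auto
  show "ideal_span R p C \<subseteq> carrier R" "\<zero> \<in> ideal_span R p C"
    using additive_closure_closed[OF W] additive_closure.zero by (auto simp: ideal_span_def)
  show "\<lbrakk>w \<in> ideal_span R p C; z \<in> ideal_span R p C\<rbrakk> \<Longrightarrow> w \<oplus> z \<in> ideal_span R p C"
    using additive_closure_add[OF W] by (simp add: ideal_span_def)
  show gen: "\<lbrakk>x \<in> p; c \<in> C\<rbrakk> \<Longrightarrow> x \<otimes> c \<in> ideal_span R p C" for x c
    using additive_closure_incl[OF W, of "x \<otimes> c"] by (auto simp: ideal_span_def)
  show "\<lbrakk>c \<in> C; z \<in> ideal_span R p C\<rbrakk> \<Longrightarrow> c \<otimes> z \<in> ideal_span R p C"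
    unfolding ideal_span_def
  proof (rule additive_closure_mult[OF W W])
    fix w assume c: "c \<in> C" and "w \<in> {x \<otimes> c | x c. x \<in> p \<and> c \<in> C}"
    then obtain x d where w: "w = x \<otimes> d" "x \<in> p" "d \<in> C" by blast
    have "c \<otimes> w = x \<otimes> (c \<otimes> d)" using w c assms(1) C(1) by (simp add: m_lcomm subset_iff)
    thus "c \<otimes> w \<in> additive_closure R {x \<otimes> c | x c. x \<in> p \<and> c \<in> C}"
      using gen[OF w(2) C(6)[OF c w(3)]] by (simp add: ideal_span_def)
  qed (use C(1) in auto)
qed

lemma ideal_span_mono: "C \<subseteq> C' \<Longrightarrow> ideal_span R p C \<subseteq> ideal_span R p C'"
  unfolding ideal_span_def by (intro additive_closure_mono) auto

lemma poly_span_props: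
  assumes "S \<subseteq> carrier R" "y \<in> carrier R"
  shows poly_span_closed: "poly_span R S y D \<subseteq> carrier R"
    and poly_span_zero: "\<zero> \<in> poly_span R S y D"
    and poly_span_add: "\<lbrakk>w \<in> poly_span R S y D; z \<in> poly_span R S y D\<rbrakk> \<Longrightarrow> w \<oplus> z \<in> poly_span R S y D"
    and poly_span_gen: "\<lbrakk>c \<in> S; i \<in> D\<rbrakk> \<Longrightarrow> c \<otimes> y [^] i \<in> poly_span R S y D"
proof -
  have W: "{c \<otimes> y [^] i | c i. c \<in> S \<and> i \<in> D} \<subseteq> carrier R" using assms by auto
  show "poly_span R S y D \<subseteq> carrier R" "\<zero> \<in> poly_span R S y D"
    using additive_closure_closed[OF W] additive_closure.zero by (auto simp: poly_span_def)
  show "\<lbrakk>w \<in> poly_span R S y D; z \<in> poly_span R S y D\<rbrakk> \<Longrightarrow> w \<oplus> z \<in> poly_span R S y D"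
    using additive_closure_add[OF W] by (simp add: poly_span_def)
  show "\<lbrakk>c \<in> S; i \<in> D\<rbrakk> \<Longrightarrow> c \<otimes> y [^] i \<in> poly_span R S y D" for c i
    using additive_closure_incl[OF W, of "c \<otimes> y [^] i"] by (auto simp: poly_span_def)
qed

lemma poly_span_mult:
  assumes "S \<subseteq> carrier R" "T \<subseteq> carrier R" "y \<in> carrier R" "r \<in> carrier R"
    and "\<And>s i. \<lbrakk>s \<in> S; i \<in> D\<rbrakk> \<Longrightarrow> r \<otimes> (s \<otimes> y [^] i) \<in> poly_span R T y D"
    and "z \<in> poly_span R S y D"
  shows "r \<otimes> z \<in> poly_span R T y D"
  unfolding poly_span_def
proof (rule additive_closure_mult)
  show "{c \<otimes> y [^] i | c i. c \<in> S \<and> i \<in> D} \<subseteq> carrier R" "{c \<otimes> y [^] i | c i. c \<in> T \<and> i \<in> D} \<subseteq> carrier R"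
    using assms(1-3) by auto
  show "r \<otimes> x \<in> additive_closure R {c \<otimes> y [^] i | c i. c \<in> T \<and> i \<in> D}"
    if "x \<in> {c \<otimes> y [^] i | c i. c \<in> S \<and> i \<in> D}" for x
    using that assms(5) by (auto simp: poly_span_def)
qed (use assms(4,6) in \<open>simp_all add: poly_span_def\<close>)

lemma poly_span_scale:
  assumes "S \<subseteq> carrier R" "T \<subseteq> carrier R" "y \<in> carrier R" "r \<in> carrier R"
    and "\<And>s. s \<in> S \<Longrightarrow> r \<otimes> s \<in> T" and "z \<in> poly_span R S y D"
  shows "r \<otimes> z \<in> poly_span R T y D"
proof (rule poly_span_mult[OF assms(1-4) _ assms(6)])
  fix s i assume "s \<in> S" "i \<in> D"
  have "r \<otimes> (s \<otimes> y [^] i) = (r \<otimes> s) \<otimes> y [^] i"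
    using assms \<open>s \<in> S\<close> by (simp add: m_assoc subset_iff)
  thus "r \<otimes> (s \<otimes> y [^] i) \<in> poly_span R T y D"
    using poly_span_gen[OF assms(2,3) assms(5)[OF \<open>s \<in> S\<close>] \<open>i \<in> D\<close>] by simp
qed

lemma poly_span_finsum:
  assumes S: "S \<subseteq> carrier R" and y: "y \<in> carrier R"
    and c: "\<And>i. i < n \<Longrightarrow> c i \<in> S" and D: "{..<n} \<subseteq> D"
  shows "(\<Oplus>i\<in>{..<n}. c i \<otimes> y [^] (i::nat)) \<in> poly_span R S y D"
  using c D
proof (induction n)
  case (Suc n)
  have cS: "c i \<in> carrier R" if "i < Suc n" for i using Suc.prems(1)[OF that] S by blast
  have "(\<Oplus>i\<in>{..<Suc n}. c i \<otimes> y [^] i) = c n \<otimes> y [^] n \<oplus> (\<Oplus>i\<in>{..<n}. c i \<otimes> y [^] i)"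
    unfolding lessThan_Suc using cS y by (subst finsum_insert) auto
  moreover have "c n \<otimes> y [^] n \<in> poly_span R S y D"
    using poly_span_gen[OF S y] Suc.prems by auto
  moreover have "(\<Oplus>i\<in>{..<n}. c i \<otimes> y [^] i) \<in> poly_span R S y D"
    using Suc.prems by (intro Suc.IH) auto
  ultimately show ?case using poly_span_add[OF S y] by simp
qed (simp add: poly_span_zero[OF S y])

text \<open>A normal form with an initial segment of exponents and zero padding, so that two
  elements of spans can be brought to a common length and compared by coefficients.\<close>

lemma poly_span_repr:
  assumes S: "S \<subseteq> carrier R" "\<zero> \<in> S" "\<And>u v. \<lbrakk>u \<in> S; v \<in> S\<rbrakk> \<Longrightarrow> u \<oplus> v \<in> S"
    and y: "y \<in> carrier R" and D: "\<And>i j. \<lbrakk>i \<in> D; j < i\<rbrakk> \<Longrightarrow> j \<in> D" and z: "z \<in> poly_span R S y D"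
  shows "\<exists>n c. range c \<subseteq> S \<and> {..<n} \<subseteq> D \<and> (\<forall>i\<ge>n. c i = \<zero>) \<and> z = (\<Oplus>i\<in>{..<n}. c i \<otimes> y [^] (i::nat))"
  using z unfolding poly_span_def
proof induction
  case zero
  show ?case using S(2) by (intro exI[of _ 0] exI[of _ "\<lambda>_. \<zero>"]) auto
next
  case (add x z)
  then obtain n c where c: "range c \<subseteq> S" "{..<n} \<subseteq> D" "\<And>i. i \<ge> n \<Longrightarrow> c i = \<zero>"
    and z: "z = (\<Oplus>i\<in>{..<n}. c i \<otimes> y [^] i)" by blast
  obtain s j where s: "x = s \<otimes> y [^] j" "s \<in> S" "j \<in> D" using add by blast
  define N where "N = max n (Suc j)"
  define e where "e = (\<lambda>i. if i = j then s else \<zero>)"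
  have cS: "c i \<in> S" "c i \<in> carrier R" "e i \<in> S" "e i \<in> carrier R" for i
    using c(1) S(1,2) s(2) by (auto simp: e_def)
  have "z = (\<Oplus>i\<in>{..<N}. c i \<otimes> y [^] i)"
    unfolding z using cS y c(3)
    by (intro add.finprod_mono_neutral_cong_left) (auto simp: N_def)
  moreover have "x = (\<Oplus>i\<in>{..<N}. e i \<otimes> y [^] i)"
  proof -
    have "(\<Oplus>i\<in>{..<N}. e i \<otimes> y [^] i) = (\<Oplus>i\<in>{..<N}. if j = i then s \<otimes> y [^] i else \<zero>)"
      using cS y s S by (intro finsum_cong') (auto simp: e_def)
    also have "\<dots> = s \<otimes> y [^] j"
      using y s S by (intro finsum_singleton) (auto simp: N_def)
    finally show ?thesis using s by simp
  qed
  ultimately have "x \<oplus> z = (\<Oplus>i\<in>{..<N}. e i \<otimes> y [^] i \<oplus> c i \<otimes> y [^] i)"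
    using cS y by (subst finsum_addf) auto
  also have "\<dots> = (\<Oplus>i\<in>{..<N}. (e i \<oplus> c i) \<otimes> y [^] i)"
    using cS y by (intro finsum_cong') (auto simp: l_distr)
  finally have "x \<oplus> z = (\<Oplus>i\<in>{..<N}. (e i \<oplus> c i) \<otimes> y [^] i)" .
  moreover have "range (\<lambda>i. e i \<oplus> c i) \<subseteq> S" using cS S(3) by auto
  moreover have "{..<N} \<subseteq> D"
  proof
    fix i assume "i \<in> {..<N}"
    hence "i < n \<or> i = j \<or> i < j" by (auto simp: N_def)
    thus "i \<in> D" using c(2) s(3) D by auto
  qed
  moreover have "\<forall>i\<ge>N. e i \<oplus> c i = \<zero>" using c(3) by (auto simp: N_def e_def)
  ultimately show ?case by (intro exI[of _ N] exI[of _ "\<lambda>i. e i \<oplus> c i"]) auto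
qed

text \<open>
  The elements that some power of \<open>h\<close> makes act on the lattice \<open>M = poly_span R C y D\<close> form a ring
  containing \<open>C\<close> and \<open>y\<close>; this avoids any reduction algorithm.
\<close>

lemma generate_ring_lattice:
  assumes C: "subring C R" and y: "y \<in> carrier R" and h: "h \<in> C"
    and red: "\<And>i. i \<in> D \<Longrightarrow> h \<otimes> y [^] Suc i \<in> poly_span R C y D"
    and b: "b \<in> generate_ring R (insert y C)"
  shows "\<exists>k::nat. \<forall>m\<in>poly_span R C y D. h [^] k \<otimes> b \<otimes> m \<in> poly_span R C y D"
  using b
proof induction
  let ?M = "poly_span R C y D"
  note CE = subringE[OF C]
  have hc: "h \<in> carrier R" using h CE(1) by blast
  note M = poly_span_props[OF CE(1) y, where D=D]
  have scale: "c \<otimes> m \<in> ?M" if "c \<in> C" "m \<in> ?M" for c m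
    using that CE(1,6) by (intro poly_span_scale[OF CE(1) CE(1) y]) auto
  have hpow: "h [^] (k::nat) \<in> C" for k
    by (induction k) (use CE(3,6) h in auto)
  have gc: "b \<in> carrier R" if "b \<in> generate_ring R (insert y C)" for b
    using that CE(1) y generate_ring_in_carrier[of "insert y C"] by auto
  {
    case one
    show ?case using M(1) by (intro exI[of _ 0]) auto
  next
    case (incl b)
    show ?case
    proof (cases "b = y")
      case True
      \<comment> \<open>One factor \<open>h\<close> suffices for \<open>y\<close>: each monomial is
        raised by one exponent, and \<open>red\<close> brings \<open>h\<close> times the raised
        power back into \<open>?M\<close>.\<close>
      have "h \<otimes> y \<otimes> m \<in> ?M" if "m \<in> ?M" for m
      proof (rule poly_span_mult[OF CE(1) CE(1) y _ _ that])
        fix c i assume ci: "c \<in> C" "i \<in> D"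
        have "h \<otimes> y \<otimes> (c \<otimes> y [^] i) = c \<otimes> (h \<otimes> y [^] Suc i)"
          using ci y hc CE(1) by (simp add: m_ac subset_iff)
        thus "h \<otimes> y \<otimes> (c \<otimes> y [^] i) \<in> ?M" using scale red ci by simp
      qed (use hc y in simp)
      thus ?thesis using True hc by (intro exI[of _ 1]) auto
    next
      case False
      hence "b \<in> C" using incl by blast
      thus ?thesis using scale CE(1) by (intro exI[of _ 0]) auto
    qed
  next
    case (a_inv b)
    then obtain k :: nat where k: "\<And>m. m \<in> ?M \<Longrightarrow> h [^] k \<otimes> b \<otimes> m \<in> ?M" by blast
    have "h [^] k \<otimes> (\<ominus> b) \<otimes> m \<in> ?M" if "m \<in> ?M" for m
    proof -
      have "h [^] k \<otimes> (\<ominus> b) \<otimes> m = (\<ominus> \<one>) \<otimes> (h [^] k \<otimes> b \<otimes> m)"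
        using that M(1) hc gc[OF a_inv(1)] by (simp add: l_minus r_minus subset_iff)
      thus ?thesis using scale[OF _ k[OF that]] CE(3,5) by simp
    qed
    thus ?case by blast
  next
    case (eng_add b1 b2)
    then obtain k1 k2 :: nat where k: "\<And>m. m \<in> ?M \<Longrightarrow> h [^] k1 \<otimes> b1 \<otimes> m \<in> ?M"
      "\<And>m. m \<in> ?M \<Longrightarrow> h [^] k2 \<otimes> b2 \<otimes> m \<in> ?M" by blast
    \<comment> \<open>Each summand needs only its own power of \<open>h\<close>; the remaining power
      lies in \<open>C\<close> and merely scales the lattice.\<close>
    have "h [^] (k1 + k2) \<otimes> (b1 \<oplus> b2) \<otimes> m \<in> ?M" if "m \<in> ?M" for m
    proof -
      have "h [^] (k1 + k2) \<otimes> (b1 \<oplus> b2) \<otimes> m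
          = h [^] k2 \<otimes> (h [^] k1 \<otimes> b1 \<otimes> m) \<oplus> h [^] k1 \<otimes> (h [^] k2 \<otimes> b2 \<otimes> m)"
        using that M(1) hc gc[OF eng_add(1)] gc[OF eng_add(2)]
        by (simp add: nat_pow_mult[symmetric] l_distr r_distr m_ac subset_iff)
      thus ?thesis using M(3) scale[OF hpow] k that by simp
    qed
    thus ?case by blast
  next
    case (eng_mult b1 b2)
    then obtain k1 k2 :: nat where k: "\<And>m. m \<in> ?M \<Longrightarrow> h [^] k1 \<otimes> b1 \<otimes> m \<in> ?M"
      "\<And>m. m \<in> ?M \<Longrightarrow> h [^] k2 \<otimes> b2 \<otimes> m \<in> ?M" by blast
    have "h [^] (k1 + k2) \<otimes> (b1 \<otimes> b2) \<otimes> m \<in> ?M" if "m \<in> ?M" for m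
    proof -
      have "h [^] (k1 + k2) \<otimes> (b1 \<otimes> b2) \<otimes> m = h [^] k1 \<otimes> b1 \<otimes> (h [^] k2 \<otimes> b2 \<otimes> m)"
        using that M(1) hc gc[OF eng_mult(1)] gc[OF eng_mult(2)]
        by (simp add: nat_pow_mult[symmetric] m_ac subset_iff)
      thus ?thesis using k that by simp
    qed
    thus ?case by blast
  }
qed

text \<open>In coordinates along the powers of \<open>y\<close>, torsion of \<open>b\<close> modulo
  the extension of \<open>p\<close> means, up to a power of \<open>h\<close>, that \<open>a\<close>
  times each coefficient of \<open>b\<close> lies in \<open>p C\<close>. The hypothesis on
  \<open>C\<close> kills these finitely many coefficients, and the product of the killers with the
  power of \<open>h\<close> kills \<open>b\<close>.\<close>

lemma torsion_killed_step:
  assumes C: "subring C R" and y: "y \<in> carrier R"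
    and U: "\<one> \<in> U" "\<And>u v. \<lbrakk>u \<in> U; v \<in> U\<rbrakk> \<Longrightarrow> u \<otimes> v \<in> U"
    and p: "p \<subseteq> C" and a: "a \<in> C"
    and ext: "tame_extension R U C y" and IH: "torsion_killed R p a U C"
  shows "torsion_killed R p a U (generate_ring R (insert y C))"
proof -
  note CE = subringE[OF C]
  obtain h D where hUC: "h \<in> U \<inter> C" and D0: "0 \<in> D"
    and red': "\<forall>i\<in>D. h \<otimes> y [^] Suc i \<in> poly_span R C y D"
    and indep': "\<forall>n. {..<n} \<subseteq> D \<longrightarrow> indep_powers R C y n" and down: "\<forall>i\<in>D. \<forall>j<i. j \<in> D"
    using ext unfolding tame_extension_def by (elim bexE exE conjE) (rule that)
  have h: "h \<in> U" "h \<in> C" and D: "0 \<in> D" "\<And>i j. \<lbrakk>i \<in> D; j < i\<rbrakk> \<Longrightarrow> j \<in> D"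
    and red: "\<And>i. i \<in> D \<Longrightarrow> h \<otimes> y [^] Suc i \<in> poly_span R C y D"
    and indep: "\<And>n. {..<n} \<subseteq> D \<Longrightarrow> indep_powers R C y n"
    using hUC D0 red' indep' down by simp_all
  define C' where "C' = generate_ring R (insert y C)"
  have C': "subring C' R" unfolding C'_def using y CE(1) by (intro generate_ring_is_subring) auto
  note CE' = subringE[OF C']
  have sub: "C \<subseteq> C'" "y \<in> C'" unfolding C'_def by (auto intro: generate_ring.incl)
  have pc: "p \<subseteq> carrier R" using p CE(1) by blast
  let ?J = "ideal_span R p C"
  let ?J' = "ideal_span R p C'"
  let ?M = "poly_span R C y D"
  let ?N = "poly_span R ?J y D"
  note J = ideal_span_props[OF pc C]
  note J' = ideal_span_props[OF pc C']
  note M = poly_span_props[OF CE(1) y, where D=D]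
  note N = poly_span_props[OF J(1) y, where D=D]
  have hc: "h \<in> carrier R" using h CE(1) by blast
  have hC: "h [^] (k::nat) \<in> C" for k by (induction k) (use CE(3,6) h in auto)
  have hU: "h [^] (k::nat) \<in> U" for k by (induction k) (use U h in auto)
  have scaleM: "c \<otimes> m \<in> ?M" if "c \<in> C" "m \<in> ?M" for c m
    using that CE(1,6) by (intro poly_span_scale[OF CE(1) CE(1) y]) auto
  have scaleN: "c \<otimes> m \<in> ?N" if "c \<in> C" "m \<in> ?N" for c m
    using that CE(1) J(4) by (intro poly_span_scale[OF J(1) J(1) y]) auto
  have pM: "x \<otimes> m \<in> ?N" if "x \<in> p" "m \<in> ?M" for x m
    using that pc J(5) by (intro poly_span_scale[OF CE(1) J(1) y]) auto
  \<comment> \<open>Here \<open>0 \<in> D\<close> matters: as the lattice contains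
    \<open>\<one>\<close>, a power of \<open>h\<close> that makes \<open>b\<close> act on the
    lattice moves \<open>b\<close> itself into it.\<close>
  have one: "\<one> \<in> ?M" using M(4)[OF CE(3) D(1)] by simp
  have toM: "\<exists>k::nat. h [^] k \<otimes> b \<in> ?M" if "b \<in> C'" for b
  proof -
    have "\<exists>k::nat. \<forall>m\<in>?M. h [^] k \<otimes> b \<otimes> m \<in> ?M"
      using generate_ring_lattice[OF C y h(2) red] that unfolding C'_def by blast
    then obtain k :: nat where "h [^] k \<otimes> b \<otimes> \<one> \<in> ?M" using one by blast
    moreover have "b \<in> carrier R" using that CE'(1) by blast
    ultimately show ?thesis using hc by auto
  qed
  \<comment> \<open>Generators \<open>x \<otimes> c\<close> are treated one by one: a power of
    \<open>h\<close> moves \<open>c\<close> into \<open>?M\<close>, and \<open>x \<in> p\<close>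
    then moves it into \<open>?N\<close>. Exponents of successive summands add.\<close>
  have toN: "\<exists>k::nat. h [^] k \<otimes> z \<in> ?N" if "z \<in> ?J'" for z
    using that unfolding ideal_span_def[of R p C']
  proof induction
    case zero
    show ?case using N(2) hc by auto
  next
    case (add w z)
    then obtain x c where w: "w = x \<otimes> c" "x \<in> p" "c \<in> C'" by blast
    obtain k where k: "h [^] (k::nat) \<otimes> c \<in> ?M" using toM[OF w(3)] by blast
    obtain l where l: "h [^] (l::nat) \<otimes> z \<in> ?N" using add by blast
    have zc: "z \<in> carrier R" using add(2) J'(1) by (auto simp: ideal_span_def)
    have "h [^] (k + l) \<otimes> (w \<oplus> z) = h [^] l \<otimes> (x \<otimes> (h [^] k \<otimes> c)) \<oplus> h [^] k \<otimes> (h [^] l \<otimes> z)"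
      using w pc CE'(1) zc hc by (simp add: nat_pow_mult[symmetric] r_distr m_ac subset_iff)
    thus ?case using N(3) scaleN[OF hC] pM[OF w(2) k] l by metis
  qed
  have NJ': "?N \<subseteq> ?J'"
  proof
    fix z assume "z \<in> ?N"
    thus "z \<in> ?J'" unfolding poly_span_def
    proof induction
      case zero
      show ?case by (rule J'(2))
    next
      case (add w z)
      then obtain c and i :: nat where w: "w = c \<otimes> y [^] i" "c \<in> ?J" by blast
      have "y [^] i \<in> C'" by (induction i) (use CE'(3,6) sub in auto)
      moreover have "c \<in> ?J'" using w(2) ideal_span_mono[OF sub(1)] by blast
      ultimately have "y [^] i \<otimes> c \<in> ?J'" using J'(4) by blast
      moreover have "w = y [^] i \<otimes> c" using w y J(1) by (simp add: m_comm subset_iff)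
      ultimately show ?case using J'(3) add(3) by simp
    qed
  qed
  show ?thesis unfolding torsion_killed_def C'_def[symmetric]
  proof (intro ballI impI)
    fix b assume b: "b \<in> C'" and ab: "a \<otimes> b \<in> ?J'"
    have bc: "b \<in> carrier R" and ac: "a \<in> carrier R" using b a CE(1) CE'(1) by auto
    obtain k where k: "h [^] (k::nat) \<otimes> b \<in> ?M" using toM[OF b] by blast
    obtain l where l: "h [^] (l::nat) \<otimes> (a \<otimes> b) \<in> ?N" using toN[OF ab] by blast
    \<comment> \<open>One power for both tasks: \<open>k\<close> factors move \<open>b\<close> into
      \<open>?M\<close>, \<open>l\<close> factors move \<open>a \<otimes> b\<close> into
      \<open>?N\<close>, and surplus factors do no harm.\<close>
    define g where "g = h [^] (k + l)"
    have g: "g \<in> U" "g \<in> C" "g \<in> carrier R" using hU hC hc by (auto simp: g_def)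
    have "g \<otimes> b = h [^] l \<otimes> (h [^] k \<otimes> b)"
      using hc bc by (simp add: g_def nat_pow_mult[symmetric] m_ac)
    hence gbM: "g \<otimes> b \<in> ?M" using scaleM[OF hC k] by simp
    have "\<exists>n c. range c \<subseteq> C \<and> {..<n} \<subseteq> D \<and> (\<forall>i\<ge>n. c i = \<zero>) \<and> g \<otimes> b = (\<Oplus>i\<in>{..<n}. c i \<otimes> y [^] i)"
      by (rule poly_span_repr[OF CE(1,2) _ y _ gbM]) (use CE(7) D(2) in auto)
    then obtain n c where c: "range c \<subseteq> C" "{..<n} \<subseteq> D" "\<And>i. i \<ge> n \<Longrightarrow> c i = \<zero>"
      and gb: "g \<otimes> b = (\<Oplus>i\<in>{..<n}. c i \<otimes> y [^] i)"
      by blast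
    have "g \<otimes> (a \<otimes> b) = h [^] k \<otimes> (h [^] l \<otimes> (a \<otimes> b))"
      using hc bc ac by (simp add: g_def nat_pow_mult[symmetric] m_ac)
    hence gabN: "g \<otimes> (a \<otimes> b) \<in> ?N" using scaleN[OF hC l] by simp
    have "\<exists>n c. range c \<subseteq> ?J \<and> {..<n} \<subseteq> D \<and> (\<forall>i\<ge>n. c i = \<zero>) \<and> g \<otimes> (a \<otimes> b) = (\<Oplus>i\<in>{..<n}. c i \<otimes> y [^] i)"
      by (rule poly_span_repr[OF J(1,2) _ y _ gabN]) (use J(3) D(2) in auto)
    then obtain n' e where e: "range e \<subseteq> ?J" "{..<n'} \<subseteq> D" "\<And>i. i \<ge> n' \<Longrightarrow> e i = \<zero>"
      and gab: "g \<otimes> (a \<otimes> b) = (\<Oplus>i\<in>{..<n'}. e i \<otimes> y [^] i)"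
      by blast
    have JC: "?J \<subseteq> C"
    proof
      fix z assume "z \<in> ?J"
      thus "z \<in> C" unfolding ideal_span_def by induction (use CE(2,6,7) p in auto)
    qed
    define m where "m = max n n'"
    have cC: "c i \<in> C" "c i \<in> carrier R" "e i \<in> C" "e i \<in> ?J" "e i \<in> carrier R" for i
      using c(1) e(1) CE(1) JC by auto
    have gb': "g \<otimes> b = (\<Oplus>i\<in>{..<m}. c i \<otimes> y [^] i)"
      unfolding gb using cC y c(3) by (intro add.finprod_mono_neutral_cong_left) (auto simp: m_def)
    have gab': "g \<otimes> (a \<otimes> b) = (\<Oplus>i\<in>{..<m}. e i \<otimes> y [^] i)"
      unfolding gab using cC y e(3) by (intro add.finprod_mono_neutral_cong_left) (auto simp: m_def)
    \<comment> \<open>Two expansions of the same element are subtracted, \<open>a\<close> times that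
      of \<open>g \<otimes> b\<close> and that of \<open>g \<otimes> (a \<otimes> b)\<close>;
      independence then equates coefficients.\<close>
    have "(\<Oplus>i\<in>{..<m}. (a \<otimes> c i \<oplus> \<ominus> e i) \<otimes> y [^] i)
        = (\<Oplus>i\<in>{..<m}. a \<otimes> (c i \<otimes> y [^] i) \<oplus> (\<ominus> \<one>) \<otimes> (e i \<otimes> y [^] i))"
      using cC ac y by (intro finsum_cong') (auto simp: l_distr l_minus m_assoc)
    also have "\<dots> = a \<otimes> (g \<otimes> b) \<oplus> (\<ominus> \<one>) \<otimes> (g \<otimes> (a \<otimes> b))"
      unfolding gb' gab' using cC ac y by (subst finsum_addf) (auto simp: finsum_rdistr)
    also have "\<dots> = \<zero>" using ac bc g by (simp add: l_minus m_lcomm[of g a] r_neg)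
    finally have "(\<Oplus>i\<in>{..<m}. (a \<otimes> c i \<oplus> \<ominus> e i) \<otimes> y [^] i) = \<zero>" .
    moreover have "range (\<lambda>i. a \<otimes> c i \<oplus> \<ominus> e i) \<subseteq> C" using cC a CE(5,6,7) by auto
    moreover have "{..<m} \<subseteq> D" using c(2) e(2) by (auto simp: m_def max_def)
    ultimately have z: "a \<otimes> c i \<oplus> \<ominus> e i = \<zero>" if "i < m" for i
      using indep[of m] that unfolding indep_powers_def by blast
    have ace: "a \<otimes> c i = e i" if "i < m" for i
      using z[OF that] cC ac by (simp add: a_minus_def[symmetric])
    have "\<exists>t\<in>U \<inter> C. t \<otimes> c i \<in> ?J" if "i < m" for i
      using IH cC(1,4)[of i] ace[OF that] unfolding torsion_killed_def by simp
    then obtain t where t: "\<And>i. i < m \<Longrightarrow> t i \<in> U \<inter> C" "\<And>i. i < m \<Longrightarrow> t i \<otimes> c i \<in> ?J" by metis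
    \<comment> \<open>Induction on \<open>j\<close> multiplies the individual killers
      \<open>t i\<close> into a single one.\<close>
    have "\<exists>s\<in>U \<inter> C. \<forall>i<j. s \<otimes> c i \<in> ?J" if "j \<le> m" for j
      using that
    proof (induction j)
      case 0
      show ?case using U(1) CE(3) by auto
    next
      case (Suc j)
      then obtain s where s: "s \<in> U" "s \<in> C" "\<And>i. i < j \<Longrightarrow> s \<otimes> c i \<in> ?J" by auto
      have tj: "t j \<in> U" "t j \<in> C" "t j \<otimes> c j \<in> ?J" using t Suc.prems by auto
      have car: "s \<in> carrier R" "t j \<in> carrier R" using s tj CE(1) by auto
      have "s \<otimes> t j \<otimes> c i \<in> ?J" if "i < Suc j" for i
      proof (cases "i = j")
        case True
        thus ?thesis using J(4)[OF s(2) tj(3)] car cC by (simp add: m_assoc)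
      next
        case False
        hence "t j \<otimes> (s \<otimes> c i) \<in> ?J" using J(4)[OF tj(2) s(3)] that by simp
        moreover have "t j \<otimes> (s \<otimes> c i) = s \<otimes> t j \<otimes> c i" using car cC by (simp add: m_ac)
        ultimately show ?thesis by simp
      qed
      thus ?case using U(2) CE(6) s tj by (intro bexI[of _ "s \<otimes> t j"]) auto
    qed
    then obtain s where s: "s \<in> U" "s \<in> C" "\<And>i. i < m \<Longrightarrow> s \<otimes> c i \<in> ?J" by blast
    have sc: "s \<in> carrier R" using s CE(1) by blast
    have "s \<otimes> (g \<otimes> b) = (\<Oplus>i\<in>{..<m}. (s \<otimes> c i) \<otimes> y [^] i)"
      unfolding gb' using sc cC y by (subst finsum_rdistr) (auto intro!: finsum_cong' simp: m_assoc)
    also have "\<dots> \<in> ?N"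
      by (rule poly_span_finsum[OF J(1) y]) (use s(3) \<open>{..<m} \<subseteq> D\<close> in auto)
    finally have "s \<otimes> g \<otimes> b \<in> ?J'" using NJ' sc g bc by (auto simp: m_assoc)
    thus "\<exists>t\<in>U \<inter> C'. t \<otimes> b \<in> ?J'"
      using s g U(2) CE(6) sub by (intro bexI[of _ "s \<otimes> g"]) auto
  qed
qed

end

section \<open>Well-ordered towers of tame extensions\<close>

context cring
begin

text \<open>At the bottom there is no torsion: \<open>p A\<close> is \<open>p\<close> itself, and
  the last hypothesis cancels \<open>a\<close>, so \<open>\<one>\<close> serves as killer.\<close>

lemma torsion_killed_base:
  assumes A: "subring A R" and p: "p \<subseteq> A" "\<zero> \<in> p" "\<And>x z. \<lbrakk>x \<in> p; z \<in> p\<rbrakk> \<Longrightarrow> x \<oplus> z \<in> p"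
    "\<And>x c. \<lbrakk>x \<in> p; c \<in> A\<rbrakk> \<Longrightarrow> x \<otimes> c \<in> p" and U: "\<one> \<in> U"
    and prime: "\<And>b. \<lbrakk>b \<in> A; a \<otimes> b \<in> p\<rbrakk> \<Longrightarrow> b \<in> p"
  shows "torsion_killed R p a U A"
  unfolding torsion_killed_def
proof (intro ballI impI)
  note AE = subringE[OF A]
  have sub: "z \<in> p" if "z \<in> ideal_span R p A" for z
    using that unfolding ideal_span_def by induction (use p in auto)
  fix b assume b: "b \<in> A" "a \<otimes> b \<in> ideal_span R p A"
  hence "b \<in> p" using prime sub by blast
  moreover have "p \<subseteq> carrier R" using p(1) AE(1) by blast
  ultimately have "b \<otimes> \<one> \<in> ideal_span R p A" using ideal_span_gen[OF _ A] AE(3) by blast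
  moreover have "b \<otimes> \<one> = \<one> \<otimes> b" using b(1) AE(1) by auto
  ultimately show "\<exists>t\<in>U \<inter> A. t \<otimes> b \<in> ideal_span R p A" using U AE(3) by auto
qed

lemma generate_ring_finite_support:
  assumes "b \<in> generate_ring R (A \<union> x ` Y)"
  shows "\<exists>F. finite F \<and> F \<subseteq> Y \<and> b \<in> generate_ring R (A \<union> x ` F)"
proof -
  have mono: "generate_ring R (A \<union> x ` F) \<subseteq> generate_ring R (A \<union> x ` F')" if "F \<subseteq> F'" for F F'
  proof
    fix z assume "z \<in> generate_ring R (A \<union> x ` F)"
    thus "z \<in> generate_ring R (A \<union> x ` F')"
      using that by induction (auto intro: generate_ring.intros)
  qed
  show ?thesis using assms
  proof induction
    case one
    show ?case by (intro exI[of _ "{}"]) (auto intro: generate_ring.intros)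
  next
    case (incl h)
    show ?case
    proof (cases "h \<in> A")
      case True
      thus ?thesis by (intro exI[of _ "{}"]) (auto intro: generate_ring.intros)
    next
      case False
      then obtain i where "i \<in> Y" "h = x i" using incl by blast
      thus ?thesis by (intro exI[of _ "{i}"]) (auto intro: generate_ring.intros)
    qed
  next
    case (a_inv h)
    thus ?case by (blast intro: generate_ring.intros)
  next
    case (eng_add h1 h2)
    then obtain F1 F2 where F: "finite F1" "F1 \<subseteq> Y" "h1 \<in> generate_ring R (A \<union> x ` F1)"
      "finite F2" "F2 \<subseteq> Y" "h2 \<in> generate_ring R (A \<union> x ` F2)" by blast
    have "h1 \<oplus> h2 \<in> generate_ring R (A \<union> x ` (F1 \<union> F2))"
      using mono[of F1 "F1 \<union> F2"] mono[of F2 "F1 \<union> F2"] F by (intro generate_ring.eng_add) auto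
    thus ?case using F by (intro exI[of _ "F1 \<union> F2"]) auto
  next
    case (eng_mult h1 h2)
    then obtain F1 F2 where F: "finite F1" "F1 \<subseteq> Y" "h1 \<in> generate_ring R (A \<union> x ` F1)"
      "finite F2" "F2 \<subseteq> Y" "h2 \<in> generate_ring R (A \<union> x ` F2)" by blast
    have "h1 \<otimes> h2 \<in> generate_ring R (A \<union> x ` (F1 \<union> F2))"
      using mono[of F1 "F1 \<union> F2"] mono[of F2 "F1 \<union> F2"] F by (intro generate_ring.eng_mult) auto
    thus ?case using F by (intro exI[of _ "F1 \<union> F2"]) auto
  qed
qed

text \<open>Membership in \<open>p C\<close> has a finite certificate: finitely many products, each
  with a coefficient built from finitely many generators. So torsion seen in a union of stages is
  already seen in one.\<close>

lemma ideal_span_finite_support: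
  assumes A: "A \<union> x ` Y \<subseteq> carrier R" and p: "p \<subseteq> carrier R"
    and "z \<in> ideal_span R p (generate_ring R (A \<union> x ` Y))"
  shows "\<exists>F. finite F \<and> F \<subseteq> Y \<and> z \<in> ideal_span R p (generate_ring R (A \<union> x ` F))"
  using assms(3) unfolding ideal_span_def[of R p "generate_ring R (A \<union> x ` Y)"]
proof induction
  case zero
  show ?case by (intro exI[of _ "{}"]) (auto simp: ideal_span_def intro: additive_closure.zero)
next
  case (add w z)
  then obtain u c where w: "w = u \<otimes> c" "u \<in> p" "c \<in> generate_ring R (A \<union> x ` Y)" by blast
  obtain F1 where F1: "finite F1" "F1 \<subseteq> Y" "c \<in> generate_ring R (A \<union> x ` F1)"
    using generate_ring_finite_support[OF w(3)] by blast
  obtain F2 where F2: "finite F2" "F2 \<subseteq> Y" "z \<in> ideal_span R p (generate_ring R (A \<union> x ` F2))"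
    using add by blast
  let ?F = "F1 \<union> F2"
  have car: "A \<union> x ` ?F \<subseteq> carrier R" using A F1(2) F2(2) by blast
  have sr: "subring (generate_ring R (A \<union> x ` ?F)) R" by (rule generate_ring_is_subring[OF car])
  have m1: "generate_ring R (A \<union> x ` F1) \<subseteq> generate_ring R (A \<union> x ` ?F)"
    by (rule mono_generate_ring[OF _ car]) auto
  have m2: "generate_ring R (A \<union> x ` F2) \<subseteq> generate_ring R (A \<union> x ` ?F)"
    by (rule mono_generate_ring[OF _ car]) auto
  have "w \<in> ideal_span R p (generate_ring R (A \<union> x ` ?F))"
    using ideal_span_gen[OF p sr w(2)] m1 F1(3) w(1) by blast
  moreover have "z \<in> ideal_span R p (generate_ring R (A \<union> x ` ?F))"
    using ideal_span_mono[OF m2] F2(3) by blast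
  ultimately have "w \<oplus> z \<in> ideal_span R p (generate_ring R (A \<union> x ` ?F))"
    by (rule ideal_span_add[OF p sr])
  thus ?case using F1 F2 by (intro exI[of _ ?F]) auto
qed

text \<open>Transfinite induction on the index: \<open>torsion_killed_step\<close> adjoins one
  element, and the auxiliary fact \<open>union\<close> covers every stage that is a union of earlier
  ones.\<close>

theorem torsion_killed_tower:
  fixes x :: "'i::wellorder \<Rightarrow> 'a"
  assumes A: "subring A R" and x: "x ` V \<subseteq> carrier R"
    and U: "\<one> \<in> U" "\<And>u v. \<lbrakk>u \<in> U; v \<in> U\<rbrakk> \<Longrightarrow> u \<otimes> v \<in> U"
    and p: "p \<subseteq> A" and a: "a \<in> A" and base: "torsion_killed R p a U A"
    and tame: "\<And>i. i \<in> V \<Longrightarrow> tame_extension R U (generate_ring R (A \<union> x ` {j \<in> V. j < i})) (x i)"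
  shows "torsion_killed R p a U (generate_ring R (A \<union> x ` V))"
proof -
  define G where "G Y = generate_ring R (A \<union> x ` Y)" for Y
  note AE = subringE[OF A]
  have pc: "p \<subseteq> carrier R" using p AE(1) by blast
  have car: "A \<union> x ` Y \<subseteq> carrier R" if "Y \<subseteq> V" for Y using that x AE(1) by blast
  have G: "subring (G Y) R" if "Y \<subseteq> V" for Y
    unfolding G_def by (rule generate_ring_is_subring[OF car[OF that]])
  have mono: "G Y \<subseteq> G Z" if "Y \<subseteq> Z" "Z \<subseteq> V" for Y Z
    unfolding G_def using that by (intro mono_generate_ring car) auto
  have AG: "A \<subseteq> G Y" for Y unfolding G_def by (auto intro: generate_ring.incl)
  have G0: "torsion_killed R p a U (G {})"
  proof -
    have "G {} \<subseteq> A" unfolding G_def by (rule generate_ring_min_subring1[OF _ A]) (use AE(1) in auto)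
    hence "G {} = A" using AG by blast
    thus ?thesis using base by simp
  qed
  \<comment> \<open>\<open>Y\<close> is an initial segment. An instance of torsion uses finitely
    many generators, so it occurs already up to the largest of them, and its killer stays valid in
    the larger ring. With no generators at all, the stage is \<open>A\<close>.\<close>
  have union: "torsion_killed R p a U (G Y)"
    if Y: "Y \<subseteq> V" and down: "\<And>i. i \<in> Y \<Longrightarrow> {j \<in> V. j \<le> i} \<subseteq> Y"
      and IH: "\<And>i. i \<in> Y \<Longrightarrow> torsion_killed R p a U (G {j \<in> V. j \<le> i})" for Y
    unfolding torsion_killed_def
  proof (intro ballI impI)
    fix b assume b: "b \<in> G Y" and ab: "a \<otimes> b \<in> ideal_span R p (G Y)"
    obtain F1 where F1: "finite F1" "F1 \<subseteq> Y" "b \<in> G F1"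
      using generate_ring_finite_support b unfolding G_def by metis
    obtain F2 where F2: "finite F2" "F2 \<subseteq> Y" "a \<otimes> b \<in> ideal_span R p (G F2)"
      using ideal_span_finite_support[OF car[OF Y] pc] ab unfolding G_def by metis
    have "\<exists>Z. Z \<subseteq> Y \<and> F1 \<union> F2 \<subseteq> Z \<and> torsion_killed R p a U (G Z)"
    proof (cases "F1 \<union> F2 = {}")
      case True
      thus ?thesis using G0 by (intro exI[of _ "{}"]) auto
    next
      case False
      let ?i = "Max (F1 \<union> F2)"
      have i: "?i \<in> Y" using Max_in[of "F1 \<union> F2"] F1 F2 False by blast
      have "F1 \<union> F2 \<subseteq> {j \<in> V. j \<le> ?i}" using F1 F2 Y by (auto intro: Max_ge)
      thus ?thesis using IH[OF i] down[OF i] by blast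
    qed
    then obtain Z where Z: "Z \<subseteq> Y" "F1 \<union> F2 \<subseteq> Z" "torsion_killed R p a U (G Z)" by blast
    have ZV: "Z \<subseteq> V" using Z Y by blast
    have "b \<in> G Z" using mono[of F1 Z] F1(3) Z ZV by blast
    moreover have "a \<otimes> b \<in> ideal_span R p (G Z)"
      using ideal_span_mono[OF mono[of F2 Z]] F2(3) Z ZV by blast
    ultimately obtain t where t: "t \<in> U \<inter> G Z" "t \<otimes> b \<in> ideal_span R p (G Z)"
      using Z(3) unfolding torsion_killed_def by blast
    show "\<exists>t\<in>U \<inter> G Y. t \<otimes> b \<in> ideal_span R p (G Y)"
      using t mono[OF Z(1) Y] ideal_span_mono[OF mono[OF Z(1) Y]] by blast
  qed
  have "torsion_killed R p a U (G {j \<in> V. j \<le> i})" if "i \<in> V" for i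
    using that
  proof (induction i rule: less_induct)
    case (less i)
    \<comment> \<open>The open segment below \<open>i\<close> is handled by \<open>union\<close>, so
      zero, successor and limit indices need no distinction.\<close>
    have lt: "torsion_killed R p a U (G {j \<in> V. j < i})"
      by (rule union) (use less.IH in auto)
    have "torsion_killed R p a U (generate_ring R (insert (x i) (G {j \<in> V. j < i})))"
    proof (rule torsion_killed_step[OF G _ U _ _ _ lt])
      show "tame_extension R U (G {j \<in> V. j < i}) (x i)"
        using tame[OF less.prems] by (simp add: G_def)
    qed (use less.prems x a p AG[of "{j \<in> V. j < i}"] in auto)
    moreover have "generate_ring R (insert (x i) (G {j \<in> V. j < i})) = G {j \<in> V. j \<le> i}"
    proof
      have "G {j \<in> V. j < i} \<subseteq> G {j \<in> V. j \<le> i}" by (rule mono) auto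
      moreover have "x i \<in> G {j \<in> V. j \<le> i}"
        unfolding G_def using less.prems by (auto intro: generate_ring.incl)
      moreover have "insert (x i) (G {j \<in> V. j < i}) \<subseteq> carrier R"
        using less.prems x subringE(1)[OF G[of "{j \<in> V. j < i}"]] by auto
      ultimately show "generate_ring R (insert (x i) (G {j \<in> V. j < i})) \<subseteq> G {j \<in> V. j \<le> i}"
        by (intro generate_ring_min_subring1 G) auto
      have 1: "insert (x i) (G {j \<in> V. j < i}) \<subseteq> carrier R"
        using less.prems x subringE(1)[OF G[of "{j \<in> V. j < i}"]] by auto
      have "x j \<in> G {j \<in> V. j < i}" if "j \<in> V" "j < i" for j
        unfolding G_def using that by (auto intro: generate_ring.incl)
      hence "A \<union> x ` {j \<in> V. j \<le> i} \<subseteq> insert (x i) (G {j \<in> V. j < i})"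
        using AG[of "{j \<in> V. j < i}"] by (auto simp: le_less)
      hence "A \<union> x ` {j \<in> V. j \<le> i} \<subseteq> generate_ring R (insert (x i) (G {j \<in> V. j < i}))"
        by (auto intro: generate_ring.incl)
      thus "G {j \<in> V. j \<le> i} \<subseteq> generate_ring R (insert (x i) (G {j \<in> V. j < i}))"
        unfolding G_def[of "{j \<in> V. j \<le> i}"]
        by (intro generate_ring_min_subring1 generate_ring_is_subring[OF 1] car) auto
    qed
    ultimately show ?case by simp
  qed
  hence "torsion_killed R p a U (G V)" by (intro union[of V]) auto
  thus ?thesis by (simp add: G_def)
qed

section \<open>Sources of tame extensions: transcendental and algebraic elements\<close>

lemma indep_powers_mono:
  assumes C: "subring C R" and y: "y \<in> carrier R" and ind: "indep_powers R C y n" and mn: "m \<le> n"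
  shows "indep_powers R C y m"
  unfolding indep_powers_def
proof (intro allI impI)
  note CE = subringE[OF C]
  fix c i assume c: "range c \<subseteq> C" "(\<Oplus>i\<in>{..<m}. c i \<otimes> y [^] i) = \<zero>" and i: "i < m"
  define e where "e i = (if i < m then c i else \<zero>)" for i
  have e: "range e \<subseteq> C" using c(1) CE(2) by (auto simp: e_def)
  have ec: "e i \<in> carrier R" "c i \<in> carrier R" for i using e c(1) CE(1) by auto
  have "(\<Oplus>i\<in>{..<m}. c i \<otimes> y [^] i) = (\<Oplus>i\<in>{..<n}. e i \<otimes> y [^] i)"
    using y ec mn by (intro add.finprod_mono_neutral_cong_left) (auto simp: e_def)
  hence "e i = \<zero>" using ind e c(2) i mn unfolding indep_powers_def by auto
  thus "c i = \<zero>" using i by (simp add: e_def)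
qed

lemma finsum_lessThan_Suc:
  assumes "\<And>i. i \<le> n \<Longrightarrow> f i \<in> carrier R"
  shows "(\<Oplus>i\<in>{..<Suc n}. f i) = f n \<oplus> (\<Oplus>i\<in>{..<n}. f i)"
  unfolding lessThan_Suc using assms by (intro finsum_insert) auto

text \<open>Nothing is inverted and all exponents are allowed, so \<open>y [^] Suc i\<close> is
  itself one of the basis powers.\<close>

lemma tame_extension_transcendental:
  assumes C: "subring C R" and y: "y \<in> carrier R" and "\<one> \<in> U" and "\<And>n. indep_powers R C y n"
  shows "tame_extension R U C y"
  unfolding tame_extension_def
proof (intro bexI[of _ \<one>] exI[of _ UNIV] conjI ballI)
  note CE = subringE[OF C]
  show "\<one> \<otimes> y [^] Suc i \<in> poly_span R C y UNIV" for i
    using poly_span_gen[OF CE(1) y CE(3)] by blast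
qed (use assms subringE(3)[OF C] in auto)

text \<open>The leading coefficient plays the part of \<open>h\<close>: the relation rewrites its
  product with \<open>y [^] d\<close> in lower powers, while smaller powers already belong to the
  basis. Positivity of \<open>d\<close> puts the exponent \<open>0\<close> into
  \<open>{..<d}\<close>.\<close>

lemma tame_extension_algebraic:
  assumes C: "subring C R" and y: "y \<in> carrier R" and d: "d > 0" and c: "range c \<subseteq> C"
    and rel: "(\<Oplus>i\<in>{..<Suc d}. c i \<otimes> y [^] i) = \<zero>" and "c d \<in> U" and ind: "indep_powers R C y d"
  shows "tame_extension R U C y"
  unfolding tame_extension_def
proof (intro bexI[of _ "c d"] exI[of _ "{..<d}"] conjI ballI)
  note CE = subringE[OF C]
  have cc: "c i \<in> carrier R" for i using c CE(1) by auto
  fix i assume i: "i \<in> {..<d}"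
  show "c d \<otimes> y [^] Suc i \<in> poly_span R C y {..<d}"
  proof (cases "Suc i < d")
    case True
    thus ?thesis using poly_span_gen[OF CE(1) y, of "c d" "Suc i" "{..<d}"] c by auto
  next
    case False
    hence id: "Suc i = d" using i by auto
    let ?r = "\<Oplus>i\<in>{..<d}. c i \<otimes> y [^] i"
    have r: "?r \<in> carrier R" using cc y by auto
    have "c d \<otimes> y [^] d \<oplus> ?r = \<zero>" using rel cc y by (subst (asm) finsum_lessThan_Suc) auto
    hence "c d \<otimes> y [^] d = \<ominus> ?r" using minus_equality cc y r by auto
    also have "\<dots> = (\<ominus> \<one>) \<otimes> ?r" using r by (simp add: l_minus)
    also have "\<dots> = (\<Oplus>i\<in>{..<d}. (\<ominus> c i) \<otimes> y [^] i)"
      using cc y by (subst finsum_rdistr) (auto intro!: finsum_cong' simp: l_minus)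
    also have "\<dots> \<in> poly_span R C y {..<d}"
      by (rule poly_span_finsum[OF CE(1) y]) (use c CE(5) in auto)
    finally show ?thesis using id by simp
  qed
qed (use assms indep_powers_mono[OF C y ind] in auto)

text \<open>The least dependent length is some \<open>Suc d\<close>, as the empty family is
  independent. If the coefficient of degree \<open>d\<close> vanished, a shorter relation would
  exist; if \<open>d\<close> were zero, the relation would say that this coefficient is
  zero.\<close>

lemma minimal_relation:
  assumes C: "subring C R" and y: "y \<in> carrier R" and dep: "\<not> indep_powers R C y n"
  shows "\<exists>d c. d > 0 \<and> range c \<subseteq> C \<and> (\<Oplus>i\<in>{..<Suc d}. c i \<otimes> y [^] i) = \<zero> \<and> c d \<noteq> \<zero> \<and>
    indep_powers R C y d"
proof -
  note CE = subringE[OF C]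
  define k where "k = (LEAST n. \<not> indep_powers R C y n)"
  have k: "\<not> indep_powers R C y k" unfolding k_def using dep by (rule LeastI)
  have less: "indep_powers R C y j" if "j < k" for j
    using not_less_Least[of j "\<lambda>n. \<not> indep_powers R C y n"] that unfolding k_def by blast
  have "k \<noteq> 0" using k by (auto simp: indep_powers_def)
  then obtain d where d: "k = Suc d" using not0_implies_Suc by blast
  obtain c j where c: "range c \<subseteq> C" "(\<Oplus>i\<in>{..<Suc d}. c i \<otimes> y [^] i) = \<zero>" and j: "j < Suc d" "c j \<noteq> \<zero>"
    using k unfolding indep_powers_def d by blast
  have cc: "c i \<in> carrier R" for i using c CE(1) by auto
  have ind: "indep_powers R C y d" using less d by simp
  have rel: "c d \<otimes> y [^] d \<oplus> (\<Oplus>i\<in>{..<d}. c i \<otimes> y [^] i) = \<zero>"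
    using c(2) cc y by (subst (asm) finsum_lessThan_Suc) auto
  have "c d \<noteq> \<zero>"
  proof
    assume 0: "c d = \<zero>"
    hence "(\<Oplus>i\<in>{..<d}. c i \<otimes> y [^] i) = \<zero>" using rel cc y by simp
    hence "\<forall>i<d. c i = \<zero>" using ind c(1) unfolding indep_powers_def by blast
    thus False using j 0 less_Suc_eq by blast
  qed
  moreover have "d > 0"
  proof (rule ccontr)
    assume "\<not> d > 0"
    hence "c d = \<zero>" using rel cc by simp
    thus False using \<open>c d \<noteq> \<zero>\<close> by simp
  qed
  ultimately show ?thesis using c ind by blast
qed

end

section \<open>Leading derivatives\<close>

lemma nat_seq_mono_subseq:
  fixes g :: "nat \<Rightarrow> nat"
  shows "\<exists>r::nat \<Rightarrow> nat. strict_mono r \<and> mono (\<lambda>i. g (r i))"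
proof -
  obtain r :: "nat \<Rightarrow> nat" where r: "strict_mono r" "monoseq (\<lambda>i. g (r i))" using seq_monosub by blast
  show ?thesis
  proof (cases "\<forall>m. \<forall>n\<ge>m. g (r m) \<le> g (r n)")
    case True
    thus ?thesis using r by (auto simp: mono_def)
  next
    case False
    hence dec: "\<forall>m. \<forall>n\<ge>m. g (r n) \<le> g (r m)" using r(2) by (auto simp: monoseq_def)
    \<comment> \<open>A decreasing sequence of naturals is constant from the place where it attains
      its minimum, so this tail is weakly increasing as well.\<close>
    obtain n0 where n0: "\<And>n. g (r n0) \<le> g (r n)"
      using ex_has_least_nat[of "\<lambda>_. True" 0 "\<lambda>n. g (r n)"] by auto
    have "g (r (n0 + i)) = g (r n0)" for i
      using dec n0 by (intro antisym) auto
    hence "mono (\<lambda>i. g (r (n0 + i)))" by (simp add: mono_def)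
    moreover have "strict_mono (\<lambda>i. r (n0 + i))" using r(1) by (auto simp: strict_mono_def)
    ultimately show ?thesis by blast
  qed
qed

text \<open>The sequence is thinned out once per coordinate; monotonicity in the earlier coordinates
  survives each refinement.\<close>

lemma dickson_seq:
  fixes f :: "nat \<Rightarrow> nat multiset"
  shows "\<exists>r::nat \<Rightarrow> nat. strict_mono r \<and> (\<forall>c<m. mono (\<lambda>i. count (f (r i)) c))"
proof (induction m)
  case 0
  show ?case by (intro exI[of _ id]) (auto simp: strict_mono_def)
next
  case (Suc m)
  then obtain r :: "nat \<Rightarrow> nat" where r: "strict_mono r" "\<And>c. c < m \<Longrightarrow> mono (\<lambda>i. count (f (r i)) c)" by blast
  obtain r' :: "nat \<Rightarrow> nat" where r': "strict_mono r'" "mono (\<lambda>i. count (f (r (r' i))) m)"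
    using nat_seq_mono_subseq[of "\<lambda>i. count (f (r i)) m"] by blast
  have "mono (\<lambda>i. count (f (r (r' i))) c)" if "c < Suc m" for c
  proof (cases "c = m")
    case False
    hence "mono (\<lambda>i. count (f (r i)) c)" using r(2) that by simp
    thus ?thesis using strict_mono_mono[OF r'(1)] by (auto simp: mono_def)
  qed (use r' in simp)
  moreover have "strict_mono (\<lambda>i. r (r' i))" using r(1) r'(1) by (auto simp: strict_mono_def)
  ultimately show ?case by blast
qed

text \<open>The inclusion-minimal members of \<open>E\<close> serve. Infinitely many would form an
  injective sequence in which \<open>dickson_seq\<close> finds two comparable members, against
  minimality.\<close>

lemma dickson_multiset:
  fixes E :: "nat multiset set"
  assumes E: "\<And>M. M \<in> E \<Longrightarrow> set_mset M \<subseteq> {..<m}"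
  shows "\<exists>F. finite F \<and> F \<subseteq> E \<and> (\<forall>M\<in>E. \<exists>N\<in>F. N \<subseteq># M)"
proof -
  define F where "F = {M \<in> E. \<forall>N\<in>E. \<not> N \<subset># M}"
  have "\<exists>N\<in>F. N \<subseteq># M" if "M \<in> E" for M
    using that
  proof (induction "size M" arbitrary: M rule: less_induct)
    case less
    show ?case
    proof (cases "M \<in> F")
      case False
      then obtain N where N: "N \<in> E" "N \<subset># M" using less.prems by (auto simp: F_def)
      then obtain N' where "N' \<in> F" "N' \<subseteq># N" using less.hyps[of N] mset_subset_size by blast
      thus ?thesis using N(2) by (meson subset_mset.dual_order.trans subset_mset.less_imp_le)
    qed auto
  qed
  moreover have "finite F"
  proof (rule ccontr)
    assume "infinite F"
    then obtain f :: "nat \<Rightarrow> nat multiset" where f: "inj f" "range f \<subseteq> F"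
      using infinite_countable_subset by blast
    obtain r :: "nat \<Rightarrow> nat" where r: "strict_mono r" "\<And>c. c < m \<Longrightarrow> mono (\<lambda>i. count (f (r i)) c)"
      using dickson_seq by blast
    have fE: "f i \<in> F" "f i \<in> E" for i using f(2) by (auto simp: F_def)
    have "f (r 0) \<subseteq># f (r 1)"
      unfolding subseteq_mset_def
    proof
      fix c
      show "count (f (r 0)) c \<le> count (f (r 1)) c"
      proof (cases "c < m")
        case True
        thus ?thesis using r(2)[OF True] by (auto dest: monoD[of _ 0 1])
      next
        case False
        hence "c \<notin># f (r 0)" using E[OF fE(2)] by auto
        thus ?thesis by (simp add: not_in_iff)
      qed
    qed
    moreover have "f (r 0) \<noteq> f (r 1)"
      using f(1) r(1) by (metis injD less_numeral_extra(1) less_numeral_extra(4) strict_mono_less)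
    ultimately have "f (r 0) \<subset># f (r 1)" by (simp add: subset_mset.less_le)
    thus False using fE(1)[of "r 1"] fE(2)[of "r 0"] by (auto simp: F_def)
  qed
  ultimately show ?thesis by (intro exI[of _ F]) (auto simp: F_def)
qed

text \<open>\<open>dickson_multiset\<close> for each generator index separately: derivatives of
  different generators are never compared.\<close>

lemma dickson_indexed:
  fixes E :: "(nat \<times> nat multiset) set"
  assumes E: "E \<subseteq> {..<K} \<times> {M. set_mset M \<subseteq> {..<m}}"
  shows "\<exists>F. finite F \<and> F \<subseteq> E \<and> (\<forall>k M. (k, M) \<in> E \<longrightarrow> (\<exists>N. (k, N) \<in> F \<and> N \<subseteq># M))"
proof -
  have "\<exists>F. finite F \<and> F \<subseteq> {M. (k, M) \<in> E} \<and> (\<forall>M\<in>{M. (k, M) \<in> E}. \<exists>N\<in>F. N \<subseteq># M)" for k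
    by (rule dickson_multiset[of _ m]) (use E in auto)
  then obtain F where F: "\<And>k. finite (F k)" "\<And>k. F k \<subseteq> {M. (k, M) \<in> E}"
    "\<And>k M. (k, M) \<in> E \<Longrightarrow> \<exists>N\<in>F k. N \<subseteq># M" by (metis mem_Collect_eq)
  have "\<forall>k M. (k, M) \<in> E \<longrightarrow> (\<exists>N. (k, N) \<in> (SIGMA k:{..<K}. F k) \<and> N \<subseteq># M)"
  proof (intro allI impI)
    fix k M assume kM: "(k, M) \<in> E"
    obtain N where "N \<in> F k" "N \<subseteq># M" using F(3)[OF kM] by blast
    thus "\<exists>N. (k, N) \<in> (SIGMA k:{..<K}. F k) \<and> N \<subseteq># M" using kM E by auto
  qed
  moreover have "finite (SIGMA k:{..<K}. F k)" using F(1) by (intro finite_SigmaI) auto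
  moreover have "(SIGMA k:{..<K}. F k) \<subseteq> E" using F(2) by auto
  ultimately show ?thesis by blast
qed

context cring
begin

lemma finsum_in_subring:
  assumes "subring C R" and "\<And>i. i < n \<Longrightarrow> f i \<in> C"
  shows "(\<Oplus>i\<in>{..<n::nat}. f i) \<in> C"
  using assms(2)
proof (induction n)
  case (Suc n)
  have "(\<Oplus>i\<in>{..<Suc n}. f i) = f n \<oplus> (\<Oplus>i\<in>{..<n}. f i)"
    using Suc.prems subringE(1)[OF assms(1)] by (intro finsum_lessThan_Suc) auto
  thus ?case using Suc subringE(7)[OF assms(1)] by auto
qed (use subringE(2)[OF assms(1)] in simp)

lemma pow_in_subring:
  assumes "subring C R" and "y \<in> C" shows "y [^] (n::nat) \<in> C"
  using assms(2) subringE(3,6)[OF assms(1)] by (induction n) auto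

lemma add_pow_in_subring:
  assumes "subring C R" and "y \<in> C" shows "add_pow R (n::nat) y \<in> C"
  using assms(2) subringE(2,7)[OF assms(1)] by (induction n) auto

end

section \<open>Derivatives of polynomial relations\<close>

context diff_cring
begin

text \<open>For \<open>i = 0\<close> the truncated exponent \<open>i - 1\<close> is harmless, since its coefficient vanishes.\<close>

definition separant :: "(nat \<Rightarrow> 'a) \<Rightarrow> 'a \<Rightarrow> nat \<Rightarrow> 'a" where
  "separant c y n = (\<Oplus>i\<in>{..<n}. (add_pow R i \<one> \<otimes> c i) \<otimes> y [^] (i - 1))"

lemma separant_closed:
  assumes "\<And>i. c i \<in> carrier R" "y \<in> carrier R"
  shows "separant c y n \<in> carrier R"
  unfolding separant_def using assms by (intro finsum_closed) auto

text \<open>Reindexing drops the vanishing constant term. The formal derivative of an expression of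
  degree \<open>n\<close> then has exponents below \<open>n\<close>, the form that
  \<open>indep_powers\<close> can test.\<close>

lemma separant_Suc:
  assumes "\<And>i. c i \<in> carrier R" "y \<in> carrier R"
  shows "separant c y (Suc n) = (\<Oplus>i\<in>{..<n}. (add_pow R (Suc i) \<one> \<otimes> c (Suc i)) \<otimes> y [^] i)"
proof (induction n)
  case 0
  show ?case using assms by (simp add: separant_def lessThan_Suc)
next
  case (Suc n)
  have "separant c y (Suc (Suc n))
      = (add_pow R (Suc n) \<one> \<otimes> c (Suc n)) \<otimes> y [^] n \<oplus> separant c y (Suc n)"
    unfolding separant_def using assms by (subst finsum_lessThan_Suc) (auto simp del: add.nat_pow_Suc)
  also have "\<dots> = (\<Oplus>i\<in>{..<Suc n}. (add_pow R (Suc i) \<one> \<otimes> c (Suc i)) \<otimes> y [^] i)"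
    unfolding Suc using assms by (subst finsum_lessThan_Suc) (auto simp del: add.nat_pow_Suc)
  finally show ?case .
qed

text \<open>The chain rule: differentiating the powers of \<open>y\<close> collects into the formal
  derivative at \<open>y\<close>, and differentiating the coefficients leaves an expression in the
  same powers.\<close>

lemma der_poly:
  assumes \<delta>: "\<delta> \<in> \<Delta>" and c: "\<And>i. c i \<in> carrier R" and y: "y \<in> carrier R"
  shows "der R \<delta> (\<Oplus>i\<in>{..<n}. c i \<otimes> y [^] (i::nat))
    = separant c y n \<otimes> der R \<delta> y \<oplus> (\<Oplus>i\<in>{..<n}. der R \<delta> (c i) \<otimes> y [^] i)"
proof (induction n)
  case 0
  show ?case using \<delta> y by (simp add: separant_def)
next
  case (Suc n)
  let ?P = "\<Oplus>i\<in>{..<n}. c i \<otimes> y [^] i" and ?T = "\<Oplus>i\<in>{..<n}. der R \<delta> (c i) \<otimes> y [^] i"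
  have P: "?P \<in> carrier R" and T: "?T \<in> carrier R" using c y \<delta> by (auto intro!: finsum_closed)
  have S: "separant c y n \<in> carrier R" by (rule separant_closed[OF c y])
  have pow: "der R \<delta> (y [^] n) = (add_pow R n \<one> \<otimes> y [^] (n - 1)) \<otimes> der R \<delta> y"
    using der_pow_Suc[OF \<delta> y, of "n - 1"] \<delta> y by (cases n) (simp_all add: m_assoc)
  have "der R \<delta> (\<Oplus>i\<in>{..<Suc n}. c i \<otimes> y [^] i) = der R \<delta> (c n \<otimes> y [^] n \<oplus> ?P)"
    using c y by (subst finsum_lessThan_Suc) auto
  also have "\<dots> = (der R \<delta> (c n) \<otimes> y [^] n \<oplus> c n \<otimes> der R \<delta> (y [^] n))
      \<oplus> (separant c y n \<otimes> der R \<delta> y \<oplus> ?T)"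
    using Suc c y \<delta> P by (simp add: der_add der_mult)
  also have "\<dots> = ((add_pow R n \<one> \<otimes> c n) \<otimes> y [^] (n - 1) \<oplus> separant c y n) \<otimes> der R \<delta> y
      \<oplus> (der R \<delta> (c n) \<otimes> y [^] n \<oplus> ?T)"
    unfolding pow using c y \<delta> S T by (simp add: l_distr r_distr m_ac a_ac)
  also have "(add_pow R n \<one> \<otimes> c n) \<otimes> y [^] (n - 1) \<oplus> separant c y n = separant c y (Suc n)"
    unfolding separant_def using c y by (subst finsum_lessThan_Suc) auto
  also have "der R \<delta> (c n) \<otimes> y [^] n \<oplus> ?T = (\<Oplus>i\<in>{..<Suc n}. der R \<delta> (c i) \<otimes> y [^] i)"
    using c y \<delta> by (subst finsum_lessThan_Suc) auto
  finally show ?case .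
qed

end

text \<open>The product serves, nonzero since there are no zero divisors. Divisibility is what later
  puts each \<open>w\<close> into a divisor-closed set containing \<open>s\<close>.\<close>

lemma (in domain) common_multiple:
  assumes "finite W" "W \<subseteq> carrier R - {\<zero>}"
  shows "\<exists>s\<in>carrier R. s \<noteq> \<zero> \<and> (\<forall>w\<in>W. \<exists>v\<in>carrier R. s = w \<otimes> v)"
  using assms
proof (induction W rule: finite_induct)
  case empty
  show ?case by (intro bexI[of _ \<one>]) auto
next
  case (insert w W)
  then obtain s where s: "s \<in> carrier R" "s \<noteq> \<zero>" "\<And>w. w \<in> W \<Longrightarrow> \<exists>v\<in>carrier R. s = w \<otimes> v" by auto
  have w: "w \<in> carrier R" "w \<noteq> \<zero>" using insert.prems by auto
  show ?case
  proof (rule bexI[of _ "w \<otimes> s"], intro conjI ballI)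
    show "w \<otimes> s \<noteq> \<zero>" using w s integral by blast
    fix u assume u: "u \<in> insert w W"
    show "\<exists>v\<in>carrier R. w \<otimes> s = u \<otimes> v"
    proof (cases "u = w")
      case False
      then obtain v where "v \<in> carrier R" "s = u \<otimes> v" using u s(3) by blast
      moreover have "u \<in> carrier R" using u insert.prems by auto
      ultimately show ?thesis using w by (intro bexI[of _ "w \<otimes> v"]) (auto simp: m_lcomm)
    qed (use s in auto)
  qed (use w s in auto)
qed

text \<open>
  The derivative of the \<open>k\<close>-th generator with respect to the multiset \<open>M\<close> of derivations is indexed
  by \<open>(k, M)\<close>.  The lexicographic order on these indices is a ranking: a well-order compatible with
  the derivations.
\<close>

locale derivative_tower = diff_cring R \<Delta> + domain R
  for R :: "('a, 'd, 'm) diff_ring_scheme" (structure) and \<Delta> :: "'d set" +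
  fixes A :: "'a set" and D :: "nat \<Rightarrow> 'd" and m :: nat and g :: "nat \<Rightarrow> 'a" and K :: nat
  assumes A: "subring A R" and A_der: "\<And>\<delta> u. \<lbrakk>\<delta> \<in> \<Delta>; u \<in> A\<rbrakk> \<Longrightarrow> der R \<delta> u \<in> A"
    and D: "\<And>i. i < m \<Longrightarrow> D i \<in> \<Delta>" and g: "\<And>k. k < K \<Longrightarrow> g k \<in> carrier R"
    and char_zero: "\<And>n::nat. n > 0 \<Longrightarrow> add_pow R n \<one> \<noteq> \<zero>"
begin

definition index :: "(nat \<times> nat multiset) set" where
  "index = {..<K} \<times> {M. set_mset M \<subseteq> {..<m}}"

text \<open>Sorting fixes one order in which the derivations of the multiset act; as they commute,
  the choice does not matter, which \<open>der_derivative\<close> exploits.\<close>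

definition derivative :: "nat \<times> nat multiset \<Rightarrow> 'a" where
  "derivative \<theta> = foldr (\<lambda>i. der R (D i)) (sorted_list_of_multiset (snd \<theta>)) (g (fst \<theta>))"

text \<open>The stage of the tower just below \<open>\<theta>\<close>. The order compares generators
  first and multisets second, so all derivatives of earlier generators belong to the stage.\<close>

definition lower :: "nat \<times> nat multiset \<Rightarrow> 'a set" where
  "lower \<theta> = generate_ring R (A \<union> derivative ` {\<eta> \<in> index. \<eta> < \<theta>})"

lemma foldr_der_closed:
  "\<lbrakk>set xs \<subseteq> {..<m}; z \<in> carrier R\<rbrakk> \<Longrightarrow> foldr (\<lambda>i. der R (D i)) xs z \<in> carrier R"
  by (induction xs) (use D in auto)

lemma foldr_der_insort:
  assumes "set xs \<subseteq> {..<m}" "i < m" "z \<in> carrier R"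
  shows "foldr (\<lambda>i. der R (D i)) (insort i xs) z = der R (D i) (foldr (\<lambda>i. der R (D i)) xs z)"
  using assms(1)
proof (induction xs)
  case (Cons j xs)
  thus ?case using der_commute[of "D j" "D i"] D assms foldr_der_closed[of xs z] by auto
qed simp

lemma derivative_closed: "\<theta> \<in> index \<Longrightarrow> derivative \<theta> \<in> carrier R"
  unfolding derivative_def index_def using g by (intro foldr_der_closed) auto

lemma der_derivative:
  assumes "(k, M) \<in> index" "i < m"
  shows "der R (D i) (derivative (k, M)) = derivative (k, add_mset i M)"
  using assms g foldr_der_insort[of "sorted_list_of_multiset M" i "g k"]
  by (auto simp: derivative_def index_def)

lemma index_add_mset: "\<lbrakk>(k, M) \<in> index; i < m\<rbrakk> \<Longrightarrow> (k, add_mset i M) \<in> index"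
  by (auto simp: index_def)

text \<open>With \<open>add_mset_less_mono\<close> this makes the order a ranking: a derivation
  raises the rank and preserves comparisons. Here it suffices that proper inclusion implies the
  multiset order.\<close>

lemma less_add_mset: "(k, M) < (k, add_mset i M)" for k :: nat and M :: "nat multiset"
  by (simp add: less_prod_def subset_imp_less_mset)

lemma add_mset_less_mono:
  "(j, N) < (k, M) \<Longrightarrow> (j, add_mset i N) < (k, add_mset i M)" for k :: nat and M :: "nat multiset"
  by (auto simp: less_prod_def)

lemma lower_generators: "A \<union> derivative ` {\<eta> \<in> index. \<eta> < \<theta>} \<subseteq> carrier R"
  using subringE(1)[OF A] derivative_closed by auto

lemma lower_subring: "subring (lower \<theta>) R"
  unfolding lower_def by (rule generate_ring_is_subring[OF lower_generators])

lemma derivative_in_lower: "\<lbrakk>\<eta> \<in> index; \<eta> < \<theta>\<rbrakk> \<Longrightarrow> derivative \<eta> \<in> lower \<theta>"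
  unfolding lower_def by (auto intro: generate_ring.incl)

lemma lower_mono: "\<theta> \<le> \<theta>' \<Longrightarrow> lower \<theta> \<subseteq> lower \<theta>'"
  unfolding lower_def by (intro mono_generate_ring lower_generators) auto

text \<open>Derivations preserve comparisons of rank and map \<open>A\<close> to itself, so they
  send generators of one stage to generators of the other; products are handled by the product rule,
  since the old generators remain available.\<close>

lemma der_lower:
  assumes z: "z \<in> lower (k, M)" and i: "i < m"
  shows "der R (D i) z \<in> lower (k, add_mset i M)"
  using z unfolding lower_def[of "(k, M)"]
proof induction
  let ?L = "lower (k, add_mset i M)"
  note LE = subringE[OF lower_subring[of "(k, add_mset i M)"]]
  have up: "z \<in> ?L" "z \<in> carrier R"
    if "z \<in> generate_ring R (A \<union> derivative ` {\<eta> \<in> index. \<eta> < (k, M)})" for z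
    using that lower_mono[of "(k, M)" "(k, add_mset i M)"] less_add_mset[of k M i] LE(1)
    by (auto simp: lower_def[of "(k, M)"] less_imp_le)
  {
    case one
    show ?case using D i LE(2) by simp
  next
    case (incl h)
    show ?case
    proof (cases "h \<in> A")
      case True
      hence "der R (D i) h \<in> A" using A_der D i by blast
      thus ?thesis unfolding lower_def by (auto intro: generate_ring.incl)
    next
      case False
      then obtain j N where N: "(j, N) \<in> index" "(j, N) < (k, M)" "h = derivative (j, N)"
        using incl by auto
      show ?thesis unfolding N(3) der_derivative[OF N(1) i]
        by (rule derivative_in_lower[OF index_add_mset[OF N(1) i] add_mset_less_mono[OF N(2)]])
    qed
  next
    case (a_inv h)
    thus ?case using up LE(5) D i by (simp add: der_minus)
  next
    case (eng_add h1 h2)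
    thus ?case using up LE(7) D i by (simp add: der_add)
  next
    case (eng_mult h1 h2)
    thus ?case using up[OF eng_mult(1)] up[OF eng_mult(2)] LE(6,7) D i by (simp add: der_mult)
  }
qed

text \<open>Differentiating the relation once gives, by \<open>der_poly\<close>, a linear relation
  for the derivative with coefficient \<open>S\<close>. Every later differentiation keeps
  \<open>S\<close> and pushes all else into the lower stage, so a single separant serves all proper
  derivatives.\<close>

lemma separant_relation:
  assumes kM: "(k, M) \<in> index" and c: "range c \<subseteq> lower (k, M)"
    and rel: "(\<Oplus>i\<in>{..<n}. c i \<otimes> derivative (k, M) [^] (i::nat)) = \<zero>"
    and N: "set_mset N \<subseteq> {..<m}" "N \<noteq> {#}"
  defines "S \<equiv> separant c (derivative (k, M)) n"
  shows "S \<in> lower (k, M + N) \<and> (\<exists>T\<in>lower (k, M + N). S \<otimes> derivative (k, M + N) \<oplus> T = \<zero>)"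
  using N
proof (induction N)
  case empty
  thus ?case by simp
next
  case (add i N)
  let ?y = "derivative (k, M)"
  have i: "i < m" "D i \<in> \<Delta>" using add.prems D by auto
  have y: "?y \<in> carrier R" by (rule derivative_closed[OF kM])
  have cc: "c j \<in> carrier R" "c j \<in> lower (k, M)" for j
    using c subringE(1)[OF lower_subring] by auto
  have Sc: "S \<in> carrier R" unfolding S_def by (rule separant_closed[OF cc(1) y])
  show ?case
  proof (cases "N = {#}")
    case True
    let ?L = "lower (k, add_mset i M)"
    note sr = lower_subring[of "(k, add_mset i M)"]
    note LE = subringE[OF sr]
    have cL: "c j \<in> ?L" for j
      using cc(2) lower_mono[OF less_imp_le[OF less_add_mset]] by blast
    have yL: "?y \<in> ?L" by (rule derivative_in_lower[OF kM less_add_mset])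
    \<comment> \<open>The terms with differentiated coefficients. They are lower than the first
      derivative by \<open>der_lower\<close>, and \<open>?y\<close> ranks below its own
      derivative.\<close>
    let ?T = "\<Oplus>j\<in>{..<n}. der R (D i) (c j) \<otimes> ?y [^] j"
    have "S \<in> ?L"
      unfolding S_def separant_def
      by (rule finsum_in_subring[OF sr], rule LE(6)[OF LE(6)[OF add_pow_in_subring[OF sr LE(3)] cL]
          pow_in_subring[OF sr yL]])
    moreover have "?T \<in> ?L"
      by (rule finsum_in_subring[OF sr], rule LE(6)[OF der_lower[OF cc(2) i(1)] pow_in_subring[OF sr yL]])
    moreover have "S \<otimes> derivative (k, add_mset i M) \<oplus> ?T = \<zero>"
      using der_poly[where c=c and n=n, OF i(2) cc(1) y] rel i
      unfolding S_def der_derivative[OF kM i(1), symmetric] by simp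
    ultimately show ?thesis using True by auto
  next
    case False
    let ?x = "derivative (k, M + N)" and ?L = "lower (k, add_mset i (M + N))"
    note LE = subringE[OF lower_subring[of "(k, add_mset i (M + N))"]]
    have ix: "(k, M + N) \<in> index" using kM add.prems by (auto simp: index_def)
    obtain T where S: "S \<in> lower (k, M + N)" and T: "T \<in> lower (k, M + N)"
      and eq: "S \<otimes> ?x \<oplus> T = \<zero>" using add False by auto
    have x: "?x \<in> carrier R" by (rule derivative_closed[OF ix])
    have xL: "?x \<in> ?L" by (rule derivative_in_lower[OF ix less_add_mset])
    have up: "lower (k, M + N) \<subseteq> ?L" by (rule lower_mono[OF less_imp_le[OF less_add_mset]])
    have Tc: "T \<in> carrier R" using T subringE(1)[OF lower_subring] by blast
    \<comment> \<open>The product rule on \<open>S \<otimes> ?x\<close> leaves the new derivative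
      with unchanged coefficient \<open>S\<close>; the other terms are lower, since
      \<open>?x\<close> ranks below the new index.\<close>
    let ?T = "der R (D i) S \<otimes> ?x \<oplus> der R (D i) T"
    have "?T \<in> ?L" using LE(6,7) der_lower[OF S i(1)] der_lower[OF T i(1)] xL by blast
    moreover have "S \<otimes> derivative (k, add_mset i (M + N)) \<oplus> ?T = \<zero>"
    proof -
      have "der R (D i) (S \<otimes> ?x \<oplus> T) = (der R (D i) S \<otimes> ?x \<oplus> S \<otimes> der R (D i) ?x) \<oplus> der R (D i) T"
        using i Sc x Tc by (simp add: der_add der_mult)
      also have "\<dots> = S \<otimes> derivative (k, add_mset i (M + N)) \<oplus> ?T"
        unfolding der_derivative[OF ix i(1), symmetric] using i Sc x Tc by (simp add: a_ac)
      finally show ?thesis using eq i by simp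
    qed
    ultimately show ?thesis using S up by auto
  qed
qed

text \<open>The separant is an expression in the first \<open>d\<close> powers with top coefficient
  \<open>d\<close> times \<open>c d\<close>. This is nonzero in characteristic zero, so independence
  of those powers prevents the value from vanishing.\<close>

lemma separant_nonzero:
  assumes kM: "(k, M) \<in> index" and c: "range c \<subseteq> lower (k, M)" and d: "d > 0" "c d \<noteq> \<zero>"
    and ind: "indep_powers R (lower (k, M)) (derivative (k, M)) d"
  shows "separant c (derivative (k, M)) (Suc d) \<noteq> \<zero>"
proof
  note LE = subringE[OF lower_subring[of "(k, M)"]]
  have cc: "c j \<in> carrier R" "c j \<in> lower (k, M)" for j using c LE(1) by auto
  have y: "derivative (k, M) \<in> carrier R" by (rule derivative_closed[OF kM])
  assume "separant c (derivative (k, M)) (Suc d) = \<zero>"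
  hence "(\<Oplus>i\<in>{..<d}. (add_pow R (Suc i) \<one> \<otimes> c (Suc i)) \<otimes> derivative (k, M) [^] i) = \<zero>"
    by (simp only: separant_Suc[OF cc(1) y])
  moreover have "range (\<lambda>i. add_pow R (Suc i) \<one> \<otimes> c (Suc i)) \<subseteq> lower (k, M)"
    using cc(2) LE(3,6) add_pow_in_subring[OF lower_subring] by blast
  ultimately have "\<forall>i<d. add_pow R (Suc i) \<one> \<otimes> c (Suc i) = \<zero>"
    using ind unfolding indep_powers_def by blast
  from this[rule_format, of "d - 1"] have "add_pow R d \<one> \<otimes> c d = \<zero>" using d by simp
  thus False using integral[of "add_pow R d \<one>" "c d"] char_zero[OF d(1)] d(2) cc(1) by simp
qed

text \<open>\<open>s\<close> is fixed before \<open>U\<close>; closure of \<open>U\<close> under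
  divisors then yields every initial and separant dividing \<open>s\<close>. An index is either
  transcendental, or one of the finitely many chosen algebraic ones, or a proper derivative of such
  a one.\<close>

theorem tame_tower:
  "\<exists>s\<in>carrier R. s \<noteq> \<zero> \<and>
     (\<forall>U. \<one> \<in> U \<longrightarrow> s \<in> U \<longrightarrow> (\<forall>u\<in>carrier R. \<forall>v\<in>carrier R. u \<otimes> v \<in> U \<longrightarrow> u \<in> U) \<longrightarrow>
        (\<forall>\<theta>\<in>index. tame_extension R U (lower \<theta>) (derivative \<theta>)))"
proof -
  \<comment> \<open>The indices algebraic over their lower stage. Each of them is reached by
    derivations from one in the finite set \<open>F\<close> of the same generator.\<close>
  define E where "E = {\<theta> \<in> index. \<exists>n. \<not> indep_powers R (lower \<theta>) (derivative \<theta>) n}"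
  have "E \<subseteq> {..<K} \<times> {M. set_mset M \<subseteq> {..<m}}" by (auto simp: E_def index_def)
  from dickson_indexed[OF this] obtain F where F: "finite F" "F \<subseteq> E"
    and below: "\<And>k M. (k, M) \<in> E \<Longrightarrow> \<exists>N. (k, N) \<in> F \<and> N \<subseteq># M" by blast
  have FI: "f \<in> index" if "f \<in> F" for f using F that by (auto simp: E_def)
  define relation where "relation f d c \<longleftrightarrow> d > 0 \<and> range c \<subseteq> lower f \<and>
      (\<Oplus>i\<in>{..<Suc d}. c i \<otimes> derivative f [^] i) = \<zero> \<and> c d \<noteq> \<zero> \<and>
      indep_powers R (lower f) (derivative f) d" for f d c
  have "\<exists>d c. relation f d c" if f: "f \<in> F" for f
  proof -
    obtain n where "\<not> indep_powers R (lower f) (derivative f) n" using f F(2) by (auto simp: E_def)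
    from minimal_relation[OF lower_subring derivative_closed[OF FI[OF f]] this]
    show ?thesis unfolding relation_def .
  qed
  then obtain d c where relation: "\<And>f. f \<in> F \<Longrightarrow> relation f (d f) (c f)" by metis
  have dc: "d f > 0" "range (c f) \<subseteq> lower f"
      "(\<Oplus>i\<in>{..<Suc (d f)}. c f i \<otimes> derivative f [^] i) = \<zero>"
      "c f (d f) \<noteq> \<zero>" "indep_powers R (lower f) (derivative f) (d f)" if "f \<in> F" for f
    using relation[OF that] unfolding relation_def by blast+
  have cc: "c f i \<in> carrier R" if "f \<in> F" for f i
    using dc(2)[OF that] subringE(1)[OF lower_subring] by blast
  define S where "S f = separant (c f) (derivative f) (Suc (d f))" for f
  have S: "S f \<in> carrier R" "S f \<noteq> \<zero>" if "f \<in> F" for f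
  proof -
    show "S f \<in> carrier R"
      unfolding S_def by (rule separant_closed[OF cc[OF that] derivative_closed[OF FI[OF that]]])
    show "S f \<noteq> \<zero>"
      unfolding S_def using FI[OF that] dc[OF that] separant_nonzero by (cases f) blast
  qed
  have "\<exists>s\<in>carrier R. s \<noteq> \<zero> \<and> (\<forall>w\<in>(\<lambda>f. c f (d f)) ` F \<union> S ` F. \<exists>v\<in>carrier R. s = w \<otimes> v)"
    using F(1) S dc(4) cc by (intro common_multiple) auto
  then obtain s where s: "s \<in> carrier R" "s \<noteq> \<zero>"
    and multiple: "\<And>f. f \<in> F \<Longrightarrow> \<exists>v\<in>carrier R. s = c f (d f) \<otimes> v" "\<And>f. f \<in> F \<Longrightarrow> \<exists>v\<in>carrier R. s = S f \<otimes> v"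
    by blast
  show ?thesis
  proof (intro bexI[of _ s] conjI allI impI ballI s)
    fix U \<theta>
    assume U: "\<one> \<in> U" "s \<in> U" and div: "\<forall>u\<in>carrier R. \<forall>v\<in>carrier R. u \<otimes> v \<in> U \<longrightarrow> u \<in> U"
      and \<theta>: "\<theta> \<in> index"
    have y: "derivative \<theta> \<in> carrier R" by (rule derivative_closed[OF \<theta>])
    have IU: "c f (d f) \<in> U" "S f \<in> U" if "f \<in> F" for f
    proof -
      obtain v where "v \<in> carrier R" "s = c f (d f) \<otimes> v" using multiple(1)[OF \<open>f \<in> F\<close>] by blast
      thus "c f (d f) \<in> U" using U(2) div cc[OF \<open>f \<in> F\<close>] by blast
      obtain w where "w \<in> carrier R" "s = S f \<otimes> w" using multiple(2)[OF \<open>f \<in> F\<close>] by blast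
      thus "S f \<in> U" using U(2) div S(1)[OF \<open>f \<in> F\<close>] by blast
    qed
    consider "\<theta> \<notin> E" | "\<theta> \<in> F" | "\<theta> \<in> E" "\<theta> \<notin> F" by blast
    thus "tame_extension R U (lower \<theta>) (derivative \<theta>)"
    proof cases
      case 1
      thus ?thesis using \<theta> by (intro tame_extension_transcendental lower_subring y U) (auto simp: E_def)
    next
      case 2
      show ?thesis
        by (rule tame_extension_algebraic[OF lower_subring y dc(1-3)[OF 2] IU(1)[OF 2] dc(5)[OF 2]])
    next
      case 3
      obtain k M where kM: "\<theta> = (k, M)" by fastforce
      obtain N where N: "(k, N) \<in> F" "N \<subseteq># M" using below 3 kM by blast
      have M: "N + (M - N) = M" using N(2) by simp
      have ne: "M - N \<noteq> {#}" using N(1) M 3 kM by auto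
      have "set_mset (M - N) \<subseteq> {..<m}" using \<theta> kM in_diffD by (fastforce simp: index_def)
      from separant_relation[OF FI[OF N(1)] dc(2,3)[OF N(1)] this ne]
      obtain T where T: "S (k, N) \<in> lower \<theta>" "T \<in> lower \<theta>" "S (k, N) \<otimes> derivative \<theta> \<oplus> T = \<zero>"
        unfolding M kM S_def by blast
      \<comment> \<open>The linear relation as a coefficient sequence of degree one: constant term
        \<open>T\<close>, leading coefficient \<open>S (k, N)\<close>. Later values only have to lie
        in the lower ring.\<close>
      define e where "e = (\<lambda>i::nat. if i = 0 then T else S (k, N))"
      have Tc: "T \<in> carrier R" using T(2) subringE(1)[OF lower_subring] by blast
      show ?thesis
      proof (rule tame_extension_algebraic[OF lower_subring y zero_less_one])
        show "range e \<subseteq> lower \<theta>" using T by (auto simp: e_def)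
        show "(\<Oplus>i\<in>{..<Suc 1}. e i \<otimes> derivative \<theta> [^] i) = \<zero>"
          using y Tc S[OF N(1)] T(3) by (simp add: lessThan_Suc e_def)
        show "e 1 \<in> U" using IU[OF N(1)] by (simp add: e_def)
        show "indep_powers R (lower \<theta>) (derivative \<theta>) 1"
          unfolding indep_powers_def
        proof (intro allI impI)
          fix c :: "nat \<Rightarrow> 'a" and i assume c: "range c \<subseteq> lower \<theta>" "(\<Oplus>i\<in>{..<1}. c i \<otimes> derivative \<theta> [^] i) = \<zero>"
            and "i < (1::nat)"
          have "c 0 \<in> carrier R" using c(1) subringE(1)[OF lower_subring[of \<theta>]] by blast
          thus "c i = \<zero>" using c(2) y \<open>i < 1\<close> by (simp add: lessThan_Suc)
        qed
      qed
    qed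
  qed
qed

end

section \<open>Localization\<close>

locale localized_domain = diff_cring R \<Delta> + domain R
  for R :: "('a, 'd, 'm) diff_ring_scheme" (structure) and \<Delta> :: "'d set" +
  fixes s :: 'a
  assumes s: "s \<in> carrier R" "s \<noteq> \<zero>"
begin

abbreviation "fr \<equiv> fraction R s"
abbreviation "Rs \<equiv> localization R s"

lemma powersI: "s [^] (n::nat) \<in> powers R s"
  by (auto simp: powers_def)

lemma powers_closed: "u \<in> powers R s \<Longrightarrow> u \<in> carrier R"
  using s by (auto simp: powers_def)

lemma powers_nonzero: "u \<in> powers R s \<Longrightarrow> u \<noteq> \<zero>"
proof -
  have "s [^] (n::nat) \<noteq> \<zero>" for n
    by (induction n) (use s integral in auto)
  thus "u \<in> powers R s \<Longrightarrow> u \<noteq> \<zero>" by (auto simp: powers_def)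
qed

lemma powers_one: "\<one> \<in> powers R s"
  using powersI[of 0] by simp

lemma powers_mult: "\<lbrakk>u \<in> powers R s; v \<in> powers R s\<rbrakk> \<Longrightarrow> u \<otimes> v \<in> powers R s"
  using s(1) by (auto simp: powers_def nat_pow_mult)

text \<open>In a domain the auxiliary multiplier \<open>t\<close> is nonzero and cancels, leaving
  plain cross multiplication.\<close>

lemma frac_rel_iff:
  "((a, u), (b, v)) \<in> frac_rel R s \<longleftrightarrow>
     a \<in> carrier R \<and> b \<in> carrier R \<and> u \<in> powers R s \<and> v \<in> powers R s \<and> a \<otimes> v = b \<otimes> u"
  unfolding frac_rel_def using powers_one powers_nonzero powers_closed by (auto simp: m_lcancel)

lemma frac_rel_equiv: "equiv (carrier R \<times> powers R s) (frac_rel R s)"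
proof (rule equivI)
  show "frac_rel R s \<subseteq> (carrier R \<times> powers R s) \<times> (carrier R \<times> powers R s)"
    by (auto simp: frac_rel_def)
  show "refl_on (carrier R \<times> powers R s) (frac_rel R s)"
    by (auto simp: refl_on_def frac_rel_iff)
  show "sym (frac_rel R s)" by (auto simp: sym_def frac_rel_iff)
  show "trans (frac_rel R s)"
  proof (rule transI, clarify)
    fix a u b v c w
    assume "((a, u), (b, v)) \<in> frac_rel R s" "((b, v), (c, w)) \<in> frac_rel R s"
    hence cl: "a \<in> carrier R" "b \<in> carrier R" "c \<in> carrier R" "u \<in> powers R s" "v \<in> powers R s" "w \<in> powers R s"
      and eq: "a \<otimes> v = b \<otimes> u" "b \<otimes> w = c \<otimes> v" by (auto simp: frac_rel_iff)
    note [simp] = cl(1-3) cl(4-6)[THEN powers_closed]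
    have "v \<otimes> (a \<otimes> w) = (a \<otimes> v) \<otimes> w" by (simp add: m_ac)
    also have "\<dots> = (b \<otimes> w) \<otimes> u" unfolding eq(1) by (simp add: m_ac)
    also have "\<dots> = v \<otimes> (c \<otimes> u)" unfolding eq(2) by (simp add: m_ac)
    finally have "a \<otimes> w = c \<otimes> u" using powers_nonzero[OF cl(5)] by (simp add: m_lcancel)
    thus "((a, u), (c, w)) \<in> frac_rel R s" using cl by (simp add: frac_rel_iff)
  qed
qed

lemma fraction_eq_iff:
  "\<lbrakk>a \<in> carrier R; b \<in> carrier R; u \<in> powers R s; v \<in> powers R s\<rbrakk> \<Longrightarrow> fr a u = fr b v \<longleftrightarrow> a \<otimes> v = b \<otimes> u"
  unfolding fraction_def using eq_equiv_class_iff[OF frac_rel_equiv, of "(a, u)" "(b, v)"]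
  by (simp add: frac_rel_iff)

lemma mem_fraction_iff:
  "\<lbrakk>a \<in> carrier R; u \<in> powers R s\<rbrakk> \<Longrightarrow>
     (b, v) \<in> fr a u \<longleftrightarrow> b \<in> carrier R \<and> v \<in> powers R s \<and> a \<otimes> v = b \<otimes> u"
  by (auto simp: fraction_def frac_rel_iff)

lemma carrier_localization: "carrier Rs = {fr a u | a u. a \<in> carrier R \<and> u \<in> powers R s}"
  by (auto simp: localization_def quotient_def fraction_def)

lemma carrier_localizationE:
  assumes "x \<in> carrier Rs"
  obtains a u where "a \<in> carrier R" "u \<in> powers R s" "x = fr a u"
  using assms by (auto simp: carrier_localization)

lemma fraction_closed: "\<lbrakk>a \<in> carrier R; u \<in> powers R s\<rbrakk> \<Longrightarrow> fr a u \<in> carrier Rs"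
  by (auto simp: carrier_localization)

text \<open>The operations are unions over representatives, which collapse to the common value as
  soon as this value is independent of the representative.\<close>

lemma fraction_UN:
  assumes "a \<in> carrier R" "u \<in> powers R s"
    and "\<And>b v. \<lbrakk>b \<in> carrier R; v \<in> powers R s; a \<otimes> v = b \<otimes> u\<rbrakk> \<Longrightarrow> F b v = X'"
  shows "(\<Union>(b, v)\<in>fr a u. F b v) = X'"
proof -
  have "(a, u) \<in> fr a u" using assms(1,2) by (simp add: mem_fraction_iff)
  moreover have "F b v = X'" if "(b, v) \<in> fr a u" for b v
    using that assms by (simp add: mem_fraction_iff)
  ultimately show ?thesis by blast
qed

lemma mult_fraction:
  assumes a: "a \<in> carrier R" "u \<in> powers R s" and b: "b \<in> carrier R" "v \<in> powers R s"
  shows "fr a u \<otimes>\<^bsub>Rs\<^esub> fr b v = fr (a \<otimes> b) (u \<otimes> v)"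
  unfolding localization_def monoid.simps
proof (rule fraction_UN[OF a], rule fraction_UN[OF b])
  fix a' u' b' v'
  assume cl: "a' \<in> carrier R" "u' \<in> powers R s" "b' \<in> carrier R" "v' \<in> powers R s"
    and eq: "a \<otimes> u' = a' \<otimes> u" "b \<otimes> v' = b' \<otimes> v"
  note [simp] = a b cl cl(2,4)[THEN powers_closed] a(2)[THEN powers_closed] b(2)[THEN powers_closed]
  have "(a' \<otimes> b') \<otimes> (u \<otimes> v) = (a' \<otimes> u) \<otimes> (b' \<otimes> v)" by (simp add: m_ac)
  also have "\<dots> = (a \<otimes> b) \<otimes> (u' \<otimes> v')" unfolding eq[symmetric] by (simp add: m_ac)
  finally show "fr (a' \<otimes> b') (u' \<otimes> v') = fr (a \<otimes> b) (u \<otimes> v)"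
    by (simp add: fraction_eq_iff powers_mult)
qed

lemma add_fraction:
  assumes a: "a \<in> carrier R" "u \<in> powers R s" and b: "b \<in> carrier R" "v \<in> powers R s"
  shows "fr a u \<oplus>\<^bsub>Rs\<^esub> fr b v = fr ((a \<otimes> v) \<oplus> (b \<otimes> u)) (u \<otimes> v)"
  unfolding localization_def ring.simps
proof (rule fraction_UN[OF a], rule fraction_UN[OF b])
  fix a' u' b' v'
  assume cl: "a' \<in> carrier R" "u' \<in> powers R s" "b' \<in> carrier R" "v' \<in> powers R s"
    and eq: "a \<otimes> u' = a' \<otimes> u" "b \<otimes> v' = b' \<otimes> v"
  note [simp] = a b cl cl(2,4)[THEN powers_closed] a(2)[THEN powers_closed] b(2)[THEN powers_closed]
  have "(a' \<otimes> v' \<oplus> b' \<otimes> u') \<otimes> (u \<otimes> v)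
      = (a' \<otimes> u) \<otimes> (v \<otimes> v') \<oplus> (b' \<otimes> v) \<otimes> (u \<otimes> u')" by (simp add: m_ac l_distr r_distr)
  also have "\<dots> = (a \<otimes> v \<oplus> b \<otimes> u) \<otimes> (u' \<otimes> v')"
    unfolding eq[symmetric] by (simp add: m_ac l_distr r_distr)
  finally show "fr (a' \<otimes> v' \<oplus> b' \<otimes> u') (u' \<otimes> v') = fr (a \<otimes> v \<oplus> b \<otimes> u) (u \<otimes> v)"
    by (simp add: fraction_eq_iff powers_mult)
qed

lemma der_powers: "\<lbrakk>\<delta> \<in> \<Delta>; u \<in> powers R s\<rbrakk> \<Longrightarrow> der R \<delta> u \<in> carrier R"
  using powers_closed by blast

lemma der_fraction:
  assumes \<delta>: "\<delta> \<in> \<Delta>" and a: "a \<in> carrier R" "u \<in> powers R s"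
  shows "der Rs \<delta> (fr a u) = fr ((der R \<delta> a \<otimes> u) \<ominus> (a \<otimes> der R \<delta> u)) (u \<otimes> u)"
  unfolding localization_def diff_ring.simps
proof (rule fraction_UN[OF a])
  fix b v
  assume b: "b \<in> carrier R" "v \<in> powers R s" and eq: "a \<otimes> v = b \<otimes> u"
  have c: "a \<in> carrier R" "b \<in> carrier R" "u \<in> carrier R" "v \<in> carrier R"
    "der R \<delta> a \<in> carrier R" "der R \<delta> b \<in> carrier R" "der R \<delta> u \<in> carrier R" "der R \<delta> v \<in> carrier R"
    using \<delta> a b powers_closed by auto
  have eq': "der R \<delta> a \<otimes> v \<oplus> a \<otimes> der R \<delta> v = der R \<delta> b \<otimes> u \<oplus> b \<otimes> der R \<delta> u"
    using arg_cong[OF eq, of "der R \<delta>"] c \<delta> by (simp add: der_mult)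
  \<comment> \<open>After cross multiplication the numerators differ by multiples of
    \<open>a v - b u\<close> and of its derivative; both vanish by \<open>eq\<close> and
    \<open>eq'\<close>.\<close>
  have "(der R \<delta> b \<otimes> v \<ominus> b \<otimes> der R \<delta> v) \<otimes> (u \<otimes> u)
    = (der R \<delta> a \<otimes> u \<ominus> a \<otimes> der R \<delta> u) \<otimes> (v \<otimes> v)
      \<oplus> (u \<otimes> v) \<otimes> ((der R \<delta> b \<otimes> u \<oplus> b \<otimes> der R \<delta> u) \<ominus> (der R \<delta> a \<otimes> v \<oplus> a \<otimes> der R \<delta> v))
      \<oplus> (der R \<delta> v \<otimes> u \<oplus> der R \<delta> u \<otimes> v) \<otimes> (a \<otimes> v \<ominus> b \<otimes> u)"
    using c by algebra
  also have "\<dots> = (der R \<delta> a \<otimes> u \<ominus> a \<otimes> der R \<delta> u) \<otimes> (v \<otimes> v)"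
    unfolding eq eq' using c by (simp add: a_minus_def r_neg)
  finally show "fr (der R \<delta> b \<otimes> v \<ominus> b \<otimes> der R \<delta> v) (v \<otimes> v) = fr (der R \<delta> a \<otimes> u \<ominus> a \<otimes> der R \<delta> u) (u \<otimes> u)"
    using c a b by (simp add: fraction_eq_iff powers_mult)
qed

lemma zero_localization: "\<zero>\<^bsub>Rs\<^esub> = fr \<zero> \<one>" and one_localization: "\<one>\<^bsub>Rs\<^esub> = fr \<one> \<one>"
  by (simp_all add: localization_def)

lemmas fraction_simps = mult_fraction add_fraction der_fraction zero_localization one_localization
  fraction_eq_iff fraction_closed powers_mult powers_one powers_closed

lemma localization_cring: "cring Rs"
proof (intro cringI abelian_groupI comm_monoidI)
  fix x y z
  assume x: "x \<in> carrier Rs" and y: "y \<in> carrier Rs" and z: "z \<in> carrier Rs"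
  obtain a u where a: "a \<in> carrier R" "u \<in> powers R s" "x = fr a u" using x by (rule carrier_localizationE)
  obtain b v where b: "b \<in> carrier R" "v \<in> powers R s" "y = fr b v" using y by (rule carrier_localizationE)
  obtain c w where c: "c \<in> carrier R" "w \<in> powers R s" "z = fr c w" using z by (rule carrier_localizationE)
  note abc = a(1,2) b(1,2) c(1,2) a(2)[THEN powers_closed] b(2)[THEN powers_closed] c(2)[THEN powers_closed]
  note ring = l_distr r_distr m_ac a_ac
  show "x \<oplus>\<^bsub>Rs\<^esub> y \<oplus>\<^bsub>Rs\<^esub> z = x \<oplus>\<^bsub>Rs\<^esub> (y \<oplus>\<^bsub>Rs\<^esub> z)"
    unfolding a b c using abc by (simp add: fraction_simps ring)
  show "x \<otimes>\<^bsub>Rs\<^esub> y \<otimes>\<^bsub>Rs\<^esub> z = x \<otimes>\<^bsub>Rs\<^esub> (y \<otimes>\<^bsub>Rs\<^esub> z)"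
    unfolding a b c using abc by (simp add: fraction_simps ring)
  show "(x \<oplus>\<^bsub>Rs\<^esub> y) \<otimes>\<^bsub>Rs\<^esub> z = x \<otimes>\<^bsub>Rs\<^esub> z \<oplus>\<^bsub>Rs\<^esub> y \<otimes>\<^bsub>Rs\<^esub> z"
    unfolding a b c using abc by (simp add: fraction_simps ring)
next
  fix x y
  assume x: "x \<in> carrier Rs" and y: "y \<in> carrier Rs"
  obtain a u where a: "a \<in> carrier R" "u \<in> powers R s" "x = fr a u" using x by (rule carrier_localizationE)
  obtain b v where b: "b \<in> carrier R" "v \<in> powers R s" "y = fr b v" using y by (rule carrier_localizationE)
  note abc = a(1,2) b(1,2) a(2)[THEN powers_closed] b(2)[THEN powers_closed]
  note ring = l_distr r_distr m_ac a_ac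
  show "x \<oplus>\<^bsub>Rs\<^esub> y \<in> carrier Rs" "x \<otimes>\<^bsub>Rs\<^esub> y \<in> carrier Rs"
    unfolding a b using abc by (simp_all add: fraction_simps)
  show "x \<oplus>\<^bsub>Rs\<^esub> y = y \<oplus>\<^bsub>Rs\<^esub> x" "x \<otimes>\<^bsub>Rs\<^esub> y = y \<otimes>\<^bsub>Rs\<^esub> x"
    unfolding a b using abc by (simp_all add: fraction_simps ring)
next
  fix x
  assume x: "x \<in> carrier Rs"
  obtain a u where a: "a \<in> carrier R" "u \<in> powers R s" "x = fr a u" using x by (rule carrier_localizationE)
  note au = a(1,2) a(2)[THEN powers_closed]
  show "\<zero>\<^bsub>Rs\<^esub> \<oplus>\<^bsub>Rs\<^esub> x = x" "\<one>\<^bsub>Rs\<^esub> \<otimes>\<^bsub>Rs\<^esub> x = x"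
    unfolding a using au by (simp_all add: fraction_simps m_ac)
  have "fr (\<ominus> a) u \<oplus>\<^bsub>Rs\<^esub> x = \<zero>\<^bsub>Rs\<^esub>"
    unfolding a using au by (simp add: fraction_simps l_minus l_neg)
  thus "\<exists>y\<in>carrier Rs. y \<oplus>\<^bsub>Rs\<^esub> x = \<zero>\<^bsub>Rs\<^esub>"
    using au by (intro bexI[of _ "fr (\<ominus> a) u"]) (auto simp: fraction_simps)
next
  show "\<zero>\<^bsub>Rs\<^esub> \<in> carrier Rs" "\<one>\<^bsub>Rs\<^esub> \<in> carrier Rs"
    by (simp_all add: fraction_simps)
qed

lemma localization_derivation:
  assumes \<delta>: "\<delta> \<in> \<Delta>" shows "derivation Rs (der Rs \<delta>)"
  unfolding derivation_def
proof (intro conjI ballI Pi_I)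
  fix x
  assume x: "x \<in> carrier Rs"
  obtain a u where a: "a \<in> carrier R" "u \<in> powers R s" "x = fr a u" using x by (rule carrier_localizationE)
  note au = a(1,2) a(2)[THEN powers_closed] der_closed[OF \<delta> a(1)] der_powers[OF \<delta> a(2)]
  show "der Rs \<delta> x \<in> carrier Rs" unfolding a using au \<delta> by (simp add: fraction_simps)
  fix y
  assume y: "y \<in> carrier Rs"
  obtain b v where b: "b \<in> carrier R" "v \<in> powers R s" "y = fr b v" using y by (rule carrier_localizationE)
  note bv = b(1,2) b(2)[THEN powers_closed] der_closed[OF \<delta> b(1)] der_powers[OF \<delta> b(2)]
  let ?a = "der R \<delta> a" and ?u = "der R \<delta> u" and ?b = "der R \<delta> b" and ?v = "der R \<delta> v"
  have "(((?a \<otimes> v \<oplus> a \<otimes> ?v) \<oplus> (?b \<otimes> u \<oplus> b \<otimes> ?u)) \<otimes> (u \<otimes> v) \<ominus> (a \<otimes> v \<oplus> b \<otimes> u) \<otimes> (?u \<otimes> v \<oplus> u \<otimes> ?v))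
      \<otimes> ((u \<otimes> u) \<otimes> (v \<otimes> v))
    = ((?a \<otimes> u \<ominus> a \<otimes> ?u) \<otimes> (v \<otimes> v) \<oplus> (?b \<otimes> v \<ominus> b \<otimes> ?v) \<otimes> (u \<otimes> u)) \<otimes> ((u \<otimes> v) \<otimes> (u \<otimes> v))"
    using au(1,3-) bv(1,3-) by algebra
  thus "der Rs \<delta> (x \<oplus>\<^bsub>Rs\<^esub> y) = der Rs \<delta> x \<oplus>\<^bsub>Rs\<^esub> der Rs \<delta> y"
    unfolding a b using au bv \<delta> by (simp add: fraction_simps der_add der_mult)
  \<comment> \<open>Numerators of the two products in the Leibniz rule, kept opaque so that
    comparing denominators does not expand them.\<close>
  define p q where "p = (?a \<otimes> u \<ominus> a \<otimes> ?u) \<otimes> b" and "q = a \<otimes> (?b \<otimes> v \<ominus> b \<otimes> ?v)"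
  have pq: "p \<in> carrier R" "q \<in> carrier R" using au bv by (simp_all add: p_def q_def)
  have "(?a \<otimes> b \<oplus> a \<otimes> ?b) \<otimes> (u \<otimes> v) \<ominus> (a \<otimes> b) \<otimes> (?u \<otimes> v \<oplus> u \<otimes> ?v) = p \<otimes> v \<oplus> q \<otimes> u"
    unfolding p_def q_def using au(1,3-) bv(1,3-) by algebra
  hence "der Rs \<delta> (x \<otimes>\<^bsub>Rs\<^esub> y) = fr (p \<otimes> v \<oplus> q \<otimes> u) ((u \<otimes> v) \<otimes> (u \<otimes> v))"
    unfolding a b using au bv \<delta> by (simp add: mult_fraction der_fraction powers_mult der_mult)
  also have "\<dots> = fr p (u \<otimes> u \<otimes> v) \<oplus>\<^bsub>Rs\<^esub> fr q (u \<otimes> (v \<otimes> v))"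
    using pq au(2,3) bv(2,3) by (simp add: fraction_simps l_distr r_distr m_ac a_ac)
  also have "\<dots> = der Rs \<delta> x \<otimes>\<^bsub>Rs\<^esub> y \<oplus>\<^bsub>Rs\<^esub> x \<otimes>\<^bsub>Rs\<^esub> der Rs \<delta> y"
    unfolding a b p_def q_def using au bv \<delta> by (simp add: mult_fraction der_fraction powers_mult)
  finally show "der Rs \<delta> (x \<otimes>\<^bsub>Rs\<^esub> y) = der Rs \<delta> x \<otimes>\<^bsub>Rs\<^esub> y \<oplus>\<^bsub>Rs\<^esub> x \<otimes>\<^bsub>Rs\<^esub> der Rs \<delta> y" .
qed

text \<open>Both orders lead to the same denominator, the fourth power of \<open>u\<close>, so
  numerators can be compared directly; they agree because mixed second derivatives in
  \<open>R\<close> agree.\<close>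

lemma localization_der_commute:
  assumes \<delta>: "\<delta> \<in> \<Delta>" and \<epsilon>: "\<epsilon> \<in> \<Delta>" and x: "x \<in> carrier Rs"
  shows "der Rs \<delta> (der Rs \<epsilon> x) = der Rs \<epsilon> (der Rs \<delta> x)"
proof -
  obtain a u where a: "a \<in> carrier R" "u \<in> powers R s" "x = fr a u" using x by (rule carrier_localizationE)
  have second: "der Rs \<delta> (der Rs \<epsilon> x) = fr (((der R \<delta> (der R \<epsilon> a) \<otimes> u \<oplus> der R \<epsilon> a \<otimes> der R \<delta> u)
      \<ominus> (der R \<delta> a \<otimes> der R \<epsilon> u \<oplus> a \<otimes> der R \<delta> (der R \<epsilon> u))) \<otimes> (u \<otimes> u)
      \<ominus> (der R \<epsilon> a \<otimes> u \<ominus> a \<otimes> der R \<epsilon> u) \<otimes> (der R \<delta> u \<otimes> u \<oplus> u \<otimes> der R \<delta> u)) ((u \<otimes> u) \<otimes> (u \<otimes> u))"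
    if \<delta>: "\<delta> \<in> \<Delta>" and \<epsilon>: "\<epsilon> \<in> \<Delta>" for \<delta> \<epsilon>
  proof -
    have au: "a \<in> carrier R" "u \<in> powers R s" "u \<in> carrier R" "der R \<epsilon> a \<in> carrier R" "der R \<epsilon> u \<in> carrier R"
      "der R \<delta> a \<in> carrier R" "der R \<delta> u \<in> carrier R" "der R \<delta> (der R \<epsilon> a) \<in> carrier R" "der R \<delta> (der R \<epsilon> u) \<in> carrier R"
      using a powers_closed \<delta> \<epsilon> by auto
    have "der R \<delta> (der R \<epsilon> a \<otimes> u \<ominus> a \<otimes> der R \<epsilon> u)
      = (der R \<delta> (der R \<epsilon> a) \<otimes> u \<oplus> der R \<epsilon> a \<otimes> der R \<delta> u) \<ominus> (der R \<delta> a \<otimes> der R \<epsilon> u \<oplus> a \<otimes> der R \<delta> (der R \<epsilon> u))"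
      unfolding a_minus_def using au \<delta> by (simp add: der_add der_minus der_mult)
    thus ?thesis unfolding a using au \<delta> \<epsilon> by (simp add: fraction_simps der_mult)
  qed
  have au: "a \<in> carrier R" "u \<in> carrier R" "der R \<epsilon> a \<in> carrier R" "der R \<epsilon> u \<in> carrier R"
      "der R \<delta> a \<in> carrier R" "der R \<delta> u \<in> carrier R" "der R \<delta> (der R \<epsilon> a) \<in> carrier R" "der R \<delta> (der R \<epsilon> u) \<in> carrier R"
      using a powers_closed \<delta> \<epsilon> by auto
  have "((der R \<delta> (der R \<epsilon> a) \<otimes> u \<oplus> der R \<epsilon> a \<otimes> der R \<delta> u)
      \<ominus> (der R \<delta> a \<otimes> der R \<epsilon> u \<oplus> a \<otimes> der R \<delta> (der R \<epsilon> u))) \<otimes> (u \<otimes> u)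
      \<ominus> (der R \<epsilon> a \<otimes> u \<ominus> a \<otimes> der R \<epsilon> u) \<otimes> (der R \<delta> u \<otimes> u \<oplus> u \<otimes> der R \<delta> u)
    = ((der R \<delta> (der R \<epsilon> a) \<otimes> u \<oplus> der R \<delta> a \<otimes> der R \<epsilon> u)
      \<ominus> (der R \<epsilon> a \<otimes> der R \<delta> u \<oplus> a \<otimes> der R \<delta> (der R \<epsilon> u))) \<otimes> (u \<otimes> u)
      \<ominus> (der R \<delta> a \<otimes> u \<ominus> a \<otimes> der R \<delta> u) \<otimes> (der R \<epsilon> u \<otimes> u \<oplus> u \<otimes> der R \<epsilon> u)"
    using au by algebra
  thus ?thesis
    using second[OF \<delta> \<epsilon>] second[OF \<epsilon> \<delta>] der_commute[OF \<delta> \<epsilon>] a powers_closed by simp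
qed

lemma localization_differential_ring: "differential_ring \<Delta> Rs"
  using localization_cring localization_derivation localization_der_commute diff
  unfolding differential_ring_def by blast

lemma to_localization_hom: "to_localization R s \<in> ring_hom R Rs"
  by (rule ring_hom_memI) (simp_all add: to_localization_def fraction_simps)

lemma to_localization_der:
  "\<lbrakk>\<delta> \<in> \<Delta>; a \<in> carrier R\<rbrakk> \<Longrightarrow> to_localization R s (der R \<delta> a) = der Rs \<delta> (to_localization R s a)"
  by (simp add: to_localization_def fraction_simps a_minus_def)

section \<open>Primes of the localization and primes avoiding \<open>s\<close>\<close>

definition extension :: "'a set \<Rightarrow> ('a \<times> 'a) set set" where
  "extension Q = {fr a u | a u. a \<in> Q \<and> u \<in> powers R s}"

context
  fixes Q assumes Q: "prime_differential_ideal \<Delta> R Q" and sQ: "s \<notin> Q"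
begin

interpretation Q: primeideal Q R
  using Q by (simp add: prime_differential_ideal_def)

lemma powers_notin_prime: "u \<in> powers R s \<Longrightarrow> u \<notin> Q"
proof -
  have "s [^] (n::nat) \<notin> Q" for n
  proof (induction n)
    case 0
    have "\<one> \<notin> Q" using Q.one_imp_carrier Q.I_notcarr by blast
    thus ?case by simp
  next
    case (Suc n)
    thus ?case using Q.I_prime[of "s [^] n" s] sQ s by auto
  qed
  thus "u \<in> powers R s \<Longrightarrow> u \<notin> Q" by (auto simp: powers_def)
qed

text \<open>\<open>extension\<close> asks for one representative with numerator in \<open>Q\<close>.
  All others then qualify: cross multiplication puts the numerator times a power of \<open>s\<close>
  into \<open>Q\<close>, and such powers lie outside the prime \<open>Q\<close>.\<close>

lemma fraction_in_extension_iff: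
  assumes "a \<in> carrier R" "u \<in> powers R s"
  shows "fr a u \<in> extension Q \<longleftrightarrow> a \<in> Q"
proof
  assume "fr a u \<in> extension Q"
  then obtain b v where b: "b \<in> Q" "v \<in> powers R s" "fr a u = fr b v" by (auto simp: extension_def)
  have "b \<in> carrier R" using b(1) Q.a_subset by blast
  hence "a \<otimes> v = b \<otimes> u" using b assms by (simp add: fraction_eq_iff)
  hence "a \<otimes> v \<in> Q" using Q.I_r_closed[OF b(1) powers_closed[OF assms(2)]] by simp
  thus "a \<in> Q" using Q.I_prime[of a v] powers_notin_prime[OF b(2)] assms powers_closed[OF b(2)] by blast
next
  assume "a \<in> Q"
  thus "fr a u \<in> extension Q" using assms by (auto simp: extension_def)
qed

text \<open>All conditions become conditions on numerators; in the quotient rule both terms stay in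
  \<open>Q\<close>, since \<open>a\<close> and its derivative do.\<close>

lemma extension_prime: "prime_differential_ideal \<Delta> Rs (extension Q)"
proof -
  interpret Rs: cring Rs by (rule localization_cring)
  interpret Rs: diff_cring Rs \<Delta> by unfold_locales (rule localization_differential_ring)
  have sub: "extension Q \<subseteq> carrier Rs" using Q.a_subset by (auto simp: extension_def fraction_closed)
  have mem: "\<exists>a u. a \<in> Q \<and> a \<in> carrier R \<and> u \<in> powers R s \<and> x = fr a u" if "x \<in> extension Q" for x
    using that Q.a_subset by (auto simp: extension_def)
  have QD: "der R \<delta> a \<in> Q" if "\<delta> \<in> \<Delta>" "a \<in> Q" for \<delta> a
    using Q that by (auto simp: prime_differential_ideal_def)
  have "Rs.diff_ideal (extension Q)"
  proof (rule Rs.diff_idealI[OF sub])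
    show "\<zero>\<^bsub>Rs\<^esub> \<in> extension Q"
      unfolding zero_localization by (simp add: fraction_in_extension_iff powers_one)
    fix x assume "x \<in> extension Q"
    then obtain a u where a: "a \<in> Q" "a \<in> carrier R" "u \<in> powers R s" "x = fr a u" using mem by blast
    note au = a(1-3) powers_closed[OF a(3)]
    {
      fix y assume "y \<in> extension Q"
      then obtain b v where b: "b \<in> Q" "b \<in> carrier R" "v \<in> powers R s" "y = fr b v" using mem by blast
      note bv = b(1-3) powers_closed[OF b(3)]
      have "a \<otimes> v \<oplus> b \<otimes> u \<in> Q" using au bv Q.I_r_closed by simp
      thus "x \<oplus>\<^bsub>Rs\<^esub> y \<in> extension Q"
        unfolding a b using au bv by (simp add: add_fraction fraction_in_extension_iff powers_mult)
    next
      fix r assume "r \<in> carrier Rs"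
      then obtain b v where b: "b \<in> carrier R" "v \<in> powers R s" "r = fr b v" by (rule carrier_localizationE)
      have "b \<otimes> a \<in> Q" using a b Q.I_l_closed by simp
      thus "r \<otimes>\<^bsub>Rs\<^esub> x \<in> extension Q"
        unfolding a b using au b(1,2) by (simp add: mult_fraction fraction_in_extension_iff powers_mult)
    next
      fix \<delta> assume \<delta>: "\<delta> \<in> \<Delta>"
      have "der R \<delta> a \<otimes> u \<ominus> a \<otimes> der R \<delta> u \<in> Q"
        unfolding a_minus_def using au QD[OF \<delta> a(1)] \<delta> Q.I_r_closed by simp
      thus "der Rs \<delta> x \<in> extension Q"
        unfolding a using au \<delta> by (simp add: der_fraction fraction_in_extension_iff powers_mult)
    }
  qed
  note di = this
  have "primeideal (extension Q) Rs"
  proof (rule primeidealI)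
    show "ideal (extension Q) Rs" using di by (simp add: Rs.diff_ideal_def)
    show "cring Rs" by (rule localization_cring)
    have "\<one>\<^bsub>Rs\<^esub> \<notin> extension Q"
      unfolding one_localization using powers_notin_prime[OF powers_one]
      by (simp add: fraction_in_extension_iff powers_one)
    thus "carrier Rs \<noteq> extension Q" using Rs.one_closed by blast
    fix x y assume xy: "x \<in> carrier Rs" "y \<in> carrier Rs" "x \<otimes>\<^bsub>Rs\<^esub> y \<in> extension Q"
    obtain a u where a: "a \<in> carrier R" "u \<in> powers R s" "x = fr a u" using xy(1) by (rule carrier_localizationE)
    obtain b v where b: "b \<in> carrier R" "v \<in> powers R s" "y = fr b v" using xy(2) by (rule carrier_localizationE)
    have "a \<otimes> b \<in> Q"
      using xy(3) unfolding a b using a(1,2) b(1,2)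
      by (simp add: mult_fraction fraction_in_extension_iff powers_mult)
    hence "a \<in> Q \<or> b \<in> Q" using Q.I_prime a b by blast
    thus "x \<in> extension Q \<or> y \<in> extension Q"
      unfolding a b using a(1,2) b(1,2) by (simp add: fraction_in_extension_iff)
  qed
  thus ?thesis using di by (simp add: prime_differential_ideal_def Rs.diff_ideal_def)
qed

end

text \<open>\<open>s\<close> becomes a unit, so it cannot lie in the contraction of a proper ideal.
  A fraction and its numerator differ by the unit \<open>u\<close>, so they belong to
  \<open>Q\<close> together.\<close>

lemma contraction_prime:
  assumes Q: "prime_differential_ideal \<Delta> Rs Q"
  shows "prime_differential_ideal \<Delta> R {a \<in> carrier R. to_localization R s a \<in> Q}"
    and "s \<notin> {a \<in> carrier R. to_localization R s a \<in> Q}"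
    and "\<lbrakk>a \<in> carrier R; u \<in> powers R s\<rbrakk> \<Longrightarrow> fr a u \<in> Q \<longleftrightarrow> to_localization R s a \<in> Q"
proof -
  interpret Rs: cring Rs by (rule localization_cring)
  interpret Q: primeideal Q Rs using Q by (simp add: prime_differential_ideal_def)
  interpret f: ring_hom_cring R Rs "to_localization R s"
    by (intro ring_hom_cring.intro ring_hom_cring_axioms.intro is_cring localization_cring to_localization_hom)
  have one: "\<one>\<^bsub>Rs\<^esub> \<notin> Q" using Q.one_imp_carrier Q.I_notcarr by blast
  show "prime_differential_ideal \<Delta> R {a \<in> carrier R. to_localization R s a \<in> Q}"
    unfolding prime_differential_ideal_def
  proof
    show "primeideal {a \<in> carrier R. to_localization R s a \<in> Q} R"
      by (rule f.ring.primeideal_vimage[OF is_cring Q.primeideal_axioms])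
    show "\<forall>\<delta>\<in>\<Delta>. \<forall>x\<in>{a \<in> carrier R. to_localization R s a \<in> Q}.
        der R \<delta> x \<in> {a \<in> carrier R. to_localization R s a \<in> Q}"
      using Q by (auto simp: to_localization_der prime_differential_ideal_def)
  qed
  show sn: "s \<notin> {a \<in> carrier R. to_localization R s a \<in> Q}"
  proof
    assume "s \<in> {a \<in> carrier R. to_localization R s a \<in> Q}"
    hence "fr \<one> s \<otimes>\<^bsub>Rs\<^esub> to_localization R s s \<in> Q"
      using powersI[of 1] s by (intro Q.I_l_closed fraction_closed) auto
    moreover have "fr \<one> s \<otimes>\<^bsub>Rs\<^esub> to_localization R s s = \<one>\<^bsub>Rs\<^esub>"
      using powersI[of 1] s by (simp add: to_localization_def fraction_simps)
    ultimately show False using one by simp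
  qed
  assume a: "a \<in> carrier R" "u \<in> powers R s"
  note au = a powers_closed[OF a(2)]
  have 1: "fr a u = fr \<one> u \<otimes>\<^bsub>Rs\<^esub> to_localization R s a"
    and 2: "to_localization R s a = fr u \<one> \<otimes>\<^bsub>Rs\<^esub> fr a u"
    using au by (simp_all add: to_localization_def fraction_simps m_ac)
  show "fr a u \<in> Q \<longleftrightarrow> to_localization R s a \<in> Q"
  proof
    assume "fr a u \<in> Q"
    thus "to_localization R s a \<in> Q"
      unfolding 2 using au by (intro Q.I_l_closed fraction_closed powers_one)
  next
    assume "to_localization R s a \<in> Q"
    thus "fr a u \<in> Q"
      unfolding 1 using au by (intro Q.I_l_closed fraction_closed) auto
  qed
qed

end

section \<open>Going down\<close>

text \<open>In the derivative of \<open>x \<otimes> c\<close> both terms of the product rule keep a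
  factor from \<open>p\<close>, since \<open>p\<close> is stable under derivations.\<close>

lemma (in diff_cring) ideal_span_diff_ideal:
  assumes p: "p \<subseteq> carrier R" and der_p: "\<And>\<delta> x. \<lbrakk>\<delta> \<in> \<Delta>; x \<in> p\<rbrakk> \<Longrightarrow> der R \<delta> x \<in> p"
  shows "diff_ideal (ideal_span R p (carrier R))"
proof (rule diff_idealI)
  note I = ideal_span_props[OF p carrier_is_subring]
  show "ideal_span R p (carrier R) \<subseteq> carrier R" "\<zero> \<in> ideal_span R p (carrier R)"
    using I(1,2) by auto
  show "x \<oplus> y \<in> ideal_span R p (carrier R)"
    if "x \<in> ideal_span R p (carrier R)" "y \<in> ideal_span R p (carrier R)" for x y
    using I(3) that by blast
  show "r \<otimes> x \<in> ideal_span R p (carrier R)" if "x \<in> ideal_span R p (carrier R)" "r \<in> carrier R" for x r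
    using I(4) that by blast
  fix \<delta> x assume \<delta>: "\<delta> \<in> \<Delta>" and "x \<in> ideal_span R p (carrier R)"
  from this(2) show "der R \<delta> x \<in> ideal_span R p (carrier R)"
    unfolding ideal_span_def[of R p]
  proof induction
    case zero
    show ?case using \<delta> by (simp add: additive_closure.zero)
  next
    case (add w z)
    then obtain x c where w: "w = x \<otimes> c" "x \<in> p" "c \<in> carrier R" by blast
    have z: "z \<in> ideal_span R p (carrier R)" "der R \<delta> z \<in> ideal_span R p (carrier R)"
      using add by (simp_all add: ideal_span_def)
    have car: "x \<in> carrier R" "z \<in> carrier R" using w p z I(1) by auto
    have "der R \<delta> (w \<oplus> z) = der R \<delta> x \<otimes> c \<oplus> x \<otimes> der R \<delta> c \<oplus> der R \<delta> z"
      unfolding w(1) using \<delta> w(3) car by (simp add: der_add der_mult)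
    also have "\<dots> \<in> ideal_span R p (carrier R)"
      using I(3,5) der_p[OF \<delta> w(2)] w z(2) \<delta> by simp
    finally show ?case by (simp add: ideal_span_def)
  qed
qed

text \<open>A word of derivations in any order is absorbed letter by letter into a multiset by
  \<open>der_derivative\<close>.\<close>

lemma (in derivative_tower) all_derivatives_subset:
  assumes "D ` {..<m} = \<Delta>"
  shows "all_derivatives \<Delta> R (g ` {..<K}) \<subseteq> derivative ` index"
proof
  fix z assume "z \<in> all_derivatives \<Delta> R (g ` {..<K})"
  then obtain \<delta>s k where z: "z = foldr (der R) \<delta>s (g k)" "set \<delta>s \<subseteq> \<Delta>" "k < K"
    by (auto simp: all_derivatives_def)
  have "\<exists>M. (k, M) \<in> index \<and> foldr (der R) \<delta>s (g k) = derivative (k, M)"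
    using z(2)
  proof (induction \<delta>s)
    case Nil
    show ?case using z(3) by (intro exI[of _ "{#}"]) (simp add: index_def derivative_def)
  next
    case (Cons \<delta> \<delta>s)
    then obtain M where M: "(k, M) \<in> index" "foldr (der R) \<delta>s (g k) = derivative (k, M)" by auto
    obtain i where i: "i < m" "\<delta> = D i" using Cons.prems assms by auto
    show ?case
      using index_add_mset[OF M(1) i(1)] der_derivative[OF M(1) i(1)] M(2) i(2)
      by (intro exI[of _ "add_mset i M"]) auto
  qed
  thus "z \<in> derivative ` index" using z(1) by auto
qed

text \<open>Going down by one step, stated in \<open>B\<close> with primes \<open>q\<close> that
  avoid \<open>s\<close> in place of primes of the localization; one \<open>s\<close> works for all
  \<open>p\<close> and \<open>q\<close>.\<close>

lemma going_down_denominator: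
  fixes B :: "('a, 'd, 'm) diff_ring_scheme"
  assumes ritt: "ritt_algebra \<Delta> B" and dom: "domain B" and A: "differential_subring \<Delta> A B"
    and gen: "differentially_finitely_generated \<Delta> A B"
  shows "\<exists>s\<in>carrier B. s \<noteq> \<zero>\<^bsub>B\<^esub> \<and>
    (\<forall>p q. prime_differential_ideal \<Delta> (B\<lparr>carrier := A\<rparr>) p \<longrightarrow> prime_differential_ideal \<Delta> B q \<longrightarrow>
       s \<notin> q \<longrightarrow> p \<subseteq> q \<longrightarrow> (\<exists>q'. prime_differential_ideal \<Delta> B q' \<and> q' \<subseteq> q \<and> q' \<inter> A = p))"
proof -
  interpret domain B by (rule dom)
  have diffB: "differential_ring \<Delta> B" using ritt by (simp add: ritt_algebra_def)
  interpret diff_cring B \<Delta> by unfold_locales (rule diffB)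
  have divisible: "\<And>n::nat. n > 0 \<Longrightarrow> \<exists>r\<in>carrier B. r \<otimes>\<^bsub>B\<^esub> add_pow B n \<one>\<^bsub>B\<^esub> = \<one>\<^bsub>B\<^esub>"
    by (rule ritt_algebra_divisible[OF ritt])
  have subA: "subring A B" and derA: "\<And>\<delta> x. \<lbrakk>\<delta> \<in> \<Delta>; x \<in> A\<rbrakk> \<Longrightarrow> der B \<delta> x \<in> A"
    using A by (auto simp: differential_subring_def)
  note AE = subringE[OF subA]
  obtain G where G: "finite G" "G \<subseteq> carrier B" "generate_ring B (A \<union> all_derivatives \<Delta> B G) = carrier B"
    using gen by (auto simp: differentially_finitely_generated_def)
  \<comment> \<open>Derivations and generators are numbered, because the ranking needs an order on
    their names.\<close>
  have "finite \<Delta>" using diffB by (simp add: differential_ring_def)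
  then obtain D where D: "bij_betw D {0..<card \<Delta>} \<Delta>" using ex_bij_betw_nat_finite by blast
  obtain g where g: "bij_betw g {0..<card G} G" using ex_bij_betw_nat_finite[OF G(1)] by blast
  define m K where "m = card \<Delta>" and "K = card G"
  have Dm: "D ` {..<m} = \<Delta>" and gK: "g ` {..<K} = G"
    using D g by (auto simp: bij_betw_def m_def K_def atLeast0LessThan)
  have char_zero: "\<And>n::nat. n > 0 \<Longrightarrow> add_pow B n \<one>\<^bsub>B\<^esub> \<noteq> \<zero>\<^bsub>B\<^esub>"
  proof
    fix n :: nat assume "n > 0" and "add_pow B n \<one>\<^bsub>B\<^esub> = \<zero>\<^bsub>B\<^esub>"
    thus False using divisible[of n] by auto
  qed
  interpret derivative_tower B \<Delta> A D m g K
    by (intro derivative_tower.intro derivative_tower_axioms.intro diff_cring_axioms domain_axioms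
        subA derA char_zero) (use Dm gK G(2) in auto)
  have gens: "A \<union> derivative ` index \<subseteq> carrier B" using AE(1) derivative_closed by auto
  have top: "generate_ring B (A \<union> derivative ` index) = carrier B"
  proof
    show "generate_ring B (A \<union> derivative ` index) \<subseteq> carrier B" by (rule generate_ring_incl[OF gens])
    have "A \<union> all_derivatives \<Delta> B G \<subseteq> A \<union> derivative ` index"
      using all_derivatives_subset[OF Dm] gK by auto
    from mono_generate_ring[OF this gens] show "carrier B \<subseteq> generate_ring B (A \<union> derivative ` index)"
      using G(3) by simp
  qed
  obtain s where s: "s \<in> carrier B" "s \<noteq> \<zero>\<^bsub>B\<^esub>"
    and tame': "\<forall>U. \<one>\<^bsub>B\<^esub> \<in> U \<longrightarrow> s \<in> U \<longrightarrow>
      (\<forall>u\<in>carrier B. \<forall>v\<in>carrier B. u \<otimes>\<^bsub>B\<^esub> v \<in> U \<longrightarrow> u \<in> U) \<longrightarrow>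
      (\<forall>\<theta>\<in>index. tame_extension B U (lower \<theta>) (derivative \<theta>))"
    using tame_tower by (elim bexE conjE) (rule that)
  note tame = tame'[THEN spec, THEN mp, THEN mp, THEN mp, THEN bspec]
  have "\<exists>q'. prime_differential_ideal \<Delta> B q' \<and> q' \<subseteq> q \<and> q' \<inter> A = p"
    if p: "prime_differential_ideal \<Delta> (B\<lparr>carrier := A\<rparr>) p" and q: "prime_differential_ideal \<Delta> B q"
      and sq: "s \<notin> q" and pq: "p \<subseteq> q" for p q
  proof -
    interpret p: primeideal p "B\<lparr>carrier := A\<rparr>" using p by (simp add: prime_differential_ideal_def)
    interpret q: primeideal q B using q by (simp add: prime_differential_ideal_def)
    have pA: "p \<subseteq> A" using p.a_subset by simp
    have pc: "p \<subseteq> carrier B" using pA AE(1) by blast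
    have der_p: "\<And>\<delta> x. \<lbrakk>\<delta> \<in> \<Delta>; x \<in> p\<rbrakk> \<Longrightarrow> der B \<delta> x \<in> p"
      using p by (simp add: prime_differential_ideal_def)
    have p1: "\<one>\<^bsub>B\<^esub> \<notin> p" using p.one_imp_carrier p.I_notcarr by auto
    have p_prime: "a \<in> p \<or> b \<in> p" if "a \<in> A" "b \<in> A" "a \<otimes>\<^bsub>B\<^esub> b \<in> p" for a b
      using p.I_prime[of a b] that by simp
    have q1: "\<one>\<^bsub>B\<^esub> \<notin> q" using q.one_imp_carrier q.I_notcarr by auto
    define U where "U = carrier B - q"
    have U: "\<one>\<^bsub>B\<^esub> \<in> U" "s \<in> U" "\<And>u v. \<lbrakk>u \<in> U; v \<in> U\<rbrakk> \<Longrightarrow> u \<otimes>\<^bsub>B\<^esub> v \<in> U"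
      using q1 s sq q.I_prime by (auto simp: U_def)
    have Udiv: "\<forall>u\<in>carrier B. \<forall>v\<in>carrier B. u \<otimes>\<^bsub>B\<^esub> v \<in> U \<longrightarrow> u \<in> U"
      using q.I_r_closed by (auto simp: U_def)
    define I where "I = ideal_span B p (carrier B)"
    note I = ideal_span_props[OF pc carrier_is_subring, folded I_def]
    have Iq: "I \<subseteq> q"
    proof
      fix z assume "z \<in> I"
      thus "z \<in> q" unfolding I_def ideal_span_def
        by induction (use q.I_r_closed pq in auto)
    qed
    have torsion: "torsion_killed B p a U (carrier B)" if a: "a \<in> A" "a \<notin> p" for a
    proof -
      have base: "torsion_killed B p a U A"
      proof (rule torsion_killed_base[OF subA pA])
        show "x \<oplus>\<^bsub>B\<^esub> z \<in> p" if "x \<in> p" "z \<in> p" for x z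
          using additive_subgroup.a_closed[OF p.additive_subgroup_axioms that] by simp
        show "x \<otimes>\<^bsub>B\<^esub> c \<in> p" if "x \<in> p" "c \<in> A" for x c using p.I_r_closed[of x c] that by simp
        show "b \<in> p" if "b \<in> A" "a \<otimes>\<^bsub>B\<^esub> b \<in> p" for b
          using p_prime[OF a(1) that] a(2) by blast
              show "\<zero>\<^bsub>B\<^esub> \<in> p"
          using additive_subgroup.zero_closed[OF p.additive_subgroup_axioms] by simp
      qed (rule U(1))
      have "torsion_killed B p a U (generate_ring B (A \<union> derivative ` index))"
      proof (rule torsion_killed_tower[OF subA _ U(1,3) pA a(1) base])
        show "derivative ` index \<subseteq> carrier B" using derivative_closed by blast
        show "tame_extension B U (generate_ring B (A \<union> derivative ` {j \<in> index. j < i})) (derivative i)"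
          if "i \<in> index" for i
          using tame[OF U(1,2) Udiv that] by (simp only: lower_def)
      qed
      thus ?thesis by (simp only: top)
    qed
    \<comment> \<open>Avoiding \<open>V\<close> encodes both requirements: with
      \<open>a = \<one>\<close> it keeps the prime inside \<open>q\<close>, and with
      \<open>t = \<one>\<close> it lets the prime meet \<open>A\<close> only in
      \<open>p\<close>.\<close>
    define V where "V = {a \<otimes>\<^bsub>B\<^esub> t | a t. a \<in> A \<and> a \<notin> p \<and> t \<in> U}"
    have VI: "a \<otimes>\<^bsub>B\<^esub> t \<in> V" if "a \<in> A" "a \<notin> p" "t \<in> U" for a t using that by (auto simp: V_def)
    have tU: "t \<in> carrier B" if "t \<in> U" for t using that by (simp add: U_def)
    have aA: "a \<in> carrier B" if "a \<in> A" for a using that AE(1) by blast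
    have "\<exists>Q. prime_differential_ideal \<Delta> B Q \<and> I \<subseteq> Q \<and> Q \<inter> V = {}"
    proof (rule prime_differential_ideal_avoiding[OF divisible])
      show "diff_ideal I" unfolding I_def by (rule ideal_span_diff_ideal[OF pc der_p])
      show "\<one>\<^bsub>B\<^esub> \<in> V" using VI[OF AE(3) p1 U(1)] by simp
      show "V \<subseteq> carrier B" using tU aA by (auto simp: V_def)
      show "u \<otimes>\<^bsub>B\<^esub> v \<in> V" if uv: "u \<in> V" "v \<in> V" for u v
      proof -
        obtain a t b r where *: "u = a \<otimes>\<^bsub>B\<^esub> t" "a \<in> A" "a \<notin> p" "t \<in> U" "v = b \<otimes>\<^bsub>B\<^esub> r" "b \<in> A" "b \<notin> p" "r \<in> U"
          using uv by (auto simp: V_def)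
        have "u \<otimes>\<^bsub>B\<^esub> v = (a \<otimes>\<^bsub>B\<^esub> b) \<otimes>\<^bsub>B\<^esub> (t \<otimes>\<^bsub>B\<^esub> r)"
          using * tU aA by (simp add: m_ac)
        thus ?thesis using VI[OF AE(6)[OF *(2,6)] _ U(3)[OF *(4,8)]] p_prime * by auto
      qed
      show "I \<inter> V = {}"
      proof (rule ccontr)
        \<comment> \<open>Killing torsion replaces \<open>a\<close> by some
          \<open>t' \<in> U\<close>, so \<open>t' \<otimes> t\<close> lies in \<open>I\<close> and
          hence in \<open>q\<close>, although both factors lie outside the prime
          \<open>q\<close>.\<close>
        assume "I \<inter> V \<noteq> {}"
        then obtain a t where at: "a \<in> A" "a \<notin> p" "t \<in> U" "a \<otimes>\<^bsub>B\<^esub> t \<in> I" by (auto simp: V_def)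
        then obtain t' where "t' \<in> U" "t' \<otimes>\<^bsub>B\<^esub> t \<in> I"
          using torsion[OF at(1,2), unfolded torsion_killed_def, folded I_def, THEN bspec,
              OF tU[OF at(3)], THEN mp, OF at(4)] by blast
        hence "t' \<otimes>\<^bsub>B\<^esub> t \<in> U" "t' \<otimes>\<^bsub>B\<^esub> t \<in> q" using U(3) at(3) Iq by auto
        thus False by (simp add: U_def)
      qed
    qed auto
    then obtain Q where Q: "prime_differential_ideal \<Delta> B Q" "I \<subseteq> Q" "Q \<inter> V = {}" by blast
    interpret Q: primeideal Q B using Q(1) by (simp add: prime_differential_ideal_def)
    have Qc: "Q \<subseteq> carrier B" by (rule Q.a_subset)
    have "Q \<subseteq> q"
    proof
      fix x assume x: "x \<in> Q"
      show "x \<in> q"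
      proof (rule ccontr)
        assume "x \<notin> q"
        hence "x \<in> U" using x Qc by (auto simp: U_def)
        hence "x \<in> V" using VI[OF AE(3) p1] x Qc by force
        thus False using x Q(3) by blast
      qed
    qed
    moreover have "Q \<inter> A = p"
    proof
      show "p \<subseteq> Q \<inter> A"
      proof
        fix x assume x: "x \<in> p"
        hence "x \<otimes>\<^bsub>B\<^esub> \<one>\<^bsub>B\<^esub> \<in> I" using I(5) by blast
        moreover have "x \<otimes>\<^bsub>B\<^esub> \<one>\<^bsub>B\<^esub> = x" using x pc by auto
        ultimately show "x \<in> Q \<inter> A" using x pA Q(2) by auto
      qed
      show "Q \<inter> A \<subseteq> p"
      proof
        fix x assume x: "x \<in> Q \<inter> A"
        show "x \<in> p"
        proof (rule ccontr)
          assume "x \<notin> p"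
          hence "x \<in> V" using VI[of x "\<one>\<^bsub>B\<^esub>"] U(1) x aA by auto
          thus False using x Q(3) by blast
        qed
      qed
    qed
    ultimately show ?thesis using Q(1) by blast
  qed
  thus ?thesis using s by blast
qed

text \<open>Chains are extended one prime at a time. The single step applies because
  \<open>p (Suc k) \<subseteq> p k\<close>, and \<open>p k\<close>, as the trace of the last prime
  found, lies in that prime.\<close>

lemma going_downI_single_step:
  fixes A :: "('a, 'd, 'm) diff_ring_scheme" and B :: "('b, 'd, 'n) diff_ring_scheme"
  assumes hom: "differential_hom \<Delta> A B f"
    and step: "\<And>P Q. \<lbrakk>prime_differential_ideal \<Delta> (B\<lparr>carrier := f ` carrier A\<rparr>) P;
        prime_differential_ideal \<Delta> B Q; P \<subseteq> Q\<rbrakk>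
      \<Longrightarrow> \<exists>Q'. prime_differential_ideal \<Delta> B Q' \<and> Q' \<subseteq> Q \<and> Q' \<inter> f ` carrier A = P"
  shows "going_down \<Delta> A B f"
  unfolding going_down_def
proof (intro conjI allI impI, rule hom)
  fix n m :: nat and p q
  assume "1 \<le> m \<and> m < n \<and>
        (\<forall>i\<in>{1..n}. prime_differential_ideal \<Delta> (B\<lparr>carrier := f ` carrier A\<rparr>) (p i)) \<and>
        (\<forall>i\<in>{1..<n}. p (Suc i) \<subseteq> p i) \<and>
        (\<forall>i\<in>{1..m}. prime_differential_ideal \<Delta> B (q i)) \<and>
        (\<forall>i\<in>{1..<m}. q (Suc i) \<subseteq> q i) \<and>
        (\<forall>i\<in>{1..m}. q i \<inter> f ` carrier A = p i)"
  hence mn: "1 \<le> m" "m < n"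
    and p: "\<And>i. i \<in> {1..n} \<Longrightarrow> prime_differential_ideal \<Delta> (B\<lparr>carrier := f ` carrier A\<rparr>) (p i)"
      "\<And>i. i \<in> {1..<n} \<Longrightarrow> p (Suc i) \<subseteq> p i"
    and q: "\<forall>i\<in>{1..m}. prime_differential_ideal \<Delta> B (q i)" "\<forall>i\<in>{1..<m}. q (Suc i) \<subseteq> q i"
      "\<forall>i\<in>{1..m}. q i \<inter> f ` carrier A = p i" by blast+
  have "\<exists>q'. (\<forall>i\<in>{1..m}. q' i = q i) \<and> (\<forall>i\<in>{1..m + j}. prime_differential_ideal \<Delta> B (q' i)) \<and>
      (\<forall>i\<in>{1..<m + j}. q' (Suc i) \<subseteq> q' i) \<and> (\<forall>i\<in>{1..m + j}. q' i \<inter> f ` carrier A = p i)"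
    if "m + j \<le> n" for j
    using that
  proof (induction j)
    case 0
    show ?case using q by (intro exI[of _ q]) simp
  next
    case (Suc j)
    let ?k = "m + j"
    have "?k \<le> n" using Suc.prems by simp
    then obtain q' where "\<forall>i\<in>{1..m}. q' i = q i"
      "\<forall>i\<in>{1..?k}. prime_differential_ideal \<Delta> B (q' i)"
      "\<forall>i\<in>{1..<?k}. q' (Suc i) \<subseteq> q' i" "\<forall>i\<in>{1..?k}. q' i \<inter> f ` carrier A = p i"
      using Suc.IH by blast
    note q' = this[THEN bspec]
    have k: "?k \<in> {1..?k}" "?k \<in> {1..<n}" "Suc ?k \<in> {1..n}" using mn Suc.prems by auto
    have "p (Suc ?k) \<subseteq> q' ?k" using p(2)[OF k(2)] q'(4)[OF k(1)] by blast
    from step[OF p(1)[OF k(3)] q'(2)[OF k(1)] this] obtain Q where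
      Q: "prime_differential_ideal \<Delta> B Q" "Q \<subseteq> q' ?k" "Q \<inter> f ` carrier A = p (Suc ?k)" by blast
    define r where "r i = (if i = Suc ?k then Q else q' i)" for i
    have "r i = q i" if "i \<in> {1..m}" for i using that q'(1) by (simp add: r_def)
    moreover have "prime_differential_ideal \<Delta> B (r i)" "r i \<inter> f ` carrier A = p i"
      if "i \<in> {1..m + Suc j}" for i
      using that q'(2,4)[of i] Q by (auto simp: r_def le_Suc_eq)
    moreover have "r (Suc i) \<subseteq> r i" if "i \<in> {1..<m + Suc j}" for i
      using that q'(3)[of i] Q(2) by (cases "i = ?k") (auto simp: r_def)
    ultimately show ?case by (intro exI[of _ r]) blast
  qed
  from this[of "n - m"] mn show "\<exists>q'. (\<forall>i\<in>{1..m}. q' i = q i) \<and> (\<forall>i\<in>{1..n}. prime_differential_ideal \<Delta> B (q' i)) \<and>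
      (\<forall>i\<in>{1..<n}. q' (Suc i) \<subseteq> q' i) \<and> (\<forall>i\<in>{1..n}. q' i \<inter> f ` carrier A = p i)"
    by simp
qed

text \<open>A prime of the localization is contracted to \<open>B\<close>, where
  \<open>going_down_denominator\<close> applies, and the smaller prime found there is extended
  again.\<close>

theorem theorem15:
  fixes \<Delta> :: "'d set"
    and B :: "('a, 'd, 'm) diff_ring_scheme"
    and A :: "'a set"
  assumes "ritt_algebra \<Delta> B" and "domain B"
    and "differential_subring \<Delta> A B"
    and "ritt_algebra \<Delta> (B\<lparr>carrier := A\<rparr>)" and "domain (B\<lparr>carrier := A\<rparr>)"
    and "differentially_finitely_generated \<Delta> A B"
  shows "\<exists>s\<in>carrier B. s \<noteq> \<zero>\<^bsub>B\<^esub> \<and>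
           going_down \<Delta> (B\<lparr>carrier := A\<rparr>) (localization B s) (to_localization B s)"
proof -
  interpret domain B by fact
  have diffB: "differential_ring \<Delta> B" using assms(1) by (simp add: ritt_algebra_def)
  interpret diff_cring B \<Delta> by unfold_locales (rule diffB)
  have subA: "subring A B" and derA: "\<And>\<delta> x. \<lbrakk>\<delta> \<in> \<Delta>; x \<in> A\<rbrakk> \<Longrightarrow> der B \<delta> x \<in> A"
    using assms(3) by (auto simp: differential_subring_def)
  have Ac: "\<And>a. a \<in> A \<Longrightarrow> a \<in> carrier B" using subringE(1)[OF subA] by blast
  obtain s where s: "s \<in> carrier B" "s \<noteq> \<zero>\<^bsub>B\<^esub>"
    and down: "\<And>p q. \<lbrakk>prime_differential_ideal \<Delta> (B\<lparr>carrier := A\<rparr>) p; prime_differential_ideal \<Delta> B q;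
       s \<notin> q; p \<subseteq> q\<rbrakk> \<Longrightarrow> \<exists>q'. prime_differential_ideal \<Delta> B q' \<and> q' \<subseteq> q \<and> q' \<inter> A = p"
    using going_down_denominator[OF assms(1-3,6)] by blast
  interpret localized_domain B \<Delta> s by unfold_locales (rule s)+
  let ?A = "B\<lparr>carrier := A\<rparr>"
  let ?f = "to_localization B s"
  let ?fA = "Rs\<lparr>carrier := ?f ` A\<rparr>"
  have homA: "?f \<in> ring_hom ?A Rs"
    using to_localization_hom Ac by (auto simp: ring_hom_def)
  have "going_down \<Delta> ?A Rs ?f"
  proof (rule going_downI_single_step)
    show "differential_hom \<Delta> ?A Rs ?f"
      using assms(4) localization_differential_ring homA to_localization_der Ac
      by (auto simp: differential_hom_def ritt_algebra_def)
    fix P Q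
    assume "prime_differential_ideal \<Delta> (Rs\<lparr>carrier := ?f ` carrier ?A\<rparr>) P"
      and Q: "prime_differential_ideal \<Delta> Rs Q" and PQ: "P \<subseteq> Q"
    hence P: "prime_differential_ideal \<Delta> ?fA P" by simp
    interpret P: primeideal P ?fA using P by (simp add: prime_differential_ideal_def)
    define p where "p = {a \<in> A. ?f a \<in> P}"
    define q where "q = {a \<in> carrier B. ?f a \<in> Q}"
    have "prime_differential_ideal \<Delta> ?A p"
      unfolding prime_differential_ideal_def
    proof
      interpret A: domain ?A by fact
      \<comment> \<open>\<open>P\<close> is a prime of the image ring only, so it is pulled back
        along the map onto that image.\<close>
      interpret f: ring_hom_cring ?A ?fA ?f
        by (intro ring_hom_cring.intro ring_hom_cring_axioms.intro A.is_cring P.is_cring)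
          (use homA in \<open>auto simp: ring_hom_def\<close>)
      show "primeideal p ?A"
        using f.ring.primeideal_vimage[OF A.is_cring P.primeideal_axioms] by (simp add: p_def)
      show "\<forall>\<delta>\<in>\<Delta>. \<forall>x\<in>p. der ?A \<delta> x \<in> p"
        using P derA Ac by (auto simp: p_def to_localization_der prime_differential_ideal_def)
    qed
    moreover note contraction_prime(1,2)[OF Q, folded q_def]
    moreover have "p \<subseteq> q" using PQ Ac by (auto simp: p_def q_def)
    ultimately obtain q' where q': "prime_differential_ideal \<Delta> B q'" "q' \<subseteq> q" "q' \<inter> A = p"
      using down by blast
    have sq: "s \<notin> q'" using q'(2) contraction_prime(2)[OF Q, folded q_def] by blast
    have f_mem: "?f a \<in> extension q' \<longleftrightarrow> a \<in> q'" if "a \<in> A" for a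
      using fraction_in_extension_iff[OF q'(1) sq Ac[OF that] powers_one]
      by (simp add: to_localization_def)
    \<comment> \<open>A numerator in \<open>q'\<close> lies in the contraction \<open>q\<close> of
      \<open>Q\<close>, and membership in \<open>Q\<close> depends on the numerator alone.\<close>
    have "extension q' \<subseteq> Q"
      using q'(2) contraction_prime(3)[OF Q] by (auto simp: extension_def q_def)
    moreover have "extension q' \<inter> ?f ` carrier ?A = P"
    proof (intro equalityI subsetI)
      fix x assume "x \<in> extension q' \<inter> ?f ` carrier ?A"
      thus "x \<in> P" using f_mem q'(3) by (auto simp: p_def)
    next
      fix x assume x: "x \<in> P"
      then obtain a where "a \<in> A" "x = ?f a" using P.a_subset by auto
      moreover from this have "a \<in> q'" using x q'(3) by (auto simp: p_def)
      ultimately show "x \<in> extension q' \<inter> ?f ` carrier ?A" using f_mem by auto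
    qed
    ultimately show "\<exists>Q'. prime_differential_ideal \<Delta> Rs Q' \<and> Q' \<subseteq> Q \<and> Q' \<inter> ?f ` carrier ?A = P"
      using extension_prime[OF q'(1) sq] by blast
  qed
  thus ?thesis using s by blast
qed

end
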